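(* Let $c,m\geq 1$ be integers, let $H$ be a finite group and $\rho: H \to \mathrm{GL}_n(\mathbb{Q})$ a $\mathbb{Q}$-irreducible representation. Then there exists a $c$-hyperbolic, integer-like matrix $C\in \mathrm{GL}_{mn}(\mathbb{Q})$ which commutes with (every matrix in the image of) $m \rho=\underbrace{\rho\oplus \rho \oplus \cdots \oplus \rho}_{m\text{ times}}$ if and only if $\rho$ splits in strictly more than $\frac{c}{m}$ components when seen as a representation over $\mathbb{R}$.
   Context: A matrix $C\in \mathrm{GL}_n(\mathbb{Q})$ is called integer-like if its characteristic polynomial has coefficients in $\mathbb{Z}$ and its determinant is $\pm 1$. A matrix is called $c$-hyperbolic if there do not exist an integer $k$ with $1\le k\leq c$ and $k$ (not necessarily different) complex eigenvalues of the matrix whose product has absolute value equal to $1$. "Splits in $k$ components over $\mathbb{R}$" means that the representation, with scalars extended to $\mathbb{R}$, is a direct sum of $k$ $\mathbb{R}$-irreducible representations (counted with multiplicity). *)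

theory Defs
  imports "Jordan_Normal_Form.Spectral_Radius" "Jordan_Normal_Form.VS_Connect"
begin

definition GL :: "nat \<Rightarrow> 'a::field mat monoid" where
  "GL n = units_of (ring_mat TYPE('a) n ())"

text \<open>A representation of degree \<open>n\<close> over the field \<open>'a\<close>; its values outside the carrier of the
  group are irrelevant.\<close>

definition representation ::
    "('h, 'b) monoid_scheme \<Rightarrow> nat \<Rightarrow> ('h \<Rightarrow> 'a::field mat) \<Rightarrow> bool" where
  "representation H n \<rho> \<longleftrightarrow> \<rho> \<in> hom H (GL n)"

text \<open>The field of scalars is the type \<open>'a\<close>: irreducibility is over \<open>'a\<close>, and the zero
  representation is not irreducible.\<close>

definition irreducible_rep ::
    "('h, 'b) monoid_scheme \<Rightarrow> nat \<Rightarrow> ('h \<Rightarrow> 'a::field mat) \<Rightarrow> bool" where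
  "irreducible_rep H n \<rho> \<longleftrightarrow>
     representation H n \<rho> \<and> n > 0 \<and>
     (\<forall>W. VectorSpace.subspace class_ring W (module_vec TYPE('a) n) \<and>
          (\<forall>h \<in> carrier H. \<forall>w \<in> W. \<rho> h *\<^sub>v w \<in> W)
        \<longrightarrow> W = {0\<^sub>v n} \<or> W = carrier_vec n)"

definition equivalent_rep ::
    "('h, 'b) monoid_scheme \<Rightarrow> nat \<Rightarrow> ('h \<Rightarrow> 'a::field mat) \<Rightarrow> ('h \<Rightarrow> 'a mat) \<Rightarrow> bool" where
  "equivalent_rep H n \<rho> \<sigma> \<longleftrightarrow>
     representation H n \<rho> \<and> representation H n \<sigma> \<and>
     (\<exists>P \<in> carrier (GL n). \<forall>h \<in> carrier H. \<rho> h * P = P * \<sigma> h)"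

definition direct_sum_rep :: "('h \<Rightarrow> 'a::zero mat) list \<Rightarrow> 'h \<Rightarrow> 'a mat" where
  "direct_sum_rep \<sigma>s h = diag_block_mat (map (\<lambda>\<sigma>. \<sigma> h) \<sigma>s)"

definition multiple_rep :: "nat \<Rightarrow> ('h \<Rightarrow> 'a::zero mat) \<Rightarrow> 'h \<Rightarrow> 'a mat" where
  "multiple_rep m \<rho> = direct_sum_rep (replicate m \<rho>)"

definition real_extension :: "('h \<Rightarrow> rat mat) \<Rightarrow> 'h \<Rightarrow> real mat" where
  "real_extension \<rho> h = map_mat of_rat (\<rho> h)"

text \<open>The summands form a list, so isomorphic components are counted with multiplicity.\<close>

definition splits_in_components ::
    "('h, 'b) monoid_scheme \<Rightarrow> nat \<Rightarrow> ('h \<Rightarrow> 'a::field mat) \<Rightarrow> nat \<Rightarrow> bool" where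
  "splits_in_components H n \<rho> k \<longleftrightarrow>
     (\<exists>\<sigma>s. length \<sigma>s = k \<and> (\<forall>\<sigma> \<in> set \<sigma>s. \<exists>d. irreducible_rep H d \<sigma>) \<and>
           equivalent_rep H n \<rho> (direct_sum_rep \<sigma>s))"

definition integer_like :: "rat mat \<Rightarrow> bool" where
  "integer_like C \<longleftrightarrow> (\<forall>i. coeff (char_poly C) i \<in> \<int>) \<and> (det C = 1 \<or> det C = -1)"

text \<open>An eigenvalue may occur in the list any number of times, independently of its multiplicity
  as a root of the characteristic polynomial.\<close>

definition c_hyperbolic :: "nat \<Rightarrow> rat mat \<Rightarrow> bool" where
  "c_hyperbolic c C \<longleftrightarrow>
     \<not> (\<exists>ls :: complex list. 1 \<le> length ls \<and> length ls \<le> c \<and>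
          set ls \<subseteq> spectrum (map_mat of_rat C) \<and> cmod (prod_list ls) = 1)"

end

theory Submission
  imports Defs "Jordan_Normal_Form.DL_Rank"
    "Jordan_Normal_Form.Jordan_Normal_Form_Uniqueness"
begin

text \<open>Let \<open>\<rho>\<close> split over \<open>\<real>\<close> into \<open>k\<close> components. Approximating the operator that acts on the
  \<open>j\<close>-th component as the scalar \<open>j\<close>, and averaging over \<open>H\<close>, gives a rational matrix \<open>S\<close> that commutes
  with \<open>\<rho>\<close> and is self-adjoint for an invariant inner product. By Schur's lemma over \<open>\<rat>\<close> all eigenvalues
  of \<open>S\<close> have the same multiplicity \<open>N\<close>, and a dimension count in the flag of sums of eigenspaces shows
  that \<open>S\<close> has exactly \<open>k\<close> eigenvalues and that all real components have degree \<open>N\<close>.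

  Hence all real invariant subspaces of \<open>m \<rho>\<close> have dimension divisible by \<open>N\<close>. If \<open>C\<close> commutes with
  \<open>m \<rho>\<close>, this yields \<open>m k\<close> eigenvalues of \<open>C\<close> whose product has absolute value \<open>|det C|\<close> to the power
  \<open>1 / N\<close>, so \<open>C\<close> is not \<open>c\<close>-hyperbolic if it is integer-like and \<open>m k \<le> c\<close>.

  Conversely, let \<open>Z\<close> be an integral multiple of \<open>S\<close>. Dirichlet's argument in \<open>\<int>[Z]\<close> gives, for
  arbitrarily large \<open>b\<close>, an integral matrix \<open>w\<close> of determinant 1 with one eigenvalue comparable to
  \<open>b ^ (k - 1)\<close> and the others comparable to \<open>1 / b\<close>. Let \<open>C\<close> be the block companion matrix of
  \<open>X ^ m = w ^ m * (1 + (b * X) ^ (m - 1))\<close>, without the second summand if \<open>m = 1\<close>. Up to factors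
  independent of \<open>b\<close>, each eigenvalue of \<open>C\<close> times \<open>b\<close> is \<open>1\<close> or \<open>b ^ (m * k)\<close> in absolute value. A
  product of \<open>L\<close> eigenvalues is thus comparable to \<open>b ^ (m * k * p - L)\<close> for some \<open>p\<close>, and the exponent
  is not 0 if \<open>0 < L < m * k\<close>.\<close>

section \<open>Dimension of subspaces\<close>

text \<open>The projections onto the real components are irrational in general, so Schur's lemma
  over \<rat> says nothing about them. What survives approximation is \<open>S\<close>: averaged
  forms are symmetric and invariant in any coordinates, so only the coordinates are approximated,
  and having at least k eigenvalues is an open condition. The flag turns "at least" into "exactly".
  Real, complex and quaternionic components are never told apart; a component enters only through
  its degree.

  For m > 1, repeating \<open>w\<close> along the diagonal would not do: the k eigenvalues of
  \<open>w\<close> already have product \<plusminus>1. The companion matrix distributes the sizes as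
  unevenly as possible. With \<mu> = b X and W = b \<omega>, for an eigenvalue \<omega> of
  \<open>w\<close>, its equation reads \<mu>^m = W^m (1 + \<mu>^(m - 1)). If W has order 1, so have
  all roots; if W has order b^k, one root has order W^m and the other m - 1 stay near the roots of 1
  + \<mu>^(m - 1). The power \<open>w ^ m\<close> is what matches the factor b^m coming from (b
  X)^m, and as its determinant is 1 the companion matrix stays invertible over \<int>.\<close>

lemma subspace_iff:
  "VectorSpace.subspace class_ring W (module_vec TYPE('a::field) n) \<longleftrightarrow>
     W \<subseteq> carrier_vec n \<and> 0\<^sub>v n \<in> W \<and> (\<forall>v \<in> W. \<forall>w \<in> W. v + w \<in> W) \<and> (\<forall>c. \<forall>v \<in> W. c \<cdot>\<^sub>v v \<in> W)"
  unfolding subspace_def submodule_def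
  using vec_vs[of n, where ?'a = 'a] vec_module[of n, where ?'a = 'a]
  by (auto simp: module_vec_simps class_ring_simps)

definition sdim :: "nat \<Rightarrow> 'a::field vec set \<Rightarrow> nat" where
  "sdim n W = vectorspace.dim class_ring (module_vec TYPE('a) n\<lparr>carrier := W\<rparr>)"

lemma sdim_carrier: "sdim n (carrier_vec n :: 'a::field vec set) = n"
proof -
  interpret vec_space "TYPE('a)" n .
  have "module_vec TYPE('a) n\<lparr>carrier := carrier_vec n\<rparr> = module_vec TYPE('a) n"
    by (simp add: module_vec_def)
  then show ?thesis unfolding sdim_def using dim_is_n by (rule ssubst)
qed

text \<open>A maximal independent subset of \<open>W\<close> is enlarged to a maximal independent
  subset of the whole space. The columns of \<open>P\<close> list these vectors, those of
  \<open>W\<close> first, so \<open>W\<close> consists of the vectors whose coordinates vanish from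
  \<open>sdim n W\<close> on.\<close>

lemma subspace_adapted_basis:
  fixes W :: "'a::field vec set"
  assumes W: "VectorSpace.subspace class_ring W (module_vec TYPE('a) n)"
  obtains P where "P \<in> carrier_mat n n" "det P \<noteq> 0" "sdim n W \<le> n"
    "W = {P *\<^sub>v v |v. v \<in> carrier_vec n \<and> (\<forall>j<n. sdim n W \<le> j \<longrightarrow> v $ j = 0)}"
    "vectorspace.fin_dim class_ring (module_vec TYPE('a) n\<lparr>carrier := W\<rparr>)"
proof -
  interpret vec_space "TYPE('a)" n .
  interpret W: vectorspace class_ring "vs W" by (rule subspace_is_vs[OF W])
  have sm: "submodule class_ring W V" using W by (simp add: subspace_def)
  have Wc: "W \<subseteq> carrier_vec n" using W by (simp add: subspace_iff)
  have li: "W.lin_indpt S \<longleftrightarrow> lin_indpt S" if "S \<subseteq> W" for S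
    using span_li_not_depend(2)[OF that sm] by simp
  have sp: "W.span S = span S" if "S \<subseteq> W" for S
    using span_li_not_depend(1)[OF that sm] by simp
  obtain b where b: "finite b" "maximal b (\<lambda>S. S \<subseteq> W \<and> lin_indpt S)"
  proof -
    have "\<exists>A. finite A \<and> maximal A (\<lambda>S. S \<subseteq> W \<and> lin_indpt S)"
    proof (rule maximal_exists[of "\<lambda>S. S \<subseteq> W \<and> lin_indpt S" n "{}"])
      fix A assume A: "A \<subseteq> W \<and> lin_indpt A"
      show "finite A \<and> card A \<le> n"
        using li_le_dim[of A] A Wc dim_is_n by auto
    next
      show "{} \<subseteq> W \<and> lin_indpt {}" by (auto simp: lin_dep_def)
    qed
    then show ?thesis using that by blast
  qed
  have bW: "b \<subseteq> W" "lin_indpt b" using b(2) by (auto simp: maximal_def)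
  have "W.basis b"
  proof (rule W.max_li_is_basis)
    show "maximal b (\<lambda>S. S \<subseteq> carrier (vs W) \<and> W.lin_indpt S)"
      using b(2) li unfolding maximal_def by auto
  qed
  then have spb: "span b = W" and dimW: "W.dim = card b" and fd: "W.fin_dim"
    using sp[OF bW(1)] W.dim_basis[of b] b(1)
    unfolding W.basis_def W.fin_dim_def by auto
  have sd: "sdim n W = card b" unfolding sdim_def using dimW by simp
  \<comment> \<open>A set that is maximal among the independent supersets of \<open>b\<close> is
    maximal among all independent sets, since whatever contains it contains \<open>b\<close> as
    well.\<close>
  obtain A where A: "b \<subseteq> A" "finite A" "maximal A (\<lambda>S. S \<subseteq> carrier_vec n \<and> lin_indpt S)"
  proof -
    have "\<exists>A. finite A \<and> maximal A (\<lambda>S. b \<subseteq> S \<and> S \<subseteq> carrier_vec n \<and> lin_indpt S)"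
    proof (rule maximal_exists[of "\<lambda>S. b \<subseteq> S \<and> S \<subseteq> carrier_vec n \<and> lin_indpt S" n b])
      fix A assume A: "b \<subseteq> A \<and> A \<subseteq> carrier_vec n \<and> lin_indpt A"
      show "finite A \<and> card A \<le> n"
        using li_le_dim[of A] A dim_is_n by auto
    next
      show "b \<subseteq> b \<and> b \<subseteq> carrier_vec n \<and> lin_indpt b" using bW Wc by auto
    qed
    then obtain A where "finite A" "maximal A (\<lambda>S. b \<subseteq> S \<and> S \<subseteq> carrier_vec n \<and> lin_indpt S)" by blast
    then show ?thesis using that[of A] order_trans[of b A] unfolding maximal_def by meson
  qed
  have bA: "basis A" using max_li_is_basis[of A] A(3) by simp
  then have cA: "card A = n" and Ac: "A \<subseteq> carrier_vec n" and liA: "lin_indpt A"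
    using dim_basis[of A] A(2) dim_is_n by (auto simp: basis_def)
  obtain xs where xs: "set xs = b" "distinct xs" using finite_distinct_list[OF b(1)] by blast
  obtain ys where ys: "set ys = A - b" "distinct ys" using finite_distinct_list[of "A - b"] A(2) by blast
  define zs where "zs = xs @ ys"
  have zs: "distinct zs" "set zs = A" "length zs = n"
  proof -
    show z1: "distinct zs" and z2: "set zs = A" using xs ys A(1) unfolding zs_def by auto
    show "length zs = n" using distinct_card[OF z1] z2 cA by simp
  qed
  have lxs: "length xs = sdim n W" using xs distinct_card[of xs] sd by simp
  define P where "P = mat_of_cols n zs"
  have P: "P \<in> carrier_mat n n" unfolding P_def using zs by auto
  have zsc: "set zs \<subseteq> carrier_vec n" using zs Ac by simp
  have cP: "cols P = zs" unfolding P_def using cols_mat_of_cols[OF zsc] .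
  have det: "det P \<noteq> 0"
  proof
    assume "det P = 0"
    then obtain v where "v \<in> carrier_vec n" "v \<noteq> 0\<^sub>v n" "P *\<^sub>v v = 0\<^sub>v n"
      using det_0_iff_vec_prod_zero_field[OF P] by blast
    then have "lin_dep (set (cols P))" using lin_depI[OF P] cP zs by auto
    then show False using cP zs liA by simp
  qed
  have "card b \<le> n" using card_mono[OF A(2) A(1)] cA by simp
  then have le: "sdim n W \<le> n" using sd by simp
  have comb: "P *\<^sub>v v = mat_of_cols n xs *\<^sub>v vec (length xs) (\<lambda>i. v $ i)"
    if v: "v \<in> carrier_vec n" "\<forall>j<n. sdim n W \<le> j \<longrightarrow> v $ j = 0" for v
  proof (rule eq_vecI)
    fix i assume "i < dim_vec (mat_of_cols n xs *\<^sub>v vec (length xs) (\<lambda>i. v $ i))"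
    then have i: "i < n" by simp
    have "(P *\<^sub>v v) $ i = (\<Sum>j<n. P $$ (i,j) * v $ j)"
      using i P v by (auto simp: scalar_prod_def atLeast0LessThan)
    also have "\<dots> = (\<Sum>j<length xs. P $$ (i,j) * v $ j)"
      using le v lxs by (intro sum.mono_neutral_right) auto
    also have "\<dots> = (\<Sum>j<length xs. xs ! j $ i * v $ j)"
      using i le lxs zs unfolding P_def
      by (intro sum.cong) (auto simp: mat_of_cols_index zs_def nth_append)
    finally show "(P *\<^sub>v v) $ i = (mat_of_cols n xs *\<^sub>v vec (length xs) (\<lambda>i. v $ i)) $ i"
      using i by (auto simp: scalar_prod_def atLeast0LessThan mat_of_cols_index)
  qed (use P in auto)
  have xsc: "set xs \<subseteq> carrier_vec n" using xs bW Wc by auto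
  have Weq: "W = {P *\<^sub>v v |v. v \<in> carrier_vec n \<and> (\<forall>j<n. sdim n W \<le> j \<longrightarrow> v $ j = 0)}" (is "_ = ?R")
  proof -
    have "W = span_list xs" using spb xs span_list_as_span[OF xsc] by simp
    also have "\<dots> = {mat_of_cols n xs *\<^sub>v vec (length xs) c |c. True}"
    proof -
      have "\<forall>w\<in>set xs. dim_vec w = n" using xsc by auto
      then show ?thesis unfolding span_list_def using lincomb_list_as_mat_mult by auto
    qed
    also have "\<dots> = ?R"
    proof (intro Set.set_eqI iffI)
      fix x assume "x \<in> {mat_of_cols n xs *\<^sub>v vec (length xs) c |c. True}"
      then obtain c where x: "x = mat_of_cols n xs *\<^sub>v vec (length xs) c" by auto
      define v where "v = vec n (\<lambda>i. if i < length xs then c i else 0)"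
      have v: "v \<in> carrier_vec n" "\<forall>j<n. sdim n W \<le> j \<longrightarrow> v $ j = 0" using lxs by (auto simp: v_def)
      have "vec (length xs) (\<lambda>i. v $ i) = vec (length xs) c"
        using le lxs by (intro eq_vecI) (auto simp: v_def)
      then have "x = P *\<^sub>v v" using comb[OF v] x by simp
      then show "x \<in> ?R" using v by blast
    next
      fix x assume "x \<in> ?R"
      then show "x \<in> {mat_of_cols n xs *\<^sub>v vec (length xs) c |c. True}" using comb by auto
    qed
    finally show ?thesis .
  qed
  show ?thesis using that[OF P det le Weq] fd by blast
qed

text \<open>Rank-nullity for the restriction of \<open>M\<close> to \<open>W\<close>; the later
  dimension counts rest on it.\<close>

lemma sdim_mat_image:
  fixes W :: "'a::field vec set"
  assumes W: "VectorSpace.subspace class_ring W (module_vec TYPE('a) n)"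
    and M: "M \<in> carrier_mat m n"
  shows "sdim n W = sdim m ((*\<^sub>v) M ` W) + sdim n {w \<in> W. M *\<^sub>v w = 0\<^sub>v m}"
proof -
  interpret n: vec_space "TYPE('a)" n .
  interpret m: vec_space "TYPE('a)" m .
  interpret W: vectorspace class_ring "n.vs W" by (rule n.subspace_is_vs[OF W])
  have Wc: "\<And>w. w \<in> W \<Longrightarrow> w \<in> carrier_vec n" using W by (auto simp: subspace_iff)
  have hom: "(*\<^sub>v) M \<in> module_hom class_ring (n.vs W) m.V"
    unfolding module_hom_def using M Wc
    by (auto simp: class_ring_simps module_vec_simps intro: mult_add_distrib_mat_vec mult_mat_vec)
  interpret l: linear_map class_ring "n.vs W" m.V "(*\<^sub>v) M"
    unfolding linear_map_def mod_hom_def mod_hom_axioms_def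
    using W.vectorspace_axioms m.vectorspace_axioms hom W.module_axioms m.module_axioms by blast
  obtain P where "W.fin_dim" using subspace_adapted_basis[OF W] by metis
  from l.rank_nullity[OF this] show ?thesis
    unfolding sdim_def l.im_def l.ker_def by (simp add: module_vec_simps)
qed

lemma subspace_mat_image:
  fixes W :: "'a::field vec set"
  assumes W: "VectorSpace.subspace class_ring W (module_vec TYPE('a) n)"
    and M: "M \<in> carrier_mat m n"
  shows "VectorSpace.subspace class_ring ((*\<^sub>v) M ` W) (module_vec TYPE('a) m)"
  unfolding subspace_iff
proof (intro conjI ballI allI)
  have Wc: "\<And>w. w \<in> W \<Longrightarrow> w \<in> carrier_vec n" using W by (auto simp: subspace_iff)
  show "(*\<^sub>v) M ` W \<subseteq> carrier_vec m" using mult_mat_vec_carrier[OF M] Wc by auto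
  show "0\<^sub>v m \<in> (*\<^sub>v) M ` W"
    using W M by (intro image_eqI[of _ _ "0\<^sub>v n"]) (auto simp: subspace_iff)
  fix v w c assume v: "v \<in> (*\<^sub>v) M ` W"
  then obtain v' where v': "v' \<in> W" "v = M *\<^sub>v v'" by auto
  have "c \<cdot>\<^sub>v v' \<in> W" using W v' by (auto simp: subspace_iff)
  then show "c \<cdot>\<^sub>v v \<in> (*\<^sub>v) M ` W"
    using M Wc v' by (intro image_eqI[of _ _ "c \<cdot>\<^sub>v v'"]) (auto simp: mult_mat_vec)
  assume "w \<in> (*\<^sub>v) M ` W"
  then obtain w' where w': "w' \<in> W" "w = M *\<^sub>v w'" by auto
  have "v' + w' \<in> W" using W v' w' by (auto simp: subspace_iff)
  then show "v + w \<in> (*\<^sub>v) M ` W"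
    using M Wc v' w' by (intro image_eqI[of _ _ "v' + w'"]) (auto simp: mult_add_distrib_mat_vec)
qed

lemma subspace_mat_kernel:
  fixes W :: "'a::field vec set"
  assumes W: "VectorSpace.subspace class_ring W (module_vec TYPE('a) n)"
    and M: "M \<in> carrier_mat m n"
  shows "VectorSpace.subspace class_ring {w \<in> W. M *\<^sub>v w = 0\<^sub>v m} (module_vec TYPE('a) n)"
proof -
  have Wc: "\<And>w. w \<in> W \<Longrightarrow> w \<in> carrier_vec n" using W by (auto simp: subspace_iff)
  then show ?thesis
    using W M unfolding subspace_iff
    by (auto simp: mult_add_distrib_mat_vec[OF M] mult_mat_vec[OF M])
qed

lemma subspace_carrier: "VectorSpace.subspace class_ring (carrier_vec n) (module_vec TYPE('a::field) n)"
  by (auto simp: subspace_iff)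

lemma subspace_zero: "VectorSpace.subspace class_ring {0\<^sub>v n} (module_vec TYPE('a::field) n)"
  by (auto simp: subspace_iff)

text \<open>Rank-nullity for the zero map on the zero space reads d = d + d.\<close>

lemma sdim_zero: "sdim n {0\<^sub>v n :: 'a::field vec} = 0"
proof -
  have z: "0\<^sub>m n n *\<^sub>v 0\<^sub>v n = (0\<^sub>v n :: 'a vec)" by (intro eq_vecI) auto
  then have "{w \<in> {0\<^sub>v n :: 'a vec}. 0\<^sub>m n n *\<^sub>v w = 0\<^sub>v n} = {0\<^sub>v n}" by auto
  then show ?thesis
    using sdim_mat_image[OF subspace_zero, of "0\<^sub>m n n :: 'a mat" n n] z by simp
qed

lemma sdim_mat_image_inj:
  fixes W :: "'a::field vec set"
  assumes W: "VectorSpace.subspace class_ring W (module_vec TYPE('a) n)"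
    and M: "M \<in> carrier_mat m n"
    and inj: "\<And>w. w \<in> W \<Longrightarrow> M *\<^sub>v w = 0\<^sub>v m \<Longrightarrow> w = 0\<^sub>v n"
  shows "sdim m ((*\<^sub>v) M ` W) = sdim n W"
proof -
  have "0\<^sub>v n \<in> W" using W by (simp add: subspace_iff)
  then have "{w \<in> W. M *\<^sub>v w = 0\<^sub>v m} = {0\<^sub>v n}" using inj M by auto
  then show ?thesis using sdim_mat_image[OF W M] sdim_zero by simp
qed

section \<open>Invariant subspaces\<close>

lemma GL_iff: "P \<in> carrier (GL n) \<longleftrightarrow> P \<in> carrier_mat n n \<and> det P \<noteq> 0"
  for P :: "'a::field mat"
proof
  assume P: "P \<in> carrier (GL n)"
  then have "P \<in> Units (ring_mat TYPE('a) n ())" by (simp add: GL_def units_of_carrier)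
  then show "P \<in> carrier_mat n n \<and> det P \<noteq> 0"
    using unit_imp_det_non_zero[of P n "()"] by (auto simp: Units_def ring_mat_simps)
next
  assume "P \<in> carrier_mat n n \<and> det P \<noteq> 0"
  then show "P \<in> carrier (GL n)"
    using det_non_zero_imp_unit[of P n "()"] by (simp add: GL_def units_of_carrier)
qed

lemma representation_iff:
  fixes \<rho> :: "'h \<Rightarrow> 'a::field mat"
  shows "representation H n \<rho> \<longleftrightarrow>
    (\<forall>h \<in> carrier H. \<rho> h \<in> carrier_mat n n \<and> det (\<rho> h) \<noteq> 0) \<and>
    (\<forall>g \<in> carrier H. \<forall>h \<in> carrier H. \<rho> (g \<otimes>\<^bsub>H\<^esub> h) = \<rho> g * \<rho> h)"
  by (auto simp: representation_def hom_def GL_iff GL_def units_of_mult ring_mat_simps)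
     (auto simp: GL_iff[unfolded GL_def])

lemma det_inverse_exists:
  fixes A :: "'a::field mat"
  assumes "A \<in> carrier_mat n n" "det A \<noteq> 0"
  obtains B where "B \<in> carrier_mat n n" "A * B = 1\<^sub>m n" "B * A = 1\<^sub>m n" "det B \<noteq> 0"
proof -
  obtain B where B: "B \<in> carrier_mat n n" "A * B = 1\<^sub>m n" "B * A = 1\<^sub>m n"
    using det_non_zero_imp_unit[OF assms, of "()"] by (auto simp: Units_def ring_mat_simps)
  have "det A * det B = 1" using det_mult[OF assms(1) B(1)] B(2) by simp
  then have "det B \<noteq> 0" by auto
  then show ?thesis using that B by blast
qed

lemma zero_mat_mult_vec: "v \<in> carrier_vec n \<Longrightarrow> 0\<^sub>m m n *\<^sub>v v = (0\<^sub>v m :: 'a::semiring_0 vec)"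
  by (intro eq_vecI) auto

lemma mat_mult_zero_vec:
  "A \<in> carrier_mat m n \<Longrightarrow> A *\<^sub>v 0\<^sub>v n = (0\<^sub>v m :: 'a::semiring_0 vec)"
  by (intro eq_vecI) auto

definition invariant_subspace ::
    "('h, 'b) monoid_scheme \<Rightarrow> nat \<Rightarrow> ('h \<Rightarrow> 'a::field mat) \<Rightarrow> 'a vec set \<Rightarrow> bool" where
  "invariant_subspace H n \<rho> W \<longleftrightarrow>
     VectorSpace.subspace class_ring W (module_vec TYPE('a) n) \<and>
     (\<forall>h \<in> carrier H. \<forall>w \<in> W. \<rho> h *\<^sub>v w \<in> W)"

lemma irreducible_rep_iff:
  "irreducible_rep H n \<rho> \<longleftrightarrow> representation H n \<rho> \<and> n > 0 \<and>
     (\<forall>W. invariant_subspace H n \<rho> W \<longrightarrow> W = {0\<^sub>v n} \<or> W = carrier_vec n)"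
  unfolding irreducible_rep_def invariant_subspace_def by blast

lemma invariant_subspace_image:
  fixes \<rho> :: "'h \<Rightarrow> 'a::field mat"
  assumes W: "invariant_subspace H n \<rho> W" and M: "M \<in> carrier_mat m n"
    and comm: "\<And>h w. h \<in> carrier H \<Longrightarrow> w \<in> W \<Longrightarrow> M *\<^sub>v (\<rho> h *\<^sub>v w) = \<sigma> h *\<^sub>v (M *\<^sub>v w)"
  shows "invariant_subspace H m \<sigma> ((*\<^sub>v) M ` W)"
  unfolding invariant_subspace_def
proof (intro conjI ballI)
  show "VectorSpace.subspace class_ring ((*\<^sub>v) M ` W) (module_vec TYPE('a) m)"
    using subspace_mat_image[OF _ M] W by (auto simp: invariant_subspace_def)
  fix h v assume h: "h \<in> carrier H" and v: "v \<in> (*\<^sub>v) M ` W"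
  then obtain w where w: "w \<in> W" "v = M *\<^sub>v w" by auto
  then have "\<rho> h *\<^sub>v w \<in> W" using W h by (auto simp: invariant_subspace_def)
  then have "M *\<^sub>v (\<rho> h *\<^sub>v w) \<in> (*\<^sub>v) M ` W" by (rule imageI)
  then show "\<sigma> h *\<^sub>v v \<in> (*\<^sub>v) M ` W" using comm[OF h w(1)] w(2) by simp
qed

lemma invariant_subspace_kernel:
  fixes \<rho> :: "'h \<Rightarrow> 'a::field mat"
  assumes W: "invariant_subspace H n \<rho> W" and M: "M \<in> carrier_mat m n"
    and comm: "\<And>h w. h \<in> carrier H \<Longrightarrow> w \<in> W \<Longrightarrow> M *\<^sub>v w = 0\<^sub>v m \<Longrightarrow> M *\<^sub>v (\<rho> h *\<^sub>v w) = 0\<^sub>v m"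
  shows "invariant_subspace H n \<rho> {w \<in> W. M *\<^sub>v w = 0\<^sub>v m}"
  using subspace_mat_kernel[OF _ M] W comm by (auto simp: invariant_subspace_def)

lemma direct_sum_rep_Cons:
  "direct_sum_rep (\<sigma> # \<sigma>s) h =
     (let B = \<sigma> h; D = direct_sum_rep \<sigma>s h
      in four_block_mat B (0\<^sub>m (dim_row B) (dim_col D)) (0\<^sub>m (dim_row D) (dim_col B)) D)"
  by (simp add: direct_sum_rep_def Let_def)

lemma direct_sum_rep_carrier:
  assumes "list_all2 (\<lambda>d \<sigma>. \<sigma> h \<in> carrier_mat d d) ds \<sigma>s"
  shows "direct_sum_rep \<sigma>s h \<in> carrier_mat (sum_list ds) (sum_list ds)"
  using assms
proof (induction rule: list_all2_induct)
  case (Cons d ds \<sigma> \<sigma>s)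
  then show ?case by (auto simp: direct_sum_rep_Cons Let_def)
qed (simp add: direct_sum_rep_def)

text \<open>The projections of a direct sum are kept as matrices because images, kernels and
  rank-nullity are stated for matrices above.\<close>

definition proj_first :: "nat \<Rightarrow> nat \<Rightarrow> 'a::field mat" where
  "proj_first d n = mat d (d + n) (\<lambda>(i, j). if i = j then 1 else 0)"

definition proj_last :: "nat \<Rightarrow> nat \<Rightarrow> 'a::field mat" where
  "proj_last d n = mat n (d + n) (\<lambda>(i, j). if j = d + i then 1 else 0)"

lemma proj_first_carrier [simp]: "proj_first d n \<in> carrier_mat d (d + n)"
  and proj_last_carrier [simp]: "proj_last d n \<in> carrier_mat n (d + n)"
  by (simp_all add: proj_first_def proj_last_def)

lemma proj_first_append:
  assumes "a \<in> carrier_vec d" "b \<in> carrier_vec n"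
  shows "proj_first d n *\<^sub>v (a @\<^sub>v b) = a"
proof (rule eq_vecI)
  fix i assume "i < dim_vec a"
  then show "(proj_first d n *\<^sub>v (a @\<^sub>v b)) $ i = a $ i"
    using assms
    by (auto simp: proj_first_def scalar_prod_def if_distrib[of "\<lambda>x. x * _"] cong: if_cong)
qed (use assms in \<open>auto simp: proj_first_def\<close>)

lemma proj_last_append:
  assumes "a \<in> carrier_vec d" "b \<in> carrier_vec n"
  shows "proj_last d n *\<^sub>v (a @\<^sub>v b) = b"
proof (rule eq_vecI)
  fix i assume "i < dim_vec b"
  then show "(proj_last d n *\<^sub>v (a @\<^sub>v b)) $ i = b $ i"
    using assms
    by (auto simp: proj_last_def scalar_prod_def if_distrib[of "\<lambda>x. x * _"] cong: if_cong)
qed (use assms in \<open>auto simp: proj_last_def\<close>)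

lemma block_diag_mult_append:
  assumes "A \<in> carrier_mat d d" "B \<in> carrier_mat n n" "a \<in> carrier_vec d" "b \<in> carrier_vec n"
  shows "four_block_mat A (0\<^sub>m d n) (0\<^sub>m n d) B *\<^sub>v (a @\<^sub>v b) = (A *\<^sub>v a) @\<^sub>v (B *\<^sub>v b)"
  using assms four_block_mat_mult_vec[OF assms(1) zero_carrier_mat zero_carrier_mat assms(2,3,4)]
  by (simp add: zero_mat_mult_vec)

text \<open>An invariant subspace of a direct sum need not be the sum of its parts in the two
  summands. Still, its intersection with the first summand (\<open>W1\<close>) and its projection to
  the second (\<open>W2\<close>) are invariant, and rank-nullity for the second projection makes
  their dimensions add up.\<close>

lemma invariant_subspace_block_diag:
  fixes A B :: "'h \<Rightarrow> 'a::field mat"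
  assumes A: "\<And>h. h \<in> carrier H \<Longrightarrow> A h \<in> carrier_mat d d"
    and B: "\<And>h. h \<in> carrier H \<Longrightarrow> B h \<in> carrier_mat n n"
    and W: "invariant_subspace H (d + n) (\<lambda>h. four_block_mat (A h) (0\<^sub>m d n) (0\<^sub>m n d) (B h)) W"
  defines "W1 \<equiv> (*\<^sub>v) (proj_first d n) ` {w \<in> W. proj_last d n *\<^sub>v w = 0\<^sub>v n}"
    and "W2 \<equiv> (*\<^sub>v) (proj_last d n) ` W"
  shows "invariant_subspace H d A W1" "invariant_subspace H n B W2"
    "sdim (d + n) W = sdim d W1 + sdim n W2"
proof -
  let ?T = "\<lambda>h. four_block_mat (A h) (0\<^sub>m d n) (0\<^sub>m n d) (B h)"
  define M1 :: "'a mat" where "M1 = proj_first d n"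
  define M2 :: "'a mat" where "M2 = proj_last d n"
  have M1: "M1 \<in> carrier_mat d (d + n)" and M2: "M2 \<in> carrier_mat n (d + n)"
    by (simp_all add: M1_def M2_def)
  have split: "\<exists>a b. w = a @\<^sub>v b \<and> a \<in> carrier_vec d \<and> b \<in> carrier_vec n \<and> M1 *\<^sub>v w = a \<and> M2 *\<^sub>v w = b"
    if "w \<in> carrier_vec (d + n)" for w
  proof -
    have "w = vec_first w d @\<^sub>v vec_last w n" using vec_first_last_append[OF that] by simp
    moreover have "vec_first w d \<in> carrier_vec d" "vec_last w n \<in> carrier_vec n" by auto
    ultimately show ?thesis
      unfolding M1_def M2_def by (metis proj_first_append proj_last_append)
  qed
  have act: "M1 *\<^sub>v (?T h *\<^sub>v w) = A h *\<^sub>v (M1 *\<^sub>v w) \<and> M2 *\<^sub>v (?T h *\<^sub>v w) = B h *\<^sub>v (M2 *\<^sub>v w)"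
    if h: "h \<in> carrier H" and w: "w \<in> carrier_vec (d + n)" for h w
  proof -
    obtain a b where ab: "w = a @\<^sub>v b" "a \<in> carrier_vec d" "b \<in> carrier_vec n"
        "M1 *\<^sub>v w = a" "M2 *\<^sub>v w = b"
      using split[OF w] by blast
    have "?T h *\<^sub>v w = (A h *\<^sub>v a) @\<^sub>v (B h *\<^sub>v b)"
      unfolding ab(1) by (rule block_diag_mult_append[OF A[OF h] B[OF h] ab(2,3)])
    then show ?thesis
      using ab A[OF h] B[OF h]
      by (simp add: M1_def M2_def proj_first_append[of _ d _ n] proj_last_append[of _ d _ n])
  qed
  define K where "K = {w \<in> W. M2 *\<^sub>v w = 0\<^sub>v n}"
  have Wc: "w \<in> carrier_vec (d + n)" if "w \<in> W" for w
    using W that by (auto simp: invariant_subspace_def subspace_iff)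
  show "invariant_subspace H n B W2"
    unfolding W2_def M2_def[symmetric]
    by (rule invariant_subspace_image[OF W M2]) (use act Wc in auto)
  have K: "invariant_subspace H (d + n) ?T K"
    unfolding K_def by (rule invariant_subspace_kernel[OF W M2]) (use act Wc mat_mult_zero_vec[OF B] in auto)
  have W1: "W1 = (*\<^sub>v) M1 ` K" by (simp add: W1_def M1_def M2_def K_def)
  show "invariant_subspace H d A W1"
    unfolding W1
    by (rule invariant_subspace_image[OF K M1]) (use act Wc K_def in auto)
  \<comment> \<open>On the kernel of the second projection the first one is injective, so no
    dimension is lost on the way to \<open>W1\<close>.\<close>
  have "sdim d ((*\<^sub>v) M1 ` K) = sdim (d + n) K"
  proof (rule sdim_mat_image_inj[OF _ M1])
    show "VectorSpace.subspace class_ring K (module_vec TYPE('a) (d + n))"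
      using K by (simp add: invariant_subspace_def)
    fix w assume w: "w \<in> K" "M1 *\<^sub>v w = 0\<^sub>v d"
    then obtain a b where "w = a @\<^sub>v b" "M1 *\<^sub>v w = a" "M2 *\<^sub>v w = b"
      using split[OF Wc] unfolding K_def by blast
    then show "w = 0\<^sub>v (d + n)" using w by (auto simp: K_def)
  qed
  moreover have "sdim (d + n) W = sdim n ((*\<^sub>v) M2 ` W) + sdim (d + n) K"
    using sdim_mat_image[OF _ M2] W unfolding K_def invariant_subspace_def by blast
  ultimately show "sdim (d + n) W = sdim d W1 + sdim n W2" by (simp add: W1 W2_def M2_def)
qed

text \<open>\<open>J W\<close> is the set of indices \<open>j\<close> at which the dimension of \<open>W \<inter> (U\<^sub>j \<oplus> U\<^sub>j\<^sub>+\<^sub>1 \<oplus> \<dots>)\<close> jumps.\<close>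

lemma invariant_subspace_dimension_filtration:
  fixes \<sigma>s :: "('h \<Rightarrow> 'a::field mat) list"
  assumes "list_all2 (irreducible_rep H) ds \<sigma>s"
  obtains J where
    "\<And>W. invariant_subspace H (sum_list ds) (direct_sum_rep \<sigma>s) W \<Longrightarrow> J W \<subseteq> {..<length ds}"
    "\<And>W. invariant_subspace H (sum_list ds) (direct_sum_rep \<sigma>s) W \<Longrightarrow>
       sdim (sum_list ds) W = (\<Sum>j\<in>J W. ds ! j)"
    "\<And>W W'. invariant_subspace H (sum_list ds) (direct_sum_rep \<sigma>s) W \<Longrightarrow>
       invariant_subspace H (sum_list ds) (direct_sum_rep \<sigma>s) W' \<Longrightarrow> W \<subseteq> W' \<Longrightarrow> J W \<subseteq> J W'"
proof -
  let ?inv = "\<lambda>ds \<sigma>s. invariant_subspace H (sum_list ds) (direct_sum_rep \<sigma>s)"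
  have "\<exists>J. (\<forall>W. ?inv ds \<sigma>s W \<longrightarrow> J W \<subseteq> {..<length ds}
             \<and> sdim (sum_list ds) W = (\<Sum>j\<in>J W. ds ! j)) \<and>
        (\<forall>W W'. ?inv ds \<sigma>s W \<longrightarrow> ?inv ds \<sigma>s W' \<longrightarrow> W \<subseteq> W' \<longrightarrow> J W \<subseteq> J W')"
    using assms
  proof (induction rule: list_all2_induct)
    case Nil
    have "W = {0\<^sub>v 0}" if "invariant_subspace H 0 \<rho> W" for \<rho> :: "'h \<Rightarrow> 'a mat" and W
      using that by (auto simp: invariant_subspace_def subspace_iff intro!: eq_vecI)
    then have "sdim 0 W = 0" if "invariant_subspace H 0 \<rho> W" for \<rho> :: "'h \<Rightarrow> 'a mat" and W
      using sdim_zero[of 0, where ?'a = 'a] that by metis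
    then show ?case by (intro exI[of _ "\<lambda>_. {}"]) auto
  next
    case (Cons d ds \<sigma> \<sigma>s)
    define n where "n = sum_list ds"
    define M1 :: "'a mat" where "M1 = proj_first d n"
    define M2 :: "'a mat" where "M2 = proj_last d n"
    have M1: "M1 \<in> carrier_mat d (d + n)" and M2: "M2 \<in> carrier_mat n (d + n)"
      by (simp_all add: M1_def M2_def)
    obtain J where J0: "\<forall>W. ?inv ds \<sigma>s W \<longrightarrow> J W \<subseteq> {..<length ds} \<and>
          sdim (sum_list ds) W = (\<Sum>j\<in>J W. ds ! j)"
        and J3: "\<forall>W W'. ?inv ds \<sigma>s W \<longrightarrow> ?inv ds \<sigma>s W' \<longrightarrow> W \<subseteq> W' \<longrightarrow> J W \<subseteq> J W'"
      using Cons.IH by (elim exE conjE) (rule that)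
    have J: "J W \<subseteq> {..<length ds}" "sdim n W = (\<Sum>j\<in>J W. ds ! j)" if "?inv ds \<sigma>s W" for W
      using J0 that by (simp_all add: n_def)
    have \<sigma>: "\<sigma> h \<in> carrier_mat d d" if "h \<in> carrier H" for h
      using Cons(1) that by (auto simp: irreducible_rep_iff representation_iff)
    have D: "direct_sum_rep \<sigma>s h \<in> carrier_mat n n" if "h \<in> carrier H" for h
      unfolding n_def
    proof (rule direct_sum_rep_carrier, rule list_all2_mono[OF Cons(2)])
      fix d \<tau> assume "irreducible_rep H d \<tau>"
      then show "\<tau> h \<in> carrier_mat d d" using that by (auto simp: irreducible_rep_iff representation_iff)
    qed
    have T: "direct_sum_rep (\<sigma> # \<sigma>s) h = four_block_mat (\<sigma> h) (0\<^sub>m d n) (0\<^sub>m n d) (direct_sum_rep \<sigma>s h)"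
      if "h \<in> carrier H" for h
      using carrier_matD[OF \<sigma>[OF that]] carrier_matD[OF D[OF that]] by (simp add: direct_sum_rep_Cons Let_def)
    define K where "K W = {w \<in> W. M2 *\<^sub>v w = 0\<^sub>v n}" for W
    \<comment> \<open>By irreducibility \<open>W\<close> meets the first summand in 0 or contains
      all of it, which decides whether index 0 is taken and contributes 0 or d. The other indices
      come from the projection of \<open>W\<close> to the remaining summands, shifted by
      one.\<close>
    define J' where "J' W = (if (*\<^sub>v) M1 ` K W = {0\<^sub>v d} then {} else {0}) \<union> Suc ` J ((*\<^sub>v) M2 ` W)" for W
    have main: "J' W \<subseteq> {..<length (d # ds)} \<and> sdim (d + n) W = (\<Sum>j\<in>J' W. (d # ds) ! j)
        \<and> ?inv ds \<sigma>s ((*\<^sub>v) M2 ` W) \<and> (\<forall>w \<in> W. w \<in> carrier_vec (d + n)) \<and> 0\<^sub>v (d + n) \<in> W"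
      if W: "invariant_subspace H (d + n) (direct_sum_rep (\<sigma> # \<sigma>s)) W" for W
    proof -
      have Wc: "w \<in> carrier_vec (d + n)" if "w \<in> W" for w
        using W that by (auto simp: invariant_subspace_def subspace_iff)
      have W0: "0\<^sub>v (d + n) \<in> W" using W by (auto simp: invariant_subspace_def subspace_iff)
      have "invariant_subspace H (d + n) (\<lambda>h. four_block_mat (\<sigma> h) (0\<^sub>m d n) (0\<^sub>m n d) (direct_sum_rep \<sigma>s h)) W"
        using W T by (simp add: invariant_subspace_def)
      note bd = invariant_subspace_block_diag[OF \<sigma> D this]
      have W2: "?inv ds \<sigma>s ((*\<^sub>v) M2 ` W)" using bd(2) unfolding n_def M2_def .
      have "invariant_subspace H d \<sigma> ((*\<^sub>v) M1 ` K W)"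
        using bd(1) unfolding M1_def M2_def K_def .
      then have KK: "(*\<^sub>v) M1 ` K W = {0\<^sub>v d} \<or> (*\<^sub>v) M1 ` K W = carrier_vec d"
        using Cons(1) by (auto simp: irreducible_rep_iff)
      have d: "d > 0" using Cons(1) by (auto simp: irreducible_rep_iff)
      have ne: "carrier_vec d \<noteq> {0\<^sub>v d :: 'a vec}"
        using sdim_zero[of d, where ?'a = 'a] sdim_carrier[of d, where ?'a = 'a] d by fastforce
      have "sdim (d + n) W = sdim d ((*\<^sub>v) M1 ` K W) + (\<Sum>j\<in>J ((*\<^sub>v) M2 ` W). ds ! j)"
        using bd(3) J(2)[OF W2] unfolding M1_def M2_def K_def by simp
      also have "(\<Sum>j\<in>J ((*\<^sub>v) M2 ` W). ds ! j) = (\<Sum>j\<in>Suc ` J ((*\<^sub>v) M2 ` W). (d # ds) ! j)"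
        by (simp add: sum.reindex)
      also have "sdim d ((*\<^sub>v) M1 ` K W) = (if (*\<^sub>v) M1 ` K W = {0\<^sub>v d} then 0 else d)"
        using KK ne by (auto simp: sdim_zero sdim_carrier)
      also have "\<dots> + (\<Sum>j\<in>Suc ` J ((*\<^sub>v) M2 ` W). (d # ds) ! j) = (\<Sum>j\<in>J' W. (d # ds) ! j)"
      proof -
        have "finite (J ((*\<^sub>v) M2 ` W))" using J(1)[OF W2] finite_subset by blast
        then show ?thesis unfolding J'_def by (auto simp: sum.insert_if)
      qed
      finally show ?thesis using J(1)[OF W2] W2 Wc W0 by (auto simp: J'_def)
    qed
    show ?case
    proof (intro exI[of _ J'] conjI allI impI)
      fix W W'
      assume "?inv (d # ds) (\<sigma> # \<sigma>s) W" "?inv (d # ds) (\<sigma> # \<sigma>s) W'" and sub: "W \<subseteq> W'"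
      then have inv: "invariant_subspace H (d + n) (direct_sum_rep (\<sigma> # \<sigma>s)) W"
          "invariant_subspace H (d + n) (direct_sum_rep (\<sigma> # \<sigma>s)) W'" by (simp_all add: n_def)
      have sK: "K W \<subseteq> K W'" using sub by (auto simp: K_def)
      have "0\<^sub>v d \<in> (*\<^sub>v) M1 ` K W"
        using main[OF inv(1)] M1 M2 unfolding K_def
        by (intro image_eqI[of _ _ "0\<^sub>v (d + n)"]) auto
      then have "(*\<^sub>v) M1 ` K W' = {0\<^sub>v d} \<Longrightarrow> (*\<^sub>v) M1 ` K W = {0\<^sub>v d}" using sK by blast
      moreover have "J ((*\<^sub>v) M2 ` W) \<subseteq> J ((*\<^sub>v) M2 ` W')"
      proof -
        have "?inv ds \<sigma>s ((*\<^sub>v) M2 ` W)" "?inv ds \<sigma>s ((*\<^sub>v) M2 ` W')"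
          using main[OF inv(1)] main[OF inv(2)] by blast+
        then show ?thesis using image_mono[OF sub] by (rule J3[rule_format])
      qed
      ultimately show "J' W \<subseteq> J' W'" by (auto simp: J'_def)
    qed (use main in \<open>auto simp: n_def\<close>)
  qed
  then obtain J where Ja: "\<forall>W. ?inv ds \<sigma>s W \<longrightarrow> J W \<subseteq> {..<length ds}
        \<and> sdim (sum_list ds) W = (\<Sum>j\<in>J W. ds ! j)"
      and Jb: "\<forall>W W'. ?inv ds \<sigma>s W \<longrightarrow> ?inv ds \<sigma>s W' \<longrightarrow> W \<subseteq> W' \<longrightarrow> J W \<subseteq> J W'"
    by (elim exE conjE) (rule that)
  show ?thesis
  proof (rule that[of J])
    show "J W \<subseteq> {..<length ds}" "sdim (sum_list ds) W = (\<Sum>j\<in>J W. ds ! j)" if "?inv ds \<sigma>s W" for W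
      using Ja[rule_format, OF that] by (rule conjunct1) (use Ja[rule_format, OF that] in \<open>rule conjunct2\<close>)
    show "J W \<subseteq> J W'" if "?inv ds \<sigma>s W" "?inv ds \<sigma>s W'" "W \<subseteq> W'" for W W'
      using that by (rule Jb[rule_format])
  qed
qed

section \<open>Maschke's theorem and Schur's lemma\<close>

lemma intertwine_compose:
  assumes c: "A \<in> carrier_mat n n" "B \<in> carrier_mat n n" "C \<in> carrier_mat n n"
      "P \<in> carrier_mat n n" "Q \<in> carrier_mat n n"
    and "A * P = P * B" "B * Q = Q * C"
  shows "A * (P * Q) = P * Q * C"
proof -
  have "A * (P * Q) = A * P * Q" using c by simp
  also have "\<dots> = P * (B * Q)" using c assms(6) by simp
  also have "\<dots> = P * Q * C" using c assms(7) by simp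
  finally show ?thesis .
qed

text \<open>The size is an argument because matrices of all sizes share one type, and an empty sum
  must have a size too.\<close>

definition mat_sum :: "nat \<Rightarrow> nat \<Rightarrow> ('i \<Rightarrow> 'a::comm_monoid_add mat) \<Rightarrow> 'i set \<Rightarrow> 'a mat" where
  "mat_sum nr nc f S = mat nr nc (\<lambda>ij. \<Sum>h\<in>S. f h $$ ij)"

lemma mat_sum_carrier [simp]: "mat_sum nr nc f S \<in> carrier_mat nr nc"
  by (simp add: mat_sum_def)

lemma mat_sum_index [simp]: "i < nr \<Longrightarrow> j < nc \<Longrightarrow> mat_sum nr nc f S $$ (i, j) = (\<Sum>h\<in>S. f h $$ (i, j))"
  by (simp add: mat_sum_def)

lemma mat_sum_dim [simp]: "dim_row (mat_sum nr nc f S) = nr" "dim_col (mat_sum nr nc f S) = nc"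
  by (simp_all add: mat_sum_def)

lemma mat_sum_cong: "(\<And>h. h \<in> S \<Longrightarrow> f h = g h) \<Longrightarrow> mat_sum nr nc f S = mat_sum nr nc g S"
  by (simp add: mat_sum_def cong: sum.cong)

lemma mult_mat_sum_left:
  fixes M :: "'a::semiring_0 mat"
  assumes M: "M \<in> carrier_mat k nr" and f: "\<And>h. h \<in> S \<Longrightarrow> f h \<in> carrier_mat nr nc"
  shows "M * mat_sum nr nc f S = mat_sum k nc (\<lambda>h. M * f h) S"
proof (rule eq_matI)
  fix i j assume "i < dim_row (mat_sum k nc (\<lambda>h. M * f h) S)" "j < dim_col (mat_sum k nc (\<lambda>h. M * f h) S)"
  then have ij: "i < k" "j < nc" by auto
  have "(M * mat_sum nr nc f S) $$ (i, j) = (\<Sum>l<nr. \<Sum>h\<in>S. M $$ (i, l) * f h $$ (l, j))"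
    using ij M by (auto simp: scalar_prod_def sum_distrib_left atLeast0LessThan)
  also have "\<dots> = (\<Sum>h\<in>S. \<Sum>l<nr. M $$ (i, l) * f h $$ (l, j))" by (rule sum.swap)
  also have "\<dots> = (\<Sum>h\<in>S. (M * f h) $$ (i, j))"
  proof (rule sum.cong[OF refl])
    fix h assume "h \<in> S"
    then show "(\<Sum>l<nr. M $$ (i, l) * f h $$ (l, j)) = (M * f h) $$ (i, j)"
      using ij M f[of h] by (auto simp: scalar_prod_def atLeast0LessThan)
  qed
  finally show "(M * mat_sum nr nc f S) $$ (i, j) = mat_sum k nc (\<lambda>h. M * f h) S $$ (i, j)"
    using ij by simp
qed (use M in auto)

lemma mult_mat_sum_right:
  fixes M :: "'a::semiring_0 mat"
  assumes M: "M \<in> carrier_mat nc k" and f: "\<And>h. h \<in> S \<Longrightarrow> f h \<in> carrier_mat nr nc"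
  shows "mat_sum nr nc f S * M = mat_sum nr k (\<lambda>h. f h * M) S"
proof (rule eq_matI)
  fix i j assume "i < dim_row (mat_sum nr k (\<lambda>h. f h * M) S)" "j < dim_col (mat_sum nr k (\<lambda>h. f h * M) S)"
  then have ij: "i < nr" "j < k" by auto
  have "(mat_sum nr nc f S * M) $$ (i, j) = (\<Sum>l<nc. \<Sum>h\<in>S. f h $$ (i, l) * M $$ (l, j))"
    using ij M by (auto simp: scalar_prod_def sum_distrib_right atLeast0LessThan)
  also have "\<dots> = (\<Sum>h\<in>S. \<Sum>l<nc. f h $$ (i, l) * M $$ (l, j))" by (rule sum.swap)
  also have "\<dots> = (\<Sum>h\<in>S. (f h * M) $$ (i, j))"
  proof (rule sum.cong[OF refl])
    fix h assume "h \<in> S"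
    then show "(\<Sum>l<nc. f h $$ (i, l) * M $$ (l, j)) = (f h * M) $$ (i, j)"
      using ij M f[of h] by (auto simp: scalar_prod_def atLeast0LessThan)
  qed
  finally show "(mat_sum nr nc f S * M) $$ (i, j) = mat_sum nr k (\<lambda>h. f h * M) S $$ (i, j)"
    using ij by simp
qed (use M in auto)

lemma mat_sum_reindex:
  "bij_betw \<phi> S T \<Longrightarrow> mat_sum nr nc (\<lambda>h. f (\<phi> h)) S = mat_sum nr nc f T"
  unfolding mat_sum_def
  by (intro arg_cong[where f = "mat nr nc"] ext) (rule sum.reindex_bij_betw)

lemma bij_betw_group_mult:
  assumes "group H" "g \<in> carrier H"
  shows "bij_betw (\<lambda>h. g \<otimes>\<^bsub>H\<^esub> h) (carrier H) (carrier H)"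
    "bij_betw (\<lambda>h. h \<otimes>\<^bsub>H\<^esub> g) (carrier H) (carrier H)"
proof -
  interpret group H by fact
  show "bij_betw (\<lambda>h. g \<otimes>\<^bsub>H\<^esub> h) (carrier H) (carrier H)"
    by (rule bij_betwI[where g = "\<lambda>h. inv\<^bsub>H\<^esub> g \<otimes>\<^bsub>H\<^esub> h"]) (use assms(2) in \<open>auto simp: m_assoc[symmetric]\<close>)
  show "bij_betw (\<lambda>h. h \<otimes>\<^bsub>H\<^esub> g) (carrier H) (carrier H)"
    by (rule bij_betwI[where g = "\<lambda>h. h \<otimes>\<^bsub>H\<^esub> inv\<^bsub>H\<^esub> g"]) (use assms(2) in \<open>auto simp: m_assoc\<close>)
qed

text \<open>The image of the unit is idempotent and invertible.\<close>

lemma representation_one: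
  assumes "group H" "representation H n \<rho>"
  shows "\<rho> \<one>\<^bsub>H\<^esub> = 1\<^sub>m n"
proof -
  interpret group H by fact
  have c: "\<rho> \<one>\<^bsub>H\<^esub> \<in> carrier_mat n n" and d: "det (\<rho> \<one>\<^bsub>H\<^esub>) \<noteq> 0"
    and m: "\<rho> \<one>\<^bsub>H\<^esub> = \<rho> \<one>\<^bsub>H\<^esub> * \<rho> \<one>\<^bsub>H\<^esub>"
    using assms(2) one_closed r_one[OF one_closed] unfolding representation_iff by metis+
  obtain B where B: "B \<in> carrier_mat n n" "B * \<rho> \<one>\<^bsub>H\<^esub> = 1\<^sub>m n" using det_inverse_exists[OF c d] by metis
  have "B * \<rho> \<one>\<^bsub>H\<^esub> = (B * \<rho> \<one>\<^bsub>H\<^esub>) * \<rho> \<one>\<^bsub>H\<^esub>"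
    using arg_cong[OF m, of "\<lambda>X. B * X"] assoc_mult_mat[OF B(1) c c] by simp
  then show ?thesis using B c by simp
qed

lemma representation_inv:
  assumes "group H" "representation H n \<rho>" "h \<in> carrier H"
  shows "\<rho> h * \<rho> (inv\<^bsub>H\<^esub> h) = 1\<^sub>m n" "\<rho> (inv\<^bsub>H\<^esub> h) * \<rho> h = 1\<^sub>m n"
proof -
  interpret group H by fact
  show "\<rho> h * \<rho> (inv\<^bsub>H\<^esub> h) = 1\<^sub>m n" "\<rho> (inv\<^bsub>H\<^esub> h) * \<rho> h = 1\<^sub>m n"
    using representation_one[OF assms(1,2)] assms(2,3) inv_closed[OF assms(3)]
      r_inv[OF assms(3)] l_inv[OF assms(3)]
    unfolding representation_iff by metis+
qed

section \<open>Block triangular form adapted to a subspace\<close>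

definition upper_left :: "nat \<Rightarrow> nat \<Rightarrow> 'a mat \<Rightarrow> 'a mat" where
  "upper_left d e Y = mat d d (\<lambda>(i, j). Y $$ (i, j))"

definition upper_right :: "nat \<Rightarrow> nat \<Rightarrow> 'a mat \<Rightarrow> 'a mat" where
  "upper_right d e Y = mat d e (\<lambda>(i, j). Y $$ (i, d + j))"

definition lower_right :: "nat \<Rightarrow> nat \<Rightarrow> 'a mat \<Rightarrow> 'a mat" where
  "lower_right d e Y = mat e e (\<lambda>(i, j). Y $$ (d + i, d + j))"

lemma block_carrier [simp]:
  "upper_left d e Y \<in> carrier_mat d d" "upper_right d e Y \<in> carrier_mat d e"
  "lower_right d e Y \<in> carrier_mat e e"
  by (simp_all add: upper_left_def upper_right_def lower_right_def)

lemma block_upper_triangular: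
  assumes "Y \<in> carrier_mat (d + e) (d + e)"
    and "\<And>i j. d \<le> i \<Longrightarrow> i < d + e \<Longrightarrow> j < d \<Longrightarrow> Y $$ (i, j) = 0"
  shows "Y = four_block_mat (upper_left d e Y) (upper_right d e Y) (0\<^sub>m e d) (lower_right d e Y)"
  using assms
  by (intro eq_matI) (auto simp: upper_left_def upper_right_def lower_right_def)

lemma four_block_mat_blocks:
  assumes "A \<in> carrier_mat d d" "B \<in> carrier_mat d e" "C \<in> carrier_mat e d" "D \<in> carrier_mat e e"
  shows "upper_left d e (four_block_mat A B C D) = A" "upper_right d e (four_block_mat A B C D) = B"
    "lower_right d e (four_block_mat A B C D) = D"
  using assms
  by (auto intro!: eq_matI simp: upper_left_def upper_right_def lower_right_def)

lemma mult_block_upper_triangular: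
  fixes A :: "'a::field mat"
  assumes "A \<in> carrier_mat d d" "B \<in> carrier_mat d e" "D \<in> carrier_mat e e"
    "A' \<in> carrier_mat d d" "B' \<in> carrier_mat d e" "D' \<in> carrier_mat e e"
  shows "four_block_mat A B (0\<^sub>m e d) D * four_block_mat A' B' (0\<^sub>m e d) D' =
    four_block_mat (A * A') (A * B' + B * D') (0\<^sub>m e d) (D * D')"
  using assms mult_four_block_mat[OF assms(1,2) zero_carrier_mat assms(3,4,5) zero_carrier_mat assms(6)]
  by simp

text \<open>For j < d, column j of \<open>Q * Y * P\<close> holds the coordinates of the image under
  \<open>Y\<close> of the j-th basis vector of \<open>W\<close>. This image lies in
  \<open>W\<close>, so the coordinates vanish from d on.\<close>

lemma preserved_subspace_block_form:
  fixes W :: "'a::field vec set"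
  assumes W: "W = {P *\<^sub>v v |v. v \<in> carrier_vec (d + e) \<and> (\<forall>j<d + e. d \<le> j \<longrightarrow> v $ j = 0)}"
    and PQ: "P \<in> carrier_mat (d + e) (d + e)" "Q \<in> carrier_mat (d + e) (d + e)" "Q * P = 1\<^sub>m (d + e)"
    and Y: "Y \<in> carrier_mat (d + e) (d + e)" and pres: "\<And>w. w \<in> W \<Longrightarrow> Y *\<^sub>v w \<in> W"
  shows "Q * Y * P = four_block_mat (upper_left d e (Q * Y * P)) (upper_right d e (Q * Y * P))
    (0\<^sub>m e d) (lower_right d e (Q * Y * P))"
proof (rule block_upper_triangular)
  show "Q * Y * P \<in> carrier_mat (d + e) (d + e)" using PQ Y by simp
  fix i j assume ij: "d \<le> i" "i < d + e" "j < d"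
  let ?u = "unit_vec (d + e) j :: 'a vec"
  have "P *\<^sub>v ?u \<in> W" unfolding W using ij by auto
  then have "Y *\<^sub>v (P *\<^sub>v ?u) \<in> W" by (rule pres)
  then obtain v where v: "Y *\<^sub>v (P *\<^sub>v ?u) = P *\<^sub>v v" "v \<in> carrier_vec (d + e)"
      "\<forall>j<d + e. d \<le> j \<longrightarrow> v $ j = 0"
    unfolding W by auto
  have "(Q * Y * P) *\<^sub>v ?u = Q *\<^sub>v (Y *\<^sub>v (P *\<^sub>v ?u))"
    using PQ Y by (simp add: assoc_mult_mat_vec[of _ "d + e" "d + e" _ "d + e"])
  also have "\<dots> = (Q * P) *\<^sub>v v" using v(1) assoc_mult_mat_vec[OF PQ(2,1) v(2)] by simp
  also have "\<dots> = v" using PQ v by simp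
  finally have "(Q * Y * P) *\<^sub>v ?u = v" .
  moreover have "((Q * Y * P) *\<^sub>v ?u) $ i = (Q * Y * P) $$ (i, j)"
    using ij PQ Y by (simp add: scalar_prod_right_unit[of j "d + e"])
  ultimately show "(Q * Y * P) $$ (i, j) = 0" using v ij by auto
qed

text \<open>Maschke: \<open>Y\<close> is the average of \<open>B h * D h\<inverse>\<close>.\<close>

lemma block_triangular_complement:
  fixes A B D :: "'h \<Rightarrow> 'a::field_char_0 mat"
  assumes H: "group H" "finite (carrier H)" and D: "representation H e D"
    and A: "\<And>h. h \<in> carrier H \<Longrightarrow> A h \<in> carrier_mat d d"
    and B: "\<And>h. h \<in> carrier H \<Longrightarrow> B h \<in> carrier_mat d e"
    and cocycle: "\<And>g h. g \<in> carrier H \<Longrightarrow> h \<in> carrier H \<Longrightarrow> B (g \<otimes>\<^bsub>H\<^esub> h) = A g * B h + B g * D h"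
  obtains Y where "Y \<in> carrier_mat d e" "\<forall>h \<in> carrier H. A h * Y + B h = Y * D h"
proof -
  interpret group H by fact
  let ?G = "carrier H"
  have Dc: "D h \<in> carrier_mat e e" if "h \<in> ?G" for h using D that by (simp add: representation_iff)
  define c :: 'a where "c = of_nat (card ?G)"
  have c: "c \<noteq> 0" using H(2) one_closed by (auto simp: c_def card_eq_0_iff)
  define S where "S = mat_sum d e (\<lambda>h. B h * D (inv\<^bsub>H\<^esub> h)) ?G"
  have key: "A g * S + c \<cdot>\<^sub>m B g = S * D g" if g: "g \<in> ?G" for g
  proof -
    have BD: "B h * D (inv\<^bsub>H\<^esub> h) \<in> carrier_mat d e" if "h \<in> ?G" for h
      using B[OF that] Dc[OF inv_closed[OF that]] by simp
    have "S * D g = mat_sum d e (\<lambda>h. B h * D (inv\<^bsub>H\<^esub> h) * D g) ?G"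
      unfolding S_def by (rule mult_mat_sum_right[OF Dc[OF g] BD])
    \<comment> \<open>The summation index \<open>h\<close> is replaced by \<open>g h\<close>. The
      cocycle identity then pulls \<open>A g\<close> out of every summand and leaves
      \<open>B g\<close> over once per group element.\<close>
    also have "\<dots> = mat_sum d e (\<lambda>h. B (g \<otimes>\<^bsub>H\<^esub> h) * D (inv\<^bsub>H\<^esub> (g \<otimes>\<^bsub>H\<^esub> h)) * D g) ?G"
      by (rule mat_sum_reindex[OF bij_betw_group_mult(1)[OF H(1) g], symmetric])
    also have "\<dots> = mat_sum d e (\<lambda>h. A g * (B h * D (inv\<^bsub>H\<^esub> h)) + B g) ?G"
    proof (rule mat_sum_cong)
      fix h assume h: "h \<in> ?G"
      have Di: "D (inv\<^bsub>H\<^esub> h) \<in> carrier_mat e e" using Dc h by simp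
      have "D (inv\<^bsub>H\<^esub> (g \<otimes>\<^bsub>H\<^esub> h)) * D g = D (inv\<^bsub>H\<^esub> (g \<otimes>\<^bsub>H\<^esub> h) \<otimes>\<^bsub>H\<^esub> g)"
        using D g h by (simp add: representation_iff)
      also have "inv\<^bsub>H\<^esub> (g \<otimes>\<^bsub>H\<^esub> h) \<otimes>\<^bsub>H\<^esub> g = inv\<^bsub>H\<^esub> h"
        using g h by (simp add: inv_mult_group m_assoc)
      finally have e1: "D (inv\<^bsub>H\<^esub> (g \<otimes>\<^bsub>H\<^esub> h)) * D g = D (inv\<^bsub>H\<^esub> h)" .
      have "B (g \<otimes>\<^bsub>H\<^esub> h) * D (inv\<^bsub>H\<^esub> (g \<otimes>\<^bsub>H\<^esub> h)) * D g =
          B (g \<otimes>\<^bsub>H\<^esub> h) * (D (inv\<^bsub>H\<^esub> (g \<otimes>\<^bsub>H\<^esub> h)) * D g)"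
        using B Dc g h by (intro assoc_mult_mat[of _ d e _ e _ e]) auto
      also have "\<dots> = (A g * B h + B g * D h) * D (inv\<^bsub>H\<^esub> h)"
        using e1 cocycle[OF g h] by simp
      also have "\<dots> = A g * B h * D (inv\<^bsub>H\<^esub> h) + B g * D h * D (inv\<^bsub>H\<^esub> h)"
        using A[OF g] B[OF h] B[OF g] Dc[OF h] Di
        by (intro add_mult_distrib_mat[of _ d e]) auto
      also have "A g * B h * D (inv\<^bsub>H\<^esub> h) = A g * (B h * D (inv\<^bsub>H\<^esub> h))"
        using A[OF g] B[OF h] Di by simp
      also have "B g * D h * D (inv\<^bsub>H\<^esub> h) = B g * (D h * D (inv\<^bsub>H\<^esub> h))"
        using B[OF g] Dc[OF h] Di by simp
      also have "\<dots> = B g" using representation_inv(1)[OF H(1) D h] B[OF g] by simp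
      finally show "B (g \<otimes>\<^bsub>H\<^esub> h) * D (inv\<^bsub>H\<^esub> (g \<otimes>\<^bsub>H\<^esub> h)) * D g =
          A g * (B h * D (inv\<^bsub>H\<^esub> h)) + B g" .
    qed
    also have "\<dots> = mat_sum d e (\<lambda>h. A g * (B h * D (inv\<^bsub>H\<^esub> h))) ?G + c \<cdot>\<^sub>m B g"
    proof (rule eq_matI)
      fix i j assume "i < dim_row (mat_sum d e (\<lambda>h. A g * (B h * D (inv\<^bsub>H\<^esub> h))) ?G + c \<cdot>\<^sub>m B g)"
        "j < dim_col (mat_sum d e (\<lambda>h. A g * (B h * D (inv\<^bsub>H\<^esub> h))) ?G + c \<cdot>\<^sub>m B g)"
      then have ij: "i < d" "j < e" using B[OF g] by auto
      have "(A g * (B h * D (inv\<^bsub>H\<^esub> h)) + B g) $$ (i, j) = (A g * (B h * D (inv\<^bsub>H\<^esub> h))) $$ (i, j) + B g $$ (i, j)"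
        if "h \<in> ?G" for h
        using ij A[OF g] B[OF g] BD[OF that] by (intro index_add_mat) auto
      then show "mat_sum d e (\<lambda>h. A g * (B h * D (inv\<^bsub>H\<^esub> h)) + B g) ?G $$ (i, j) =
          (mat_sum d e (\<lambda>h. A g * (B h * D (inv\<^bsub>H\<^esub> h))) ?G + c \<cdot>\<^sub>m B g) $$ (i, j)"
        using ij B[OF g] by (simp add: sum.distrib c_def)
    qed (use B[OF g] in auto)
    also have "mat_sum d e (\<lambda>h. A g * (B h * D (inv\<^bsub>H\<^esub> h))) ?G = A g * S"
      unfolding S_def by (rule mult_mat_sum_left[OF A[OF g] BD, symmetric])
    finally show ?thesis by simp
  qed
  define Y where "Y = inverse c \<cdot>\<^sub>m S"
  have Sc: "S \<in> carrier_mat d e" by (simp add: S_def)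
  have "A g * Y + B g = Y * D g" if g: "g \<in> ?G" for g
  proof -
    have "Y * D g = inverse c \<cdot>\<^sub>m (S * D g)"
      unfolding Y_def by (rule mult_smult_assoc_mat[OF Sc Dc[OF g]])
    also have "\<dots> = inverse c \<cdot>\<^sub>m (A g * S + c \<cdot>\<^sub>m B g)" using key[OF g] by simp
    also have "\<dots> = inverse c \<cdot>\<^sub>m (A g * S) + inverse c \<cdot>\<^sub>m (c \<cdot>\<^sub>m B g)"
      using A[OF g] B[OF g] Sc by (intro add_smult_distrib_left_mat[of _ d e]) auto
    also have "inverse c \<cdot>\<^sub>m (c \<cdot>\<^sub>m B g) = B g" using c by (intro eq_matI) auto
    also have "inverse c \<cdot>\<^sub>m (A g * S) = A g * Y"
      unfolding Y_def by (rule mult_smult_distrib[OF A[OF g] Sc, symmetric])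
    finally show ?thesis by simp
  qed
  then show ?thesis using that[of Y] Sc by (simp add: Y_def)
qed

lemma diag_block_mat_append':
  "direct_sum_rep (\<sigma>s @ \<tau>s) h =
     (let A = direct_sum_rep \<sigma>s h; B = direct_sum_rep \<tau>s h
      in four_block_mat A (0\<^sub>m (dim_row A) (dim_col B)) (0\<^sub>m (dim_row B) (dim_col A)) B)"
  by (simp add: direct_sum_rep_def diag_block_mat_append Let_def)

lemma det_block_diag:
  fixes A :: "'a::field mat"
  assumes "A \<in> carrier_mat d d" "D \<in> carrier_mat e e"
  shows "det (four_block_mat A (0\<^sub>m d e) (0\<^sub>m e d) D) = det A * det D"
  by (rule det_four_block_mat_lower_left_zero[OF assms(1) zero_carrier_mat refl assms(2)])

lemma irreducible_rep_carrier:
  assumes "list_all2 (irreducible_rep H) ds \<sigma>s" "h \<in> carrier H"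
  shows "direct_sum_rep \<sigma>s h \<in> carrier_mat (sum_list ds) (sum_list ds)"
proof (rule direct_sum_rep_carrier, rule list_all2_mono[OF assms(1)])
  fix d \<tau> assume "irreducible_rep H d \<tau>"
  then show "\<tau> h \<in> carrier_mat d d" using assms(2) by (auto simp: irreducible_rep_iff representation_iff)
qed

text \<open>One basis makes every matrix that preserves \<open>W\<close> triangular. The last clause
  is kept for all such matrices so that a representation and a matrix commuting with it can be cut
  down together.\<close>

lemma block_triangular_form:
  fixes W :: "'a::field vec set"
  assumes W: "VectorSpace.subspace class_ring W (module_vec TYPE('a) n)"
  obtains P Q d e where "n = d + e" "d = sdim n W"
    "P \<in> carrier_mat n n" "Q \<in> carrier_mat n n" "P * Q = 1\<^sub>m n" "Q * P = 1\<^sub>m n" "det P \<noteq> 0"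
    "W = {P *\<^sub>v v |v. v \<in> carrier_vec n \<and> (\<forall>j<n. d \<le> j \<longrightarrow> v $ j = 0)}"
    "\<forall>Y \<in> carrier_mat n n. (\<forall>w \<in> W. Y *\<^sub>v w \<in> W) \<longrightarrow>
      Q * Y * P = four_block_mat (upper_left d e (Q * Y * P)) (upper_right d e (Q * Y * P))
        (0\<^sub>m e d) (lower_right d e (Q * Y * P))"
proof -
  obtain P where P: "P \<in> carrier_mat n n" "det P \<noteq> 0" "sdim n W \<le> n"
      "W = {P *\<^sub>v v |v. v \<in> carrier_vec n \<and> (\<forall>j<n. sdim n W \<le> j \<longrightarrow> v $ j = 0)}"
    by (rule subspace_adapted_basis[OF W]) (rule that)
  obtain Q where Q: "Q \<in> carrier_mat n n" "P * Q = 1\<^sub>m n" "Q * P = 1\<^sub>m n"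
    using det_inverse_exists[OF P(1,2)] by metis
  obtain e where e: "n = sdim n W + e" using P(3) le_Suc_ex by blast
  define d where "d = sdim n W"
  have n: "n = d + e" using e by (simp add: d_def)
  show ?thesis
  proof (rule that[OF n d_def P(1) Q(1,2,3) P(2)])
    show "W = {P *\<^sub>v v |v. v \<in> carrier_vec n \<and> (\<forall>j<n. d \<le> j \<longrightarrow> v $ j = 0)}"
      unfolding d_def by (rule P(4))
    show "\<forall>Y \<in> carrier_mat n n. (\<forall>w \<in> W. Y *\<^sub>v w \<in> W) \<longrightarrow>
      Q * Y * P = four_block_mat (upper_left d e (Q * Y * P)) (upper_right d e (Q * Y * P))
        (0\<^sub>m e d) (lower_right d e (Q * Y * P))"
    proof (intro ballI impI)
      fix Y assume "Y \<in> carrier_mat n n" "\<forall>w \<in> W. Y *\<^sub>v w \<in> W"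
      then show "Q * Y * P = four_block_mat (upper_left d e (Q * Y * P)) (upper_right d e (Q * Y * P))
          (0\<^sub>m e d) (lower_right d e (Q * Y * P))"
        by (intro preserved_subspace_block_form[OF P(4)[folded d_def, unfolded n] P(1)[unfolded n]
              Q(1)[unfolded n] Q(3)[unfolded n]]) (simp_all add: n)
    qed
  qed
qed

lemma conjugate_mult:
  fixes P :: "'a::field mat"
  assumes "P \<in> carrier_mat n n" "Q \<in> carrier_mat n n" "P * Q = 1\<^sub>m n"
    "X \<in> carrier_mat n n" "Y \<in> carrier_mat n n"
  shows "Q * (X * Y) * P = (Q * X * P) * (Q * Y * P)"
proof -
  have "(Q * X * P) * (Q * Y * P) = Q * X * (P * Q) * Y * P"
    using assms(1,2,4,5) by (simp add: assoc_mult_mat[of _ n n _ n _ n])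
  also have "\<dots> = Q * (X * Y) * P"
    using assms by (simp add: assoc_mult_mat[of _ n n _ n _ n])
  finally show ?thesis by simp
qed

text \<open>\<open>A\<close> is the action on \<open>W\<close>, \<open>D\<close> the action on the
  quotient, and \<open>B\<close> the cocycle that glues them; the identities are the blocks of
  \<rho>(gh) = \<rho>(g) \<rho>(h). The basis change is exported with its effect on all matrices
  preserving \<open>W\<close>, because the eigenvalue argument triangularises a commuting matrix in
  the same basis.\<close>

lemma triangular_representation:
  fixes \<rho> :: "'h \<Rightarrow> 'a::field mat"
  assumes H: "group H" and rep: "representation H n \<rho>" and W: "invariant_subspace H n \<rho> W"
  obtains P Q d e A B D where "n = d + e" "d = sdim n W"
    "P \<in> carrier_mat n n" "Q \<in> carrier_mat n n" "P * Q = 1\<^sub>m n" "Q * P = 1\<^sub>m n" "det P \<noteq> 0"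
    "W = {P *\<^sub>v v |v. v \<in> carrier_vec n \<and> (\<forall>j<n. d \<le> j \<longrightarrow> v $ j = 0)}"
    "\<forall>Y \<in> carrier_mat n n. (\<forall>w \<in> W. Y *\<^sub>v w \<in> W) \<longrightarrow>
      Q * Y * P = four_block_mat (upper_left d e (Q * Y * P)) (upper_right d e (Q * Y * P))
        (0\<^sub>m e d) (lower_right d e (Q * Y * P))"
    "\<forall>h \<in> carrier H. Q * \<rho> h * P = four_block_mat (A h) (B h) (0\<^sub>m e d) (D h)"
    "representation H d A" "representation H e D"
    "\<forall>h \<in> carrier H. B h \<in> carrier_mat d e"
    "\<forall>g \<in> carrier H. \<forall>h \<in> carrier H. B (g \<otimes>\<^bsub>H\<^esub> h) = A g * B h + B g * D h"
proof -
  have sub: "VectorSpace.subspace class_ring W (module_vec TYPE('a) n)"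
    using W by (simp add: invariant_subspace_def)
  obtain P Q d e where n: "n = d + e" and d: "d = sdim n W"
    and P: "P \<in> carrier_mat n n" and Q: "Q \<in> carrier_mat n n" and PQ: "P * Q = 1\<^sub>m n" "Q * P = 1\<^sub>m n"
    and detP: "det P \<noteq> 0"
    and Weq: "W = {P *\<^sub>v v |v. v \<in> carrier_vec n \<and> (\<forall>j<n. d \<le> j \<longrightarrow> v $ j = 0)}"
    and blk: "\<forall>Y \<in> carrier_mat n n. (\<forall>w \<in> W. Y *\<^sub>v w \<in> W) \<longrightarrow>
      Q * Y * P = four_block_mat (upper_left d e (Q * Y * P)) (upper_right d e (Q * Y * P))
        (0\<^sub>m e d) (lower_right d e (Q * Y * P))"
    by (rule block_triangular_form[OF sub]) (rule that)
  define A where "A h = upper_left d e (Q * \<rho> h * P)" for h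
  define B where "B h = upper_right d e (Q * \<rho> h * P)" for h
  define D where "D h = lower_right d e (Q * \<rho> h * P)" for h
  have c: "A h \<in> carrier_mat d d" "B h \<in> carrier_mat d e" "D h \<in> carrier_mat e e" for h
    by (simp_all add: A_def B_def D_def)
  have rc: "\<rho> h \<in> carrier_mat n n" "det (\<rho> h) \<noteq> 0" if "h \<in> carrier H" for h
    using rep that by (simp_all add: representation_iff)
  have form: "Q * \<rho> h * P = four_block_mat (A h) (B h) (0\<^sub>m e d) (D h)" if h: "h \<in> carrier H" for h
    unfolding A_def B_def D_def
    by (rule blk[rule_format, OF rc(1)[OF h]]) (use W h in \<open>auto simp: invariant_subspace_def\<close>)
  have detQ: "det Q * det P = 1" using det_mult[OF Q P] PQ(2) by simp
  have mult: "A (g \<otimes>\<^bsub>H\<^esub> h) = A g * A h" "B (g \<otimes>\<^bsub>H\<^esub> h) = A g * B h + B g * D h"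
      "D (g \<otimes>\<^bsub>H\<^esub> h) = D g * D h"
    if g: "g \<in> carrier H" and h: "h \<in> carrier H" for g h
  proof -
    have gh: "g \<otimes>\<^bsub>H\<^esub> h \<in> carrier H" using H g h by (simp add: group.is_monoid monoid.m_closed)
    have "Q * \<rho> (g \<otimes>\<^bsub>H\<^esub> h) * P = (Q * \<rho> g * P) * (Q * \<rho> h * P)"
      using conjugate_mult[OF P Q PQ(1) rc(1)[OF g] rc(1)[OF h]] rep g h by (simp add: representation_iff)
    then have eq: "four_block_mat (A (g \<otimes>\<^bsub>H\<^esub> h)) (B (g \<otimes>\<^bsub>H\<^esub> h)) (0\<^sub>m e d) (D (g \<otimes>\<^bsub>H\<^esub> h)) =
        four_block_mat (A g * A h) (A g * B h + B g * D h) (0\<^sub>m e d) (D g * D h)"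
      using form[OF g] form[OF h] form[OF gh] mult_block_upper_triangular[OF c c] by simp
    have c2: "A g * A h \<in> carrier_mat d d" "A g * B h + B g * D h \<in> carrier_mat d e"
        "D g * D h \<in> carrier_mat e e"
      using c[of g] c[of h] by auto
    note l = four_block_mat_blocks[OF c(1)[of "g \<otimes>\<^bsub>H\<^esub> h"] c(2) zero_carrier_mat c(3)]
    note r = four_block_mat_blocks[OF c2(1,2) zero_carrier_mat c2(3)]
    show "A (g \<otimes>\<^bsub>H\<^esub> h) = A g * A h" "B (g \<otimes>\<^bsub>H\<^esub> h) = A g * B h + B g * D h"
        "D (g \<otimes>\<^bsub>H\<^esub> h) = D g * D h"
      using l[of "g \<otimes>\<^bsub>H\<^esub> h" "g \<otimes>\<^bsub>H\<^esub> h"] r eq by metis+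
  qed
  have dets: "det (A h) \<noteq> 0" "det (D h) \<noteq> 0" if h: "h \<in> carrier H" for h
  proof -
    have "det (Q * \<rho> h * P) = det Q * det (\<rho> h) * det P"
      using Q P rc(1)[OF h] by (simp add: det_mult[of _ n])
    moreover have "det (Q * \<rho> h * P) = det (A h) * det (D h)"
      unfolding form[OF h] by (rule det_four_block_mat_lower_left_zero[OF c(1,2) refl c(3)])
    ultimately show "det (A h) \<noteq> 0" "det (D h) \<noteq> 0" using detQ rc(2)[OF h] by auto
  qed
  have AD: "representation H d A" "representation H e D"
    unfolding representation_iff using c dets mult by auto
  have F: "\<forall>h \<in> carrier H. Q * \<rho> h * P = four_block_mat (A h) (B h) (0\<^sub>m e d) (D h)"
      "\<forall>h \<in> carrier H. B h \<in> carrier_mat d e"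
      "\<forall>g \<in> carrier H. \<forall>h \<in> carrier H. B (g \<otimes>\<^bsub>H\<^esub> h) = A g * B h + B g * D h"
    using form c(2) mult(2) by simp_all
  show ?thesis by (rule that[OF n d P Q PQ detP Weq blk F(1) AD F(2,3)])
qed

text \<open>Since A Y + B = Y D, conjugation by the unipotent matrix with upper right block
  \<open>Y\<close> clears the cocycle.\<close>

lemma maschke_step:
  fixes \<rho> :: "'h \<Rightarrow> 'a::field_char_0 mat"
  assumes H: "group H" "finite (carrier H)" and rep: "representation H n \<rho>"
    and W: "invariant_subspace H n \<rho> W" "W \<noteq> {0\<^sub>v n}" "W \<noteq> carrier_vec n"
  obtains P d e A D where "n = d + e" "d < n" "e < n" "P \<in> carrier_mat n n" "det P \<noteq> 0"
    "representation H d A" "representation H e D"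
    "\<forall>h \<in> carrier H. \<rho> h * P = P * four_block_mat (A h) (0\<^sub>m d e) (0\<^sub>m e d) (D h)"
proof -
  obtain P Q d e A B D where n: "n = d + e" and d: "d = sdim n W"
    and P: "P \<in> carrier_mat n n" and Q: "Q \<in> carrier_mat n n" and PQ: "P * Q = 1\<^sub>m n" "Q * P = 1\<^sub>m n"
    and detP: "det P \<noteq> 0"
    and Weq: "W = {P *\<^sub>v v |v. v \<in> carrier_vec n \<and> (\<forall>j<n. d \<le> j \<longrightarrow> v $ j = 0)}"
    and blk: "\<forall>Y \<in> carrier_mat n n. (\<forall>w \<in> W. Y *\<^sub>v w \<in> W) \<longrightarrow>
      Q * Y * P = four_block_mat (upper_left d e (Q * Y * P)) (upper_right d e (Q * Y * P))
        (0\<^sub>m e d) (lower_right d e (Q * Y * P))"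
    and form: "\<forall>h \<in> carrier H. Q * \<rho> h * P = four_block_mat (A h) (B h) (0\<^sub>m e d) (D h)"
    and A: "representation H d A" and D: "representation H e D"
    and B: "\<forall>h \<in> carrier H. B h \<in> carrier_mat d e"
    and coc: "\<forall>g \<in> carrier H. \<forall>h \<in> carrier H. B (g \<otimes>\<^bsub>H\<^esub> h) = A g * B h + B g * D h"
    by (rule triangular_representation[OF H(1) rep W(1)]) (rule that)
  have Ac: "A h \<in> carrier_mat d d" and Dc: "D h \<in> carrier_mat e e" and rc: "\<rho> h \<in> carrier_mat n n"
    if "h \<in> carrier H" for h
    using that A D rep by (auto simp: representation_iff)
  \<comment> \<open>\<open>W\<close> is nonzero and proper, so neither block is empty; hence both
    degrees drop, as the induction in \<open>maschke\<close> requires.\<close>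
  have "d \<noteq> 0"
  proof
    assume "d = 0"
    then have "v = 0\<^sub>v n" if "v \<in> carrier_vec n" "\<forall>j<n. d \<le> j \<longrightarrow> v $ j = 0" for v :: "'a vec"
      using that by (intro eq_vecI) auto
    then have "W \<subseteq> {0\<^sub>v n}" unfolding Weq using mat_mult_zero_vec[OF P] by auto
    moreover have "0\<^sub>v n \<in> W" using W(1) by (auto simp: invariant_subspace_def subspace_iff)
    ultimately show False using W(2) by auto
  qed
  have "e \<noteq> 0"
  proof
    assume "e = 0"
    have "v \<in> W" if v: "v \<in> carrier_vec n" for v
    proof -
      have "v = P *\<^sub>v (Q *\<^sub>v v)" using assoc_mult_mat_vec[OF P Q v] PQ v by simp
      then show ?thesis unfolding Weq using \<open>e = 0\<close> n Q v by auto
    qed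
    moreover have "W \<subseteq> carrier_vec n" using W(1) by (auto simp: invariant_subspace_def subspace_iff)
    ultimately show False using W(3) by auto
  qed
  obtain Y where Y: "Y \<in> carrier_mat d e" "\<forall>h \<in> carrier H. A h * Y + B h = Y * D h"
    by (rule block_triangular_complement[OF H D Ac B[rule_format] coc[rule_format]]) (assumption | rule that)+
  define R where "R = four_block_mat (1\<^sub>m d) Y (0\<^sub>m e d) (1\<^sub>m e)"
  have R: "R \<in> carrier_mat n n" unfolding R_def n using Y by auto
  have detR: "det R = 1"
    unfolding R_def using det_four_block_mat_lower_left_zero[of "1\<^sub>m d" d Y e] Y by simp
  have "\<rho> h * (P * R) = P * R * four_block_mat (A h) (0\<^sub>m d e) (0\<^sub>m e d) (D h)" if h: "h \<in> carrier H" for h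
  proof -
    let ?T = "four_block_mat (A h) (B h) (0\<^sub>m e d) (D h)"
    let ?S = "four_block_mat (A h) (0\<^sub>m d e) (0\<^sub>m e d) (D h)"
    have T: "?T \<in> carrier_mat n n" and S: "?S \<in> carrier_mat n n" using Ac[OF h] Dc[OF h] n by auto
    have "P * ?T = P * Q * \<rho> h * P"
      unfolding form[rule_format, OF h, symmetric] using P Q rc[OF h] by (simp add: assoc_mult_mat[of _ n n _ n _ n])
    then have 1: "\<rho> h * P = P * ?T" using PQ rc[OF h] by simp
    have "?T * R = four_block_mat (A h * 1\<^sub>m d) (A h * Y + B h * 1\<^sub>m e) (0\<^sub>m e d) (D h * 1\<^sub>m e)"
      unfolding R_def using mult_block_upper_triangular[OF Ac[OF h] B[rule_format, OF h] Dc[OF h] one_carrier_mat Y(1) one_carrier_mat] .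
    also have "\<dots> = four_block_mat (A h) (Y * D h) (0\<^sub>m e d) (D h)"
      using Ac[OF h] B[rule_format, OF h] Dc[OF h] Y(2)[rule_format, OF h] by simp
    also have "\<dots> = R * ?S"
      unfolding R_def using mult_block_upper_triangular[OF one_carrier_mat Y(1) one_carrier_mat Ac[OF h] zero_carrier_mat Dc[OF h]]
        Ac[OF h] Dc[OF h] Y(1) by simp
    finally have 2: "?T * R = R * ?S" .
    show ?thesis by (rule intertwine_compose[OF rc[OF h] T S P R 1 2])
  qed
  moreover have "det (P * R) \<noteq> 0" using det_mult[OF P R] detP detR by simp
  ultimately show ?thesis
    using that[of d e "P * R" A D] n \<open>d \<noteq> 0\<close> \<open>e \<noteq> 0\<close> P R A D by auto
qed

theorem maschke:
  fixes \<rho> :: "'h \<Rightarrow> 'a::field_char_0 mat"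
  assumes H: "group H" "finite (carrier H)" and rep: "representation H n \<rho>"
  shows "\<exists>ds \<sigma>s P. list_all2 (irreducible_rep H) ds \<sigma>s \<and> sum_list ds = n \<and> P \<in> carrier_mat n n \<and> det P \<noteq> 0 \<and>
    (\<forall>h \<in> carrier H. \<rho> h * P = P * direct_sum_rep \<sigma>s h)"
  using rep
proof (induction n arbitrary: \<rho> rule: less_induct)
  case (less n)
  show ?case
  \<comment> \<open>Degree 0 is the empty sum, because the zero representation does not count as
    irreducible.\<close>
  proof (cases "n = 0 \<or> irreducible_rep H n \<rho>")
    case True
    then consider "n = 0" | "irreducible_rep H n \<rho>" by blast
    then show ?thesis
    proof cases
      case 1
      have "\<rho> h * 1\<^sub>m n = 1\<^sub>m n * direct_sum_rep [] h" if "h \<in> carrier H" for h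
        using less.prems that 1 by (auto simp: representation_iff direct_sum_rep_def intro!: eq_matI)
      then show ?thesis using 1 by (intro exI[of _ "[]"] exI[of _ "1\<^sub>m n"]) auto
    next
      case 2
      have "\<rho> h * 1\<^sub>m n = 1\<^sub>m n * direct_sum_rep [\<rho>] h" if "h \<in> carrier H" for h
      proof -
        have "direct_sum_rep [\<rho>] h = \<rho> h"
          by (simp only: direct_sum_rep_def list.map diag_block_mat_singleton)
        moreover have "\<rho> h \<in> carrier_mat n n" using less.prems that by (simp add: representation_iff)
        ultimately show ?thesis by simp
      qed
      then show ?thesis using 2 by (intro exI[of _ "[n]"] exI[of _ "[\<rho>]"] exI[of _ "1\<^sub>m n"]) auto
    qed
  next
    case False
    then obtain W where W: "invariant_subspace H n \<rho> W" "W \<noteq> {0\<^sub>v n}" "W \<noteq> carrier_vec n"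
      using less.prems by (auto simp: irreducible_rep_iff)
    obtain P d e A D where n: "n = d + e" and de: "d < n" "e < n"
      and P: "P \<in> carrier_mat n n" "det P \<noteq> 0" and A: "representation H d A" and D: "representation H e D"
      and eq: "\<forall>h \<in> carrier H. \<rho> h * P = P * four_block_mat (A h) (0\<^sub>m d e) (0\<^sub>m e d) (D h)"
      by (rule maschke_step[OF H less.prems W]) (rule that)
    obtain ds1 \<sigma>s1 P1 where 1: "list_all2 (irreducible_rep H) ds1 \<sigma>s1" "sum_list ds1 = d"
        "P1 \<in> carrier_mat d d" "det P1 \<noteq> 0" "\<And>h. h \<in> carrier H \<Longrightarrow> A h * P1 = P1 * direct_sum_rep \<sigma>s1 h"
      using less.IH[OF de(1) A] by blast
    obtain ds2 \<sigma>s2 P2 where 2: "list_all2 (irreducible_rep H) ds2 \<sigma>s2" "sum_list ds2 = e"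
        "P2 \<in> carrier_mat e e" "det P2 \<noteq> 0" "\<And>h. h \<in> carrier H \<Longrightarrow> D h * P2 = P2 * direct_sum_rep \<sigma>s2 h"
      using less.IH[OF de(2) D] by blast
    define R where "R = four_block_mat P1 (0\<^sub>m d e) (0\<^sub>m e d) P2"
    have R: "R \<in> carrier_mat n n" "det R \<noteq> 0"
      unfolding R_def n using 1(3,4) 2(3,4) det_block_diag[OF 1(3) 2(3)] by auto
    have "\<rho> h * (P * R) = P * R * direct_sum_rep (\<sigma>s1 @ \<sigma>s2) h" if h: "h \<in> carrier H" for h
    proof -
      have Ac: "A h \<in> carrier_mat d d" and Dc: "D h \<in> carrier_mat e e" and rc: "\<rho> h \<in> carrier_mat n n"
        using h A D less.prems by (auto simp: representation_iff)
      have s1: "direct_sum_rep \<sigma>s1 h \<in> carrier_mat d d" and s2: "direct_sum_rep \<sigma>s2 h \<in> carrier_mat e e"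
        using irreducible_rep_carrier[OF 1(1) h] irreducible_rep_carrier[OF 2(1) h] 1(2) 2(2) by auto
      let ?S = "four_block_mat (A h) (0\<^sub>m d e) (0\<^sub>m e d) (D h)"
      have app: "direct_sum_rep (\<sigma>s1 @ \<sigma>s2) h =
          four_block_mat (direct_sum_rep \<sigma>s1 h) (0\<^sub>m d e) (0\<^sub>m e d) (direct_sum_rep \<sigma>s2 h)"
        using s1 s2 by (simp add: diag_block_mat_append' Let_def)
      have S: "?S \<in> carrier_mat n n" and T: "direct_sum_rep (\<sigma>s1 @ \<sigma>s2) h \<in> carrier_mat n n"
        using Ac Dc s1 s2 n app by auto
      have "?S * R = four_block_mat (A h * P1) (0\<^sub>m d e) (0\<^sub>m e d) (D h * P2)"
        unfolding R_def
        using mult_block_upper_triangular[OF Ac zero_carrier_mat Dc 1(3) zero_carrier_mat 2(3)] Ac Dc 1(3) 2(3)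
        by simp
      also have "\<dots> = R * direct_sum_rep (\<sigma>s1 @ \<sigma>s2) h"
        unfolding R_def app
        using mult_block_upper_triangular[OF 1(3) zero_carrier_mat 2(3) s1 zero_carrier_mat s2] s1 s2 1(3) 2(3)
          1(5)[OF h] 2(5)[OF h]
        by simp
      finally have "?S * R = R * direct_sum_rep (\<sigma>s1 @ \<sigma>s2) h" .
      then show ?thesis by (rule intertwine_compose[OF rc S T P(1) R(1) eq[rule_format, OF h]])
    qed
    moreover have "det (P * R) \<noteq> 0" using det_mult[OF P(1) R(1)] P R by simp
    ultimately show ?thesis
      using 1(1,2) 2(1,2) P R n
      by (intro exI[of _ "ds1 @ ds2"] exI[of _ "\<sigma>s1 @ \<sigma>s2"] exI[of _ "P * R"])
         (auto intro: list_all2_appendI)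
  qed
qed

text \<open>The kernel of \<open>X\<close> is invariant, nonzero because the determinant vanishes,
  hence everything. No eigenvalue in the field is required, so over \<rat> too a matrix in the
  commutant is zero or invertible.\<close>

lemma schur_rational:
  fixes \<rho> :: "'h \<Rightarrow> 'a::field mat"
  assumes irr: "irreducible_rep H n \<rho>" and X: "X \<in> carrier_mat n n"
    and comm: "\<And>h. h \<in> carrier H \<Longrightarrow> X * \<rho> h = \<rho> h * X" and det: "det X = 0"
  shows "X = 0\<^sub>m n n"
proof -
  have rc: "\<rho> h \<in> carrier_mat n n" if "h \<in> carrier H" for h
    using irr that by (auto simp: irreducible_rep_iff representation_iff)
  define W where "W = {w \<in> carrier_vec n. X *\<^sub>v w = 0\<^sub>v n}"
  have "invariant_subspace H n \<rho> (carrier_vec n)"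
    using mult_mat_vec_carrier[OF rc] by (auto simp: invariant_subspace_def subspace_carrier)
  then have "invariant_subspace H n \<rho> W"
    unfolding W_def
  proof (rule invariant_subspace_kernel[OF _ X])
    fix h and w :: "'a vec" assume h: "h \<in> carrier H" and w: "w \<in> carrier_vec n" and 0: "X *\<^sub>v w = 0\<^sub>v n"
    have "X *\<^sub>v (\<rho> h *\<^sub>v w) = \<rho> h *\<^sub>v (X *\<^sub>v w)"
      using assoc_mult_mat_vec[OF X rc[OF h] w] assoc_mult_mat_vec[OF rc[OF h] X w] comm[OF h] by simp
    then show "X *\<^sub>v (\<rho> h *\<^sub>v w) = 0\<^sub>v n" using 0 mat_mult_zero_vec[OF rc[OF h]] by simp
  qed
  moreover have "W \<noteq> {0\<^sub>v n}"
    using det det_0_iff_vec_prod_zero_field[OF X] unfolding W_def by blast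
  ultimately have "W = carrier_vec n" using irr by (auto simp: irreducible_rep_iff)
  then have "X *\<^sub>v w = 0\<^sub>v n" if "w \<in> carrier_vec n" for w using that unfolding W_def by blast
  then have "(X *\<^sub>v unit_vec n j) $ i = 0" if "i < n" for i j using that by (simp del: index_mult_mat_vec)
  then have "X $$ (i, j) = 0" if "i < n" "j < n" for i j
    using that X by (metis carrier_matD index_mult_mat_vec index_row(1) scalar_prod_right_unit)
  then show ?thesis using X by (intro eq_matI) auto
qed

section \<open>A rational self-adjoint element of the commutant\<close>

definition mat_lim :: "nat \<Rightarrow> nat \<Rightarrow> (nat \<Rightarrow> real mat) \<Rightarrow> real mat \<Rightarrow> bool" where
  "mat_lim r c X A \<longleftrightarrow> (\<forall>t. X t \<in> carrier_mat r c) \<and> A \<in> carrier_mat r c \<and>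
     (\<forall>i<r. \<forall>j<c. (\<lambda>t. X t $$ (i, j)) \<longlonglongrightarrow> A $$ (i, j))"

lemma mat_mult_index_sum:
  assumes "U \<in> carrier_mat r m" "V \<in> carrier_mat m c" "i < r" "j < c"
  shows "(U * V) $$ (i, j) = (\<Sum>l<m. U $$ (i, l) * V $$ (l, j))"
  using assms by (auto simp: scalar_prod_def atLeast0LessThan)

lemma mat_lim_dims:
  assumes "mat_lim r c X A"
  shows "dim_row (X t) = r" "dim_col (X t) = c" "dim_row A = r" "dim_col A = c"
  using assms unfolding mat_lim_def by (auto intro: carrier_matD)

lemma mat_lim_const: "A \<in> carrier_mat r c \<Longrightarrow> mat_lim r c (\<lambda>_. A) A"
  by (simp add: mat_lim_def)

lemma mat_lim_mult:
  assumes "mat_lim r m X A" "mat_lim m c Y B"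
  shows "mat_lim r c (\<lambda>t. X t * Y t) (A * B)"
proof -
  have c: "X t \<in> carrier_mat r m" "Y t \<in> carrier_mat m c" "A \<in> carrier_mat r m" "B \<in> carrier_mat m c" for t
    using assms by (auto simp: mat_lim_def)
  have "(\<lambda>t. (X t * Y t) $$ (i, j)) \<longlonglongrightarrow> (A * B) $$ (i, j)" if "i < r" "j < c" for i j
  proof -
    have "(\<lambda>t. \<Sum>l<m. X t $$ (i, l) * Y t $$ (l, j)) \<longlonglongrightarrow> (\<Sum>l<m. A $$ (i, l) * B $$ (l, j))"
      using assms that by (intro tendsto_sum tendsto_mult) (auto simp: mat_lim_def)
    then show ?thesis
      unfolding mat_mult_index_sum[OF c(1,2) that] mat_mult_index_sum[OF c(3,4) that] .
  qed
  then show ?thesis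
    using mult_carrier_mat[OF c(1,2)] mult_carrier_mat[OF c(3,4)] unfolding mat_lim_def by blast
qed

lemma mat_lim_sum:
  assumes "\<And>h. h \<in> S \<Longrightarrow> mat_lim r c (X h) (A h)"
  shows "mat_lim r c (\<lambda>t. mat_sum r c (\<lambda>h. X h t) S) (mat_sum r c A S)"
  using assms unfolding mat_lim_def by (auto intro!: tendsto_sum)

lemma mat_lim_transpose: "mat_lim r c X A \<Longrightarrow> mat_lim c r (\<lambda>t. (X t)\<^sup>T) A\<^sup>T"
  using mat_lim_dims[of r c X A] unfolding mat_lim_def by auto

lemma mat_lim_pow: "mat_lim n n X A \<Longrightarrow> mat_lim n n (\<lambda>t. X t ^\<^sub>m k) (A ^\<^sub>m k)"
proof (induction k)
  case 0
  then show ?case using mat_lim_dims[of n n X A] by (simp add: mat_lim_const)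
next
  case (Suc k)
  then show ?case using mat_lim_mult[of n n "\<lambda>t. X t ^\<^sub>m k" "A ^\<^sub>m k" n X A] by simp
qed

lemma mat_lim_det:
  assumes "mat_lim n n X A"
  shows "(\<lambda>t. det (X t)) \<longlonglongrightarrow> det A"
proof -
  have c: "X t \<in> carrier_mat n n" "A \<in> carrier_mat n n" for t using assms by (auto simp: mat_lim_def)
  have "(\<lambda>t. \<Sum>p\<in>{p. p permutes {0..<n}}. signof p * (\<Prod>i = 0..<n. X t $$ (i, p i))) \<longlonglongrightarrow>
      (\<Sum>p\<in>{p. p permutes {0..<n}}. signof p * (\<Prod>i = 0..<n. A $$ (i, p i)))"
  proof (intro tendsto_sum tendsto_mult tendsto_const tendsto_prod)
    fix p i assume "p \<in> {p. p permutes {0..<n}}" "i \<in> {0..<n}"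
    then have "i < n" "p i < n" using permutes_in_image[of p "{0..<n}" i] by auto
    then show "(\<lambda>t. X t $$ (i, p i)) \<longlonglongrightarrow> A $$ (i, p i)" using assms by (simp add: mat_lim_def)
  qed
  then show ?thesis using c by (simp add: det_def'[of _ n])
qed

text \<open>The adjugate stands in for the inverse: its entries are polynomials in the entries of
  the matrix, so it passes to the limit without any invertibility and commutes with the embedding of
  \<rat> into \<real>.\<close>

lemma mat_lim_adj:
  assumes "mat_lim n n X A"
  shows "mat_lim n n (\<lambda>t. adj_mat (X t)) (adj_mat A)"
proof -
  have c: "X t \<in> carrier_mat n n" "A \<in> carrier_mat n n" for t using assms by (auto simp: mat_lim_def)
  have "(\<lambda>t. adj_mat (X t) $$ (i, j)) \<longlonglongrightarrow> adj_mat A $$ (i, j)" if ij: "i < n" "j < n" for i j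
  proof -
    have "mat_lim (n - 1) (n - 1) (\<lambda>t. mat_delete (X t) j i) (mat_delete A j i)"
      unfolding mat_lim_def
    proof (intro conjI allI impI)
      fix i' j' assume "i' < n - 1" "j' < n - 1"
      then show "(\<lambda>t. mat_delete (X t) j i $$ (i', j')) \<longlonglongrightarrow> mat_delete A j i $$ (i', j')"
        using assms mat_lim_dims[OF assms] unfolding mat_delete_def mat_lim_def by auto
    qed (use mat_delete_carrier[OF c(1)] mat_delete_carrier[OF c(2)] in blast)+
    then have "(\<lambda>t. (-1) ^ (j + i) * det (mat_delete (X t) j i)) \<longlonglongrightarrow> (-1) ^ (j + i) * det (mat_delete A j i)"
      by (intro tendsto_mult tendsto_const mat_lim_det)
    then show ?thesis using ij c by (simp add: adj_mat_def cofactor_def carrier_matD[of _ n n])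
  qed
  then show ?thesis using adj_mat(1)[OF c(1)] adj_mat(1)[OF c(2)] unfolding mat_lim_def by blast
qed

lemma rational_mat_approx:
  assumes A: "A \<in> carrier_mat r c"
  obtains X :: "nat \<Rightarrow> rat mat" where "\<And>t. X t \<in> carrier_mat r c"
    "mat_lim r c (\<lambda>t. map_mat of_rat (X t)) A"
proof -
  have "\<exists>q. \<forall>t. \<bar>real_of_rat (q t) - x\<bar> < 1 / Suc t" for x :: real
  proof -
    have "\<exists>q. \<bar>real_of_rat q - x\<bar> < 1 / Suc t" for t
    proof -
      obtain q where "x - 1 / Suc t < real_of_rat q" "real_of_rat q < x"
        using of_rat_dense[of "x - 1 / Suc t" x] by auto
      then show ?thesis by (intro exI[of _ q]) auto
    qed
    then show ?thesis by metis
  qed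
  then obtain q where q: "\<And>x t. \<bar>real_of_rat (q x t) - x\<bar> < 1 / Suc t" by metis
  have lim: "(\<lambda>t. real_of_rat (q x t)) \<longlonglongrightarrow> x" for x
  proof (rule LIMSEQ_I)
    fix e :: real assume "e > 0"
    then obtain N where N: "1 / Suc N < e" using nat_approx_posE by blast
    have "\<bar>real_of_rat (q x t) - x\<bar> < e" if "t \<ge> N" for t
    proof -
      have "1 / real (Suc t) \<le> 1 / Suc N" using that by (intro divide_left_mono) auto
      then show ?thesis using q[of x t] N by linarith
    qed
    then show "\<exists>N. \<forall>t\<ge>N. norm (real_of_rat (q x t) - x) < e" by auto
  qed
  define X where "X t = mat r c (\<lambda>ij. q (A $$ ij) t)" for t
  show ?thesis
  proof (rule that[of X])
    show "X t \<in> carrier_mat r c" for t by (simp add: X_def)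
    show "mat_lim r c (\<lambda>t. map_mat of_rat (X t)) A"
      using A lim by (auto simp: mat_lim_def X_def)
  qed
qed

section \<open>Independence of the powers of a matrix, tested by traces\<close>

definition mat_poly :: "nat \<Rightarrow> nat \<Rightarrow> (nat \<Rightarrow> 'a::comm_ring_1) \<Rightarrow> 'a mat \<Rightarrow> 'a mat" where
  "mat_poly n k c S = mat_sum n n (\<lambda>l. c l \<cdot>\<^sub>m (S ^\<^sub>m l)) {..<k}"

definition mat_trace :: "nat \<Rightarrow> 'a::comm_monoid_add mat \<Rightarrow> 'a" where
  "mat_trace n A = (\<Sum>i<n. A $$ (i, i))"

lemma mat_trace_commute:
  fixes A :: "'a::comm_semiring_0 mat"
  assumes "A \<in> carrier_mat n n" "B \<in> carrier_mat n n"
  shows "mat_trace n (A * B) = mat_trace n (B * A)"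
proof -
  have e: "mat_trace n (X * Y) = (\<Sum>i<n. \<Sum>l<n. X $$ (i, l) * Y $$ (l, i))"
    if "X \<in> carrier_mat n n" "Y \<in> carrier_mat n n" for X Y :: "'a mat"
    using that by (auto simp: mat_trace_def scalar_prod_def atLeast0LessThan)
  show ?thesis unfolding e[OF assms] e[OF assms(2,1)]
    by (subst sum.swap) (simp add: mult.commute)
qed

text \<open>Gram matrix of 1, S, ..., S^(k - 1) for the trace form (X, Y) \<mapsto> tr (X Y). A
  nonzero determinant certifies that these powers are independent and, being polynomial in the
  entries of \<open>S\<close>, stays nonzero under small changes of \<open>S\<close>.\<close>

definition trace_gram :: "nat \<Rightarrow> nat \<Rightarrow> 'a::comm_ring_1 mat \<Rightarrow> 'a mat" where
  "trace_gram n k S = mat k k (\<lambda>(i, j). mat_trace n (S ^\<^sub>m (i + j)))"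

lemma pow_mat_add:
  fixes A :: "'a::semiring_1 mat"
  assumes "A \<in> carrier_mat n n"
  shows "A ^\<^sub>m (i + j) = A ^\<^sub>m i * A ^\<^sub>m j"
proof (induction j)
  case (Suc j)
  then show ?case
    using assms pow_carrier_mat[OF assms] by (simp add: assoc_mult_mat[of _ n n _ n _ n])
qed (use assms pow_carrier_mat[OF assms] in auto)

text \<open>The coefficients of a linear relation among the powers form a kernel vector: row i of
  the Gram matrix tests the relation against S^i under the trace.\<close>

lemma det_trace_gram_zero:
  fixes S :: "'a::field mat"
  assumes S: "S \<in> carrier_mat n n" and zero: "mat_poly n k c S = 0\<^sub>m n n" and c: "l < k" "c l \<noteq> 0"
  shows "det (trace_gram n k S) = 0"
proof -
  define v where "v = vec k c"
  have v: "v \<in> carrier_vec k" "v \<noteq> 0\<^sub>v k"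
    using c by (auto simp: v_def dest!: arg_cong[of _ _ "\<lambda>v. v $ l"])
  have Sp: "S ^\<^sub>m l \<in> carrier_mat n n" for l by (rule pow_carrier_mat[OF S])
  have "trace_gram n k S *\<^sub>v v = 0\<^sub>v k"
  proof (rule eq_vecI)
    fix i assume "i < dim_vec (0\<^sub>v k :: 'a vec)"
    then have i: "i < k" by simp
    have "(trace_gram n k S *\<^sub>v v) $ i = (\<Sum>j<k. (\<Sum>a<n. (S ^\<^sub>m (i + j)) $$ (a, a)) * c j)"
      using i by (auto simp: trace_gram_def v_def scalar_prod_def mat_trace_def atLeast0LessThan)
    also have "\<dots> = (\<Sum>j<k. \<Sum>a<n. \<Sum>b<n. (S ^\<^sub>m i) $$ (a, b) * (c j * (S ^\<^sub>m j) $$ (b, a)))"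
    proof (intro sum.cong refl)
      fix j
      have "(S ^\<^sub>m (i + j)) $$ (a, a) * c j = (\<Sum>b<n. (S ^\<^sub>m i) $$ (a, b) * (c j * (S ^\<^sub>m j) $$ (b, a)))"
        if "a < n" for a
        unfolding pow_mat_add[OF S] mat_mult_index_sum[OF Sp Sp that that] sum_distrib_right
        by (simp add: mult_ac)
      then show "(\<Sum>a<n. (S ^\<^sub>m (i + j)) $$ (a, a)) * c j =
          (\<Sum>a<n. \<Sum>b<n. (S ^\<^sub>m i) $$ (a, b) * (c j * (S ^\<^sub>m j) $$ (b, a)))"
        by (simp add: sum_distrib_right)
    qed
    also have "\<dots> = (\<Sum>a<n. \<Sum>b<n. (S ^\<^sub>m i) $$ (a, b) * (\<Sum>j<k. c j * (S ^\<^sub>m j) $$ (b, a)))"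
      by (subst sum.swap, rule sum.cong[OF refl], subst sum.swap) (simp add: sum_distrib_left)
    also have "\<dots> = 0"
    proof (intro sum.neutral ballI)
      fix a b assume ab: "a \<in> {..<n}" "b \<in> {..<n}"
      have "mat_poly n k c S $$ (b, a) = (\<Sum>j<k. (c j \<cdot>\<^sub>m (S ^\<^sub>m j)) $$ (b, a))"
        using ab by (simp add: mat_poly_def)
      also have "\<dots> = (\<Sum>j<k. c j * (S ^\<^sub>m j) $$ (b, a))"
        using ab Sp by (intro sum.cong refl index_smult_mat) (auto simp: carrier_matD[OF S])
      finally show "(S ^\<^sub>m i) $$ (a, b) * (\<Sum>j<k. c j * (S ^\<^sub>m j) $$ (b, a)) = 0"
        using zero ab by simp
    qed
    finally show "(trace_gram n k S *\<^sub>v v) $ i = 0\<^sub>v k $ i" using i by simp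
  qed (simp add: trace_gram_def)
  then show ?thesis
    using det_0_iff_vec_prod_zero_field[of "trace_gram n k S" k] v by (auto simp: trace_gram_def)
qed

lemma polynomial_many_roots_zero:
  fixes c :: "nat \<Rightarrow> 'a::idom"
  assumes "card A \<ge> k" "finite A" "\<And>x. x \<in> A \<Longrightarrow> (\<Sum>l<k. c l * x ^ l) = 0" "l < k"
  shows "c l = 0"
proof -
  define p where "p = (\<Sum>l<k. monom (c l) l)"
  have co: "coeff p i = (if i < k then c i else 0)" for i
    by (simp add: p_def coeff_sum)
  have pz: "poly p x = (\<Sum>l<k. c l * x ^ l)" for x
    by (simp add: p_def poly_sum poly_monom)
  show ?thesis
  proof (cases "p = 0")
    case True
    then show ?thesis using co[of l] assms(4) by simp
  next
    case False
    have "degree p < k" using False assms(4) co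
      by (metis leading_coeff_0_iff)
    moreover have "A \<subseteq> {x. poly p x = 0}" using assms(3) pz by auto
    then have "card A \<le> degree p"
      using card_poly_roots_bound[OF False] poly_roots_finite[OF False] card_mono by (meson le_trans)
    ultimately show ?thesis using assms(1) by simp
  qed
qed

text \<open>The bilinear form \<Theta> pulled back along the coordinates \<open>Q\<close> and summed
  over the translates by \<open>H\<close>. Symmetry (for symmetric \<Theta>) and invariance hold
  exactly for every \<open>Q\<close>, so \<open>Q\<close> can be replaced by a rational
  approximation without spoiling either.\<close>

definition averaged_form ::
    "('h, 'b) monoid_scheme \<Rightarrow> nat \<Rightarrow> ('h \<Rightarrow> 'a::comm_ring_1 mat) \<Rightarrow> 'a mat \<Rightarrow> 'a mat \<Rightarrow> 'a mat" where
  "averaged_form H n \<rho> \<Theta> Q = mat_sum n n (\<lambda>h. (Q * \<rho> h)\<^sup>T * (\<Theta> * (Q * \<rho> h))) (carrier H)"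

lemma averaged_form_carrier [simp]: "averaged_form H n \<rho> \<Theta> Q \<in> carrier_mat n n"
  by (simp add: averaged_form_def)

lemma transpose_mat_sum:
  assumes "\<And>h. h \<in> S \<Longrightarrow> f h \<in> carrier_mat nr nc"
  shows "(mat_sum nr nc f S)\<^sup>T = mat_sum nc nr (\<lambda>h. (f h)\<^sup>T) S"
proof (rule eq_matI)
  fix i j assume "i < dim_row (mat_sum nc nr (\<lambda>h. (f h)\<^sup>T) S)" "j < dim_col (mat_sum nc nr (\<lambda>h. (f h)\<^sup>T) S)"
  then have ij: "i < nc" "j < nr" by auto
  have "(\<Sum>h\<in>S. f h $$ (j, i)) = (\<Sum>h\<in>S. (f h)\<^sup>T $$ (i, j))"
    using ij carrier_matD[OF assms] by (intro sum.cong) auto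
  then show "(mat_sum nr nc f S)\<^sup>T $$ (i, j) = mat_sum nc nr (\<lambda>h. (f h)\<^sup>T) S $$ (i, j)"
    using ij by simp
qed auto

lemma congruence_carrier:
  "X \<in> carrier_mat n n \<Longrightarrow> \<Theta> \<in> carrier_mat n n \<Longrightarrow> X\<^sup>T * (\<Theta> * X) \<in> carrier_mat n n"
  by auto

lemma averaged_form_symmetric:
  fixes \<rho> :: "'h \<Rightarrow> 'a::field mat"
  assumes \<rho>: "\<And>h. h \<in> carrier H \<Longrightarrow> \<rho> h \<in> carrier_mat n n" and Q: "Q \<in> carrier_mat n n"
    and \<Theta>: "\<Theta> \<in> carrier_mat n n" "\<Theta>\<^sup>T = \<Theta>"
  shows "(averaged_form H n \<rho> \<Theta> Q)\<^sup>T = averaged_form H n \<rho> \<Theta> Q"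
proof -
  have "((Q * \<rho> h)\<^sup>T * (\<Theta> * (Q * \<rho> h)))\<^sup>T = (Q * \<rho> h)\<^sup>T * (\<Theta> * (Q * \<rho> h))" if "h \<in> carrier H" for h
  proof -
    have X: "Q * \<rho> h \<in> carrier_mat n n" using Q \<rho>[OF that] by simp
    have "((Q * \<rho> h)\<^sup>T * (\<Theta> * (Q * \<rho> h)))\<^sup>T = (\<Theta> * (Q * \<rho> h))\<^sup>T * (Q * \<rho> h)"
      using X \<Theta>(1) transpose_mult[of "(Q * \<rho> h)\<^sup>T" n n "\<Theta> * (Q * \<rho> h)" n] by simp
    also have "(\<Theta> * (Q * \<rho> h))\<^sup>T = (Q * \<rho> h)\<^sup>T * \<Theta>"
      using transpose_mult[OF \<Theta>(1) X] \<Theta>(2) by simp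
    finally show ?thesis using X \<Theta>(1) assoc_mult_mat[of "(Q * \<rho> h)\<^sup>T" n n \<Theta> n "Q * \<rho> h" n] by simp
  qed
  moreover have "(Q * \<rho> h)\<^sup>T * (\<Theta> * (Q * \<rho> h)) \<in> carrier_mat n n" if "h \<in> carrier H" for h
    using congruence_carrier[OF mult_carrier_mat[OF Q \<rho>[OF that]] \<Theta>(1)] .
  ultimately show ?thesis
    unfolding averaged_form_def by (subst transpose_mat_sum) (auto intro: mat_sum_cong)
qed

text \<open>Multiplication by \<open>g\<close> on the right permutes the summands.\<close>

lemma averaged_form_invariant:
  fixes \<rho> :: "'h \<Rightarrow> 'a::field mat"
  assumes H: "group H" and \<rho>: "representation H n \<rho>" and Q: "Q \<in> carrier_mat n n"
    and \<Theta>: "\<Theta> \<in> carrier_mat n n" and g: "g \<in> carrier H"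
  shows "(\<rho> g)\<^sup>T * averaged_form H n \<rho> \<Theta> Q * \<rho> g = averaged_form H n \<rho> \<Theta> Q"
proof -
  have rc: "\<rho> h \<in> carrier_mat n n" if "h \<in> carrier H" for h using \<rho> that by (simp add: representation_iff)
  let ?f = "\<lambda>h. (Q * \<rho> h)\<^sup>T * (\<Theta> * (Q * \<rho> h))"
  have fc: "?f h \<in> carrier_mat n n" if "h \<in> carrier H" for h
    using congruence_carrier[OF mult_carrier_mat[OF Q rc[OF that]] \<Theta>] .
  have "(\<rho> g)\<^sup>T * mat_sum n n ?f (carrier H) * \<rho> g = mat_sum n n (\<lambda>h. (\<rho> g)\<^sup>T * ?f h) (carrier H) * \<rho> g"
    using mult_mat_sum_left[of "(\<rho> g)\<^sup>T" n n "carrier H" ?f n] fc rc[OF g] by simp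
  also have "\<dots> = mat_sum n n (\<lambda>h. (\<rho> g)\<^sup>T * ?f h * \<rho> g) (carrier H)"
    using fc rc[OF g] by (intro mult_mat_sum_right) auto
  also have "\<dots> = mat_sum n n (\<lambda>h. ?f (h \<otimes>\<^bsub>H\<^esub> g)) (carrier H)"
  proof (rule mat_sum_cong)
    fix h assume h: "h \<in> carrier H"
    have X: "Q * \<rho> h \<in> carrier_mat n n" using Q rc[OF h] by simp
    have e: "Q * \<rho> (h \<otimes>\<^bsub>H\<^esub> g) = (Q * \<rho> h) * \<rho> g"
      using \<rho> h g assoc_mult_mat[OF Q rc[OF h] rc[OF g]] by (simp add: representation_iff)
    have "(Q * \<rho> (h \<otimes>\<^bsub>H\<^esub> g))\<^sup>T = (\<rho> g)\<^sup>T * (Q * \<rho> h)\<^sup>T"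
      unfolding e by (rule transpose_mult[OF X rc[OF g]])
    then show "(\<rho> g)\<^sup>T * ?f h * \<rho> g = ?f (h \<otimes>\<^bsub>H\<^esub> g)"
      unfolding e using X rc[OF g] \<Theta> by (simp add: assoc_mult_mat[of _ n n _ n _ n])
  qed
  also have "\<dots> = mat_sum n n ?f (carrier H)"
    by (rule mat_sum_reindex[OF bij_betw_group_mult(2)[OF H g]])
  finally show ?thesis unfolding averaged_form_def .
qed

lemma scalar_prod_mat_sum:
  fixes f :: "'h \<Rightarrow> 'a::comm_semiring_0 mat"
  assumes f: "\<And>h. h \<in> S \<Longrightarrow> f h \<in> carrier_mat n n" and v: "v \<in> carrier_vec n"
  shows "v \<bullet> (mat_sum n n f S *\<^sub>v v) = (\<Sum>h\<in>S. v \<bullet> (f h *\<^sub>v v))"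
proof -
  have e: "v \<bullet> (A *\<^sub>v v) = (\<Sum>i<n. \<Sum>j<n. v $ i * (A $$ (i, j) * v $ j))"
    if "A \<in> carrier_mat n n" for A
    using that v by (auto simp: scalar_prod_def atLeast0LessThan sum_distrib_left)
  have "v \<bullet> (mat_sum n n f S *\<^sub>v v) = (\<Sum>i<n. \<Sum>j<n. \<Sum>h\<in>S. v $ i * (f h $$ (i, j) * v $ j))"
    by (simp add: e sum_distrib_left sum_distrib_right)
  also have "\<dots> = (\<Sum>i<n. \<Sum>h\<in>S. \<Sum>j<n. v $ i * (f h $$ (i, j) * v $ j))"
    by (intro sum.cong refl sum.swap)
  also have "\<dots> = (\<Sum>h\<in>S. \<Sum>i<n. \<Sum>j<n. v $ i * (f h $$ (i, j) * v $ j))"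
    by (rule sum.swap)
  finally show ?thesis using f by (simp add: e)
qed

text \<open>The value at \<open>v\<close> is the sum of the squared lengths of the vectors Q
  \<rho>(h) v, so it is nonpositive only if all of them vanish. As \<open>Q\<close> may be singular,
  the conclusion is that \<open>v\<close> lies in the radical; that \<open>v\<close> is zero is
  settled separately for each use.\<close>

lemma averaged_form_positive:
  fixes \<rho> :: "'h \<Rightarrow> real mat"
  assumes fin: "finite (carrier H)" and \<rho>: "\<And>h. h \<in> carrier H \<Longrightarrow> \<rho> h \<in> carrier_mat n n"
    and Q: "Q \<in> carrier_mat n n" and v: "v \<in> carrier_vec n"
    and zero: "v \<bullet> (averaged_form H n \<rho> (1\<^sub>m n) Q *\<^sub>v v) \<le> 0"
  shows "averaged_form H n \<rho> (1\<^sub>m n) Q *\<^sub>v v = 0\<^sub>v n" "\<And>h. h \<in> carrier H \<Longrightarrow> (Q * \<rho> h) *\<^sub>v v = 0\<^sub>v n"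
proof -
  let ?f = "\<lambda>h. (Q * \<rho> h)\<^sup>T * (1\<^sub>m n * (Q * \<rho> h))"
  have X: "Q * \<rho> h \<in> carrier_mat n n" if "h \<in> carrier H" for h using Q \<rho>[OF that] by simp
  have fv: "?f h *\<^sub>v v = (Q * \<rho> h)\<^sup>T *\<^sub>v ((Q * \<rho> h) *\<^sub>v v)" if "h \<in> carrier H" for h
  proof -
    have "(Q * \<rho> h)\<^sup>T \<in> carrier_mat n n" using X[OF that] by simp
    from assoc_mult_mat_vec[OF this X[OF that] v] show ?thesis
      unfolding left_mult_one_mat[OF X[OF that]] .
  qed
  have t: "v \<bullet> (?f h *\<^sub>v v) = ((Q * \<rho> h) *\<^sub>v v) \<bullet> ((Q * \<rho> h) *\<^sub>v v)" if "h \<in> carrier H" for h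
  proof -
    have Xv: "(Q * \<rho> h) *\<^sub>v v \<in> carrier_vec n" using X[OF that] v by simp
    then show ?thesis
      unfolding fv[OF that]
      using transpose_vec_mult_scalar[OF X[OF that] v Xv] comm_scalar_prod[OF v, of "(Q * \<rho> h)\<^sup>T *\<^sub>v ((Q * \<rho> h) *\<^sub>v v)"] X[OF that]
      by simp
  qed
  have fc: "?f h \<in> carrier_mat n n" if "h \<in> carrier H" for h
    by (rule congruence_carrier[OF X[OF that] one_carrier_mat])
  have "v \<bullet> (averaged_form H n \<rho> (1\<^sub>m n) Q *\<^sub>v v) = (\<Sum>h\<in>carrier H. ((Q * \<rho> h) *\<^sub>v v) \<bullet> ((Q * \<rho> h) *\<^sub>v v))"
    unfolding averaged_form_def
    by (rule trans[OF scalar_prod_mat_sum[OF fc v] sum.cong[OF refl t]])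
  then have s: "(\<Sum>h\<in>carrier H. ((Q * \<rho> h) *\<^sub>v v) \<bullet> ((Q * \<rho> h) *\<^sub>v v)) \<le> 0" using zero by simp
  have nn: "0 \<le> w \<bullet> w" for w :: "real vec" unfolding scalar_prod_def by (intro sum_nonneg) auto
  have z: "((Q * \<rho> h) *\<^sub>v v) \<bullet> ((Q * \<rho> h) *\<^sub>v v) = 0" if "h \<in> carrier H" for h
    using s nn sum_nonneg_eq_0_iff[OF fin, of "\<lambda>h. ((Q * \<rho> h) *\<^sub>v v) \<bullet> ((Q * \<rho> h) *\<^sub>v v)"] that
    by (meson order_antisym sum_nonneg)
  show Xz: "(Q * \<rho> h) *\<^sub>v v = 0\<^sub>v n" if "h \<in> carrier H" for h
  proof (rule eq_vecI)
    fix i assume "i < dim_vec (0\<^sub>v n :: real vec)"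
    then have i: "i < n" by simp
    let ?w = "(Q * \<rho> h) *\<^sub>v v"
    have dw: "dim_vec ?w = n" using carrier_matD[OF X[OF that]] by simp
    have "(\<Sum>j\<in>{0..<n}. ?w $ j * ?w $ j) = 0" using z[OF that] dw by (simp only: scalar_prod_def)
    then have "?w $ i * ?w $ i = 0"
      using i sum_nonneg_eq_0_iff[of "{0..<n}" "\<lambda>j. ?w $ j * ?w $ j"] by simp
    then show "?w $ i = 0\<^sub>v n $ i" using i by simp
  qed (use carrier_matD[OF X[OF that]] in simp)
  show "averaged_form H n \<rho> (1\<^sub>m n) Q *\<^sub>v v = 0\<^sub>v n"
  proof (rule eq_vecI)
    fix i assume "i < dim_vec (0\<^sub>v n :: real vec)"
    then have i: "i < n" by simp
    have "(averaged_form H n \<rho> (1\<^sub>m n) Q *\<^sub>v v) $ i = (\<Sum>j<n. (\<Sum>h\<in>carrier H. ?f h $$ (i, j)) * v $ j)"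
      using i v by (auto simp: averaged_form_def scalar_prod_def atLeast0LessThan)
    also have "\<dots> = (\<Sum>h\<in>carrier H. \<Sum>j<n. ?f h $$ (i, j) * v $ j)"
      unfolding sum_distrib_right by (rule sum.swap)
    also have "\<dots> = (\<Sum>h\<in>carrier H. (?f h *\<^sub>v v) $ i)"
    proof (rule sum.cong[OF refl])
      fix h assume "h \<in> carrier H"
      then have "dim_row (?f h) = n" "dim_col (?f h) = n" using carrier_matD[OF fc] by auto
      then show "(\<Sum>j<n. ?f h $$ (i, j) * v $ j) = (?f h *\<^sub>v v) $ i"
        using i v by (simp add: scalar_prod_def atLeast0LessThan del: index_mult_mat)
    qed
    also have "\<dots> = 0"
    proof (intro sum.neutral ballI)
      fix h assume h: "h \<in> carrier H"
      have "(Q * \<rho> h)\<^sup>T *\<^sub>v 0\<^sub>v n = 0\<^sub>v n" using X[OF h] by (intro mat_mult_zero_vec) auto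
      then show "(?f h *\<^sub>v v) $ i = 0" unfolding fv[OF h] Xz[OF h] using i by simp
    qed
    finally show "(averaged_form H n \<rho> (1\<^sub>m n) Q *\<^sub>v v) $ i = 0\<^sub>v n $ i" using i by simp
  qed (simp add: averaged_form_def)
qed

lemma map_mat_sum:
  fixes f :: "'h \<Rightarrow> rat mat"
  assumes "\<And>h. h \<in> S \<Longrightarrow> f h \<in> carrier_mat nr nc"
  shows "map_mat real_of_rat (mat_sum nr nc f S) = mat_sum nr nc (\<lambda>h. map_mat real_of_rat (f h)) S"
proof (rule eq_matI)
  fix i j assume "i < dim_row (mat_sum nr nc (\<lambda>h. map_mat real_of_rat (f h)) S)"
    "j < dim_col (mat_sum nr nc (\<lambda>h. map_mat real_of_rat (f h)) S)"
  then have ij: "i < nr" "j < nc" by auto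
  have "(\<Sum>h\<in>S. real_of_rat (f h $$ (i, j))) = (\<Sum>h\<in>S. map_mat real_of_rat (f h) $$ (i, j))"
    using ij carrier_matD[OF assms] by (intro sum.cong) auto
  then show "map_mat real_of_rat (mat_sum nr nc f S) $$ (i, j) =
      mat_sum nr nc (\<lambda>h. map_mat real_of_rat (f h)) S $$ (i, j)"
    using ij by (simp add: of_rat_sum)
qed auto

lemma map_mat_of_rat_mult:
  assumes "A \<in> carrier_mat r m" "B \<in> carrier_mat m c"
  shows "map_mat real_of_rat (A * B) = map_mat real_of_rat A * map_mat real_of_rat B"
  by (rule of_rat_hom.mat_hom_mult[OF assms])

lemma map_mat_averaged_form:
  assumes \<rho>: "\<And>h. h \<in> carrier H \<Longrightarrow> \<rho> h \<in> carrier_mat n n" and Q: "Q \<in> carrier_mat n n" and \<Theta>: "\<Theta> \<in> carrier_mat n n"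
  shows "map_mat real_of_rat (averaged_form H n \<rho> \<Theta> Q) =
    averaged_form H n (real_extension \<rho>) (map_mat of_rat \<Theta>) (map_mat of_rat Q)"
proof -
  have "map_mat real_of_rat ((Q * \<rho> h)\<^sup>T * (\<Theta> * (Q * \<rho> h))) =
      (map_mat of_rat Q * real_extension \<rho> h)\<^sup>T * (map_mat of_rat \<Theta> * (map_mat of_rat Q * real_extension \<rho> h))"
    if "h \<in> carrier H" for h
  proof -
    have X: "Q * \<rho> h \<in> carrier_mat n n" using Q \<rho>[OF that] by simp
    have Xt: "(Q * \<rho> h)\<^sup>T \<in> carrier_mat n n" using X by simp
    have "map_mat real_of_rat ((Q * \<rho> h)\<^sup>T) = (map_mat of_rat (Q * \<rho> h))\<^sup>T"
      by (intro eq_matI) auto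
    then show ?thesis
      unfolding map_mat_of_rat_mult[OF Xt mult_carrier_mat[OF \<Theta> X]] map_mat_of_rat_mult[OF \<Theta> X]
        map_mat_of_rat_mult[OF Q \<rho>[OF that]] real_extension_def by simp
  qed
  moreover have "(Q * \<rho> h)\<^sup>T * (\<Theta> * (Q * \<rho> h)) \<in> carrier_mat n n" if "h \<in> carrier H" for h
    using congruence_carrier[OF mult_carrier_mat[OF Q \<rho>[OF that]] \<Theta>] .
  ultimately show ?thesis
    unfolding averaged_form_def by (subst map_mat_sum) (auto intro: mat_sum_cong)
qed

lemma map_mat_adj:
  assumes "A \<in> carrier_mat n n"
  shows "map_mat real_of_rat (adj_mat A) = adj_mat (map_mat real_of_rat A)"
proof (rule eq_matI)
  fix i j assume "i < dim_row (adj_mat (map_mat real_of_rat A))" "j < dim_col (adj_mat (map_mat real_of_rat A))"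
  then have ij: "i < n" "j < n" using assms by (auto simp: adj_mat_def)
  have "mat_delete (map_mat real_of_rat A) j i = map_mat real_of_rat (mat_delete A j i)"
    using assms ij by (intro eq_matI) (auto simp: mat_delete_def)
  then show "map_mat real_of_rat (adj_mat A) $$ (i, j) = adj_mat (map_mat real_of_rat A) $$ (i, j)"
    using assms ij by (simp add: adj_mat_def cofactor_def of_rat_mult of_rat_power of_rat_hom.hom_det)
qed (use assms in \<open>auto simp: adj_mat_def\<close>)

lemma mat_lim_averaged_form:
  assumes \<rho>: "\<And>h. h \<in> carrier H \<Longrightarrow> \<rho> h \<in> carrier_mat n n" and \<Theta>: "\<Theta> \<in> carrier_mat n n"
    and Q: "mat_lim n n X Q"
  shows "mat_lim n n (\<lambda>t. averaged_form H n \<rho> \<Theta> (X t)) (averaged_form H n \<rho> \<Theta> Q)"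
  unfolding averaged_form_def
proof (rule mat_lim_sum)
  fix h assume h: "h \<in> carrier H"
  have X: "mat_lim n n (\<lambda>t. X t * \<rho> h) (Q * \<rho> h)"
    by (rule mat_lim_mult[OF Q mat_lim_const[OF \<rho>[OF h]]])
  show "mat_lim n n (\<lambda>t. (X t * \<rho> h)\<^sup>T * (\<Theta> * (X t * \<rho> h))) ((Q * \<rho> h)\<^sup>T * (\<Theta> * (Q * \<rho> h)))"
    by (rule mat_lim_mult[OF mat_lim_transpose[OF X] mat_lim_mult[OF mat_lim_const[OF \<Theta>] X]])
qed

lemma mat_lim_trace_gram:
  assumes "mat_lim n n X A"
  shows "mat_lim k k (\<lambda>t. trace_gram n k (X t)) (trace_gram n k A)"
proof -
  have "(\<lambda>t. mat_trace n (X t ^\<^sub>m l)) \<longlonglongrightarrow> mat_trace n (A ^\<^sub>m l)" for l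
    unfolding mat_trace_def using mat_lim_pow[OF assms, of l] by (intro tendsto_sum) (auto simp: mat_lim_def)
  then show ?thesis unfolding mat_lim_def trace_gram_def by auto
qed

text \<open>\<open>S\<close> is, up to the scalar \<open>d\<close>, the quotient of two invariant
  forms, and such a quotient is equivariant: the transpose of \<open>R\<close> times B S R and the
  transpose of \<open>R\<close> times B R S both equal d F, and the common invertible factors
  cancel.\<close>

lemma form_quotient_commutes:
  fixes B :: "'a::field mat"
  assumes c: "B \<in> carrier_mat n n" "F \<in> carrier_mat n n" "S \<in> carrier_mat n n" "R \<in> carrier_mat n n"
    and inv: "R\<^sup>T * B * R = B" "R\<^sup>T * F * R = F" and S: "B * S = d \<cdot>\<^sub>m F"
    and det: "det B \<noteq> 0" "det R \<noteq> 0"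
  shows "S * R = R * S"
proof -
  obtain B' where B': "B' \<in> carrier_mat n n" "B' * B = 1\<^sub>m n" using det_inverse_exists[OF c(1) det(1)] by metis
  have dR: "det (R\<^sup>T) \<noteq> 0" using det(2) det_transpose[OF c(4)] by simp
  have Rt: "R\<^sup>T \<in> carrier_mat n n" using c by simp
  obtain T where T: "T \<in> carrier_mat n n" "T * R\<^sup>T = 1\<^sub>m n" using det_inverse_exists[OF Rt dR] by metis
  have "R\<^sup>T * (B * (S * R)) = R\<^sup>T * ((B * S) * R)" using c by (simp add: assoc_mult_mat[of _ n n _ n _ n])
  also have "\<dots> = d \<cdot>\<^sub>m (R\<^sup>T * (F * R))"
    unfolding S using c Rt by (simp add: mult_smult_assoc_mat[of _ n n _ n] mult_smult_distrib[of _ n n _ n])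
  also have "\<dots> = d \<cdot>\<^sub>m F" using inv(2) c Rt by (simp add: assoc_mult_mat[of _ n n _ n _ n])
  also have "\<dots> = R\<^sup>T * B * R * S" using inv(1) S by simp
  also have "\<dots> = R\<^sup>T * (B * (R * S))" using c Rt by (simp add: assoc_mult_mat[of _ n n _ n _ n])
  finally have "T * (R\<^sup>T * (B * (S * R))) = T * (R\<^sup>T * (B * (R * S)))" by simp
  moreover have canc: "T * (R\<^sup>T * X) = X" if "X \<in> carrier_mat n n" for X
    using T Rt that assoc_mult_mat[OF T(1) Rt that] by simp
  ultimately have "B * (S * R) = B * (R * S)" using c by simp
  then have "B' * (B * (S * R)) = B' * (B * (R * S))" by simp
  moreover have "B' * (B * X) = X" if "X \<in> carrier_mat n n" for X
    using B' c that assoc_mult_mat[OF B'(1) c(1) that] by simp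
  ultimately show ?thesis using c by simp
qed

fun block_index :: "nat list \<Rightarrow> nat \<Rightarrow> nat" where
  "block_index [] i = 0"
| "block_index (d # ds) i = (if i < d then 0 else Suc (block_index ds (i - d)))"

lemma direct_sum_rep_off_diagonal:
  assumes "list_all2 (\<lambda>d \<sigma>. \<sigma> h \<in> carrier_mat d d) ds \<sigma>s"
    and "i < sum_list ds" "j < sum_list ds" "block_index ds i \<noteq> block_index ds j"
  shows "direct_sum_rep \<sigma>s h $$ (i, j) = 0"
  using assms
proof (induction arbitrary: i j rule: list_all2_induct)
  case (Cons d ds \<sigma> \<sigma>s)
  have "direct_sum_rep \<sigma>s h \<in> carrier_mat (sum_list ds) (sum_list ds)"
    by (rule direct_sum_rep_carrier[OF Cons(2)])
  then show ?case using Cons.prems Cons.IH[of "i - d" "j - d"] Cons(1)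
    by (auto simp: direct_sum_rep_Cons Let_def split: if_splits)
qed simp

lemma block_index_surj:
  assumes "l < length ds" "\<forall>d\<in>set ds. d > 0"
  shows "\<exists>i<sum_list ds. block_index ds i = l"
  using assms
proof (induction ds arbitrary: l)
  case (Cons d ds)
  show ?case
  proof (cases l)
    case 0
    then show ?thesis using Cons.prems by (intro exI[of _ 0]) auto
  next
    case (Suc l')
    then obtain i where "i < sum_list ds" "block_index ds i = l'" using Cons by auto
    then show ?thesis using Suc by (intro exI[of _ "d + i"]) auto
  qed
qed simp

lemma conjugate_diag_pow:
  fixes P :: "'a::field mat"
  assumes P: "P \<in> carrier_mat n n" and R: "R \<in> carrier_mat n n" "R * P = 1\<^sub>m n" "P * R = 1\<^sub>m n"
  shows "(P * mat_diag n f * R) ^\<^sub>m l = P * mat_diag n (\<lambda>i. f i ^ l) * R"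
proof (induction l)
  case 0
  then show ?case using P R by simp
next
  case (Suc l)
  let ?D = "mat_diag n (\<lambda>i. f i ^ l)" and ?E = "mat_diag n f"
  have "P * ?D * R * (P * ?E * R) = P * (?D * ?E) * R"
    by (rule conjugate_mult[OF R(1) P R(2) mat_diag_dim mat_diag_dim, symmetric])
  also have "?D * ?E = mat_diag n (\<lambda>i. f i ^ Suc l)" by (simp add: mult.commute)
  finally show ?case using Suc by simp
qed

lemma conjugate_diag_trace:
  fixes P :: "'a::comm_ring_1 mat"
  assumes P: "P \<in> carrier_mat n n" and R: "R \<in> carrier_mat n n" "R * P = 1\<^sub>m n"
  shows "mat_trace n (P * mat_diag n f * R) = (\<Sum>i<n. f i)"
proof -
  have c: "mat_diag n f \<in> carrier_mat n n" "mat_diag n f * R \<in> carrier_mat n n"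
    using mult_carrier_mat[OF mat_diag_dim R(1)] by auto
  have "mat_trace n (P * mat_diag n f * R) = mat_trace n (P * (mat_diag n f * R))"
    using assoc_mult_mat[OF P c(1) R(1)] by simp
  also have "\<dots> = mat_trace n (mat_diag n f * R * P)" by (rule mat_trace_commute[OF P c(2)])
  also have "mat_diag n f * R * P = mat_diag n f" using assoc_mult_mat[OF c(1) R(1) P] R(2) c(1) by simp
  finally show ?thesis by (simp add: mat_trace_def mat_diag_def)
qed

text \<open>For a kernel vector q the quadratic form of the Gram matrix is the sum over a of the
  squares of \<Sum> q_i f(a)^i. Over \<real> each square vanishes, and a polynomial with k
  coefficients and at least k zeros is zero.\<close>

lemma det_trace_gram_diag_nonzero:
  fixes P :: "real mat"
  assumes P: "P \<in> carrier_mat n n" and R: "R \<in> carrier_mat n n" "R * P = 1\<^sub>m n" "P * R = 1\<^sub>m n"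
    and k: "card (f ` {..<n}) \<ge> k"
  shows "det (trace_gram n k (P * mat_diag n f * R)) \<noteq> 0"
proof
  let ?S = "P * mat_diag n f * R"
  assume "det (trace_gram n k ?S) = 0"
  then obtain q where q: "q \<in> carrier_vec k" "q \<noteq> 0\<^sub>v k" "trace_gram n k ?S *\<^sub>v q = 0\<^sub>v k"
    using det_0_iff_vec_prod_zero_field[of "trace_gram n k ?S" k] by (auto simp: trace_gram_def)
  have g: "trace_gram n k ?S $$ (i, j) = (\<Sum>a<n. f a ^ i * f a ^ j)" if "i < k" "j < k" for i j
    using that conjugate_diag_trace[OF P R(1,2)]
    by (simp add: trace_gram_def conjugate_diag_pow[OF P R] power_add)
  have "(\<Sum>a<n. (\<Sum>i<k. q $ i * f a ^ i)\<^sup>2) = (\<Sum>a<n. \<Sum>i<k. \<Sum>j<k. q $ i * f a ^ i * (q $ j * f a ^ j))"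
    by (simp add: power2_eq_square sum_product)
  also have "\<dots> = (\<Sum>i<k. \<Sum>a<n. \<Sum>j<k. q $ i * f a ^ i * (q $ j * f a ^ j))" by (rule sum.swap)
  also have "\<dots> = (\<Sum>i<k. \<Sum>j<k. \<Sum>a<n. q $ i * f a ^ i * (q $ j * f a ^ j))"
    by (intro sum.cong refl sum.swap)
  also have "\<dots> = (\<Sum>i<k. q $ i * (\<Sum>j<k. trace_gram n k ?S $$ (i, j) * q $ j))"
    by (intro sum.cong refl) (simp add: g sum_distrib_left sum_distrib_right mult_ac)
  also have "\<dots> = 0"
  proof (intro sum.neutral ballI)
    fix i assume i: "i \<in> {..<k}"
    have "(trace_gram n k ?S *\<^sub>v q) $ i = (\<Sum>j<k. trace_gram n k ?S $$ (i, j) * q $ j)"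
      using i q(1) by (auto simp: trace_gram_def scalar_prod_def atLeast0LessThan)
    then show "q $ i * (\<Sum>j<k. trace_gram n k ?S $$ (i, j) * q $ j) = 0" using q(3) i by simp
  qed
  finally have z: "(\<Sum>i<k. q $ i * f a ^ i) = 0" if "a < n" for a
    using that sum_nonneg_eq_0_iff[of "{..<n}" "\<lambda>a. (\<Sum>i<k. q $ i * f a ^ i)\<^sup>2"] by simp
  have "q $ l = 0" if "l < k" for l
    by (rule polynomial_many_roots_zero[OF k _ _ that]) (use z in auto)
  then have "q = 0\<^sub>v k" using q(1) by (intro eq_vecI) auto
  then show False using q(2) by simp
qed

lemma real_extension_representation:
  assumes "representation H n \<rho>"
  shows "representation H n (real_extension \<rho>)"
  using assms map_mat_of_rat_mult[of _ n n _ n]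
  by (auto simp: representation_iff real_extension_def)

text \<open>The commutant of \<open>\<rho>\<close> contains a rational element that is self-adjoint for an invariant inner
  product and close to \<open>P * \<Theta> * P\<inverse>\<close>, where \<open>\<Theta>\<close> acts on the \<open>j\<close>-th real component as the scalar \<open>j\<close>.\<close>

lemma rational_selfadjoint_commutant_element:
  fixes \<rho> :: "'h \<Rightarrow> rat mat"
  assumes H: "group H" "finite (carrier H)" and \<rho>: "representation H n \<rho>"
    and irr: "list_all2 (irreducible_rep H) ds \<sigma>s" and n: "sum_list ds = n"
    and P: "P \<in> carrier_mat n n" "det P \<noteq> 0"
    and split: "\<And>h. h \<in> carrier H \<Longrightarrow> real_extension \<rho> h * P = P * direct_sum_rep \<sigma>s h"
  obtains S B where "S \<in> carrier_mat n n" "\<forall>h \<in> carrier H. S * \<rho> h = \<rho> h * S"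
    "B \<in> carrier_mat n n" "B\<^sup>T = B" "(B * map_mat real_of_rat S)\<^sup>T = B * map_mat real_of_rat S"
    "\<forall>v \<in> carrier_vec n. v \<bullet> (B *\<^sub>v v) \<le> 0 \<longrightarrow> v = 0\<^sub>v n"
    "\<forall>c. mat_poly n (length ds) c (map_mat real_of_rat S) = 0\<^sub>m n n \<longrightarrow> (\<forall>l<length ds. c l = 0)"
proof -
  define k where "k = length ds"
  let ?\<rho>R = "real_extension \<rho>"
  have \<rho>R: "representation H n ?\<rho>R" by (rule real_extension_representation[OF \<rho>])
  have rc: "\<rho> h \<in> carrier_mat n n" "?\<rho>R h \<in> carrier_mat n n" "det (\<rho> h) \<noteq> 0" if "h \<in> carrier H" for h
    using \<rho> \<rho>R that by (auto simp: representation_iff)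
  have \<sigma>c: "direct_sum_rep \<sigma>s h \<in> carrier_mat n n" if "h \<in> carrier H" for h
    using irreducible_rep_carrier[OF irr that] n by simp
  obtain R where R: "R \<in> carrier_mat n n" "P * R = 1\<^sub>m n" "R * P = 1\<^sub>m n" "det R \<noteq> 0"
    using det_inverse_exists[OF P] by metis
  \<comment> \<open>\<Theta> is rational already. Only the change of basis \<open>P\<close> is
    irrational, so its inverse is all that has to be approximated.\<close>
  define \<Theta>Q :: "rat mat" where "\<Theta>Q = mat_diag n (\<lambda>i. of_nat (block_index ds i))"
  define \<Theta> :: "real mat" where "\<Theta> = mat_diag n (\<lambda>i. of_nat (block_index ds i))"
  have \<Theta>c: "\<Theta> \<in> carrier_mat n n" "\<Theta>Q \<in> carrier_mat n n" by (simp_all add: \<Theta>_def \<Theta>Q_def)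
  have \<Theta>map: "map_mat real_of_rat \<Theta>Q = \<Theta>"
    by (intro eq_matI) (auto simp: \<Theta>_def \<Theta>Q_def mat_diag_def)
  have \<Theta>t: "\<Theta>\<^sup>T = \<Theta>" by (intro eq_matI) (auto simp: \<Theta>_def mat_diag_def)
  have one: "map_mat real_of_rat (1\<^sub>m n) = 1\<^sub>m n" by (intro eq_matI) auto
  have \<Theta>\<sigma>: "\<Theta> * direct_sum_rep \<sigma>s h = direct_sum_rep \<sigma>s h * \<Theta>" if h: "h \<in> carrier H" for h
  proof -
    have l: "list_all2 (\<lambda>d \<sigma>. \<sigma> h \<in> carrier_mat d d) ds \<sigma>s"
      using irr by (rule list_all2_mono) (use h in \<open>auto simp: irreducible_rep_iff representation_iff\<close>)
    have "real (block_index ds i) * direct_sum_rep \<sigma>s h $$ (i, j) = direct_sum_rep \<sigma>s h $$ (i, j) * real (block_index ds j)"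
      if "i < n" "j < n" for i j
      using direct_sum_rep_off_diagonal[OF l, of i j] that n by (cases "block_index ds i = block_index ds j") auto
    then show ?thesis
      unfolding \<Theta>_def mat_diag_mult_left[OF \<sigma>c[OF h]] mat_diag_mult_right[OF \<sigma>c[OF h]]
      by (intro eq_matI) auto
  qed
  define T where "T = P * \<Theta> * R"
  have Tc: "T \<in> carrier_mat n n" using P R \<Theta>c by (simp add: T_def)
  let ?B = "\<lambda>Q. averaged_form H n ?\<rho>R (1\<^sub>m n) Q" and ?F = "\<lambda>Q. averaged_form H n ?\<rho>R \<Theta> Q"
  \<comment> \<open>\<Theta> is scalar on each block and commutes with the direct sum, so \<Theta>
    applied after \<open>R * \<rho> h\<close> equals \<open>T\<close> applied before it. Thus
    \<open>T\<close> is the quotient of the two averaged forms, and approximating the forms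
    approximates \<open>T\<close>.\<close>
  have F: "?F R = ?B R * T"
  proof -
    have Xc: "R * ?\<rho>R h \<in> carrier_mat n n" if "h \<in> carrier H" for h using R rc[OF that] by simp
    have "(R * ?\<rho>R h)\<^sup>T * (\<Theta> * (R * ?\<rho>R h)) = (R * ?\<rho>R h)\<^sup>T * (1\<^sub>m n * (R * ?\<rho>R h)) * T"
      if h: "h \<in> carrier H" for h
    proof -
      let ?s = "direct_sum_rep \<sigma>s h"
      note ac = assoc_mult_mat[of _ n n _ n _ n]
      have "R * ?\<rho>R h = R * (?\<rho>R h * (P * R))" using R rc[OF h] by simp
      also have "\<dots> = R * (?\<rho>R h * P) * R" using R(1) rc[OF h] P by (simp add: ac)
      also have "\<dots> = (R * P) * ?s * R" unfolding split[OF h] using R(1) P \<sigma>c[OF h] by (simp add: ac)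
      finally have X: "R * ?\<rho>R h = ?s * R" using R \<sigma>c[OF h] by simp
      have "\<Theta> * (R * ?\<rho>R h) = ?s * \<Theta> * R"
        unfolding X \<Theta>\<sigma>[OF h, symmetric] using \<sigma>c[OF h] R(1) \<Theta>c by (simp add: ac)
      also have "\<dots> = ?s * (R * P) * \<Theta> * R" using R \<sigma>c[OF h] by simp
      also have "\<dots> = (R * ?\<rho>R h) * T"
        unfolding X T_def using R(1) P \<sigma>c[OF h] \<Theta>c by (simp add: ac)
      finally have "\<Theta> * (R * ?\<rho>R h) = (R * ?\<rho>R h) * T" .
      moreover have "(R * ?\<rho>R h)\<^sup>T \<in> carrier_mat n n" using Xc[OF h] by simp
      ultimately show ?thesis
        unfolding left_mult_one_mat[OF Xc[OF h]] using assoc_mult_mat[OF _ Xc[OF h] Tc] by simp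
    qed
    then have "?F R = mat_sum n n (\<lambda>h. (R * ?\<rho>R h)\<^sup>T * (1\<^sub>m n * (R * ?\<rho>R h)) * T) (carrier H)"
      unfolding averaged_form_def by (intro mat_sum_cong)
    also have "\<dots> = ?B R * T"
      unfolding averaged_form_def
      by (rule mult_mat_sum_right[OF Tc, symmetric]) (rule congruence_carrier[OF Xc one_carrier_mat])
    finally show ?thesis .
  qed
  have posR: "v = 0\<^sub>v n" if v: "v \<in> carrier_vec n" and z: "?B R *\<^sub>v v = 0\<^sub>v n" for v
  proof -
    have "v \<bullet> (?B R *\<^sub>v v) \<le> 0" using v z by simp
    from averaged_form_positive(2)[OF H(2) rc(2) R(1) v this, of "\<one>\<^bsub>H\<^esub>"]
    have "R *\<^sub>v v = 0\<^sub>v n"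
      using representation_one[OF H(1) \<rho>R] R(1) H(1) by (simp add: group.is_monoid monoid.one_closed)
    then have "P *\<^sub>v (R *\<^sub>v v) = 0\<^sub>v n" using mat_mult_zero_vec[OF P(1)] by simp
    then show ?thesis using assoc_mult_mat_vec[OF P(1) R(1) v] R(2) v by simp
  qed
  have detBR: "det (?B R) \<noteq> 0"
    using det_0_iff_vec_prod_zero_field[of "?B R" n] posR by auto
  define b where "b = det (?B R)"
  define f where "f i = b * real (block_index ds i)" for i
  \<comment> \<open>The adjugate multiplies the quotient \<open>T\<close> by b, so the eigenvalues
    are b j for j < k: still k different ones, as b is nonzero.\<close>
  have SR: "adj_mat (?B R) * ?F R = P * mat_diag n f * R"
  proof -
    have a: "adj_mat (?B R) \<in> carrier_mat n n" by (rule adj_mat(1)) simp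
    have "adj_mat (?B R) * ?F R = (adj_mat (?B R) * ?B R) * T"
      unfolding F by (rule assoc_mult_mat[OF a averaged_form_carrier Tc, symmetric])
    also have "\<dots> = b \<cdot>\<^sub>m T"
      using adj_mat(3)[of "?B R" n] Tc mult_smult_assoc_mat[OF one_carrier_mat Tc] by (simp add: b_def)
    also have "\<dots> = P * (b \<cdot>\<^sub>m \<Theta>) * R"
    proof -
      have "P * \<Theta> \<in> carrier_mat n n" using P \<Theta>c by simp
      then show ?thesis
        unfolding T_def mult_smult_distrib[OF P(1) \<Theta>c(1)] using mult_smult_assoc_mat[OF _ R(1)] by simp
    qed
    also have "b \<cdot>\<^sub>m \<Theta> = mat_diag n f"
      by (intro eq_matI) (auto simp: \<Theta>_def mat_diag_def f_def)
    finally show ?thesis .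
  qed
  have dpos: "\<forall>d\<in>set ds. d > 0"
    using irr by (auto simp: list_all2_conv_all_nth in_set_conv_nth irreducible_rep_iff)
  have "card (f ` {..<n}) \<ge> k"
  proof -
    have "inj (\<lambda>l. b * real l)" using detBR by (auto simp: inj_def b_def)
    moreover have "(\<lambda>l. b * real l) ` {..<k} \<subseteq> f ` {..<n}"
      using block_index_surj[OF _ dpos] n unfolding k_def f_def by force
    ultimately show ?thesis
      by (metis card_image card_lessThan card_mono finite_imageI finite_lessThan inj_on_subset subset_UNIV)
  qed
  then have detG: "det (trace_gram n k (adj_mat (?B R) * ?F R)) \<noteq> 0"
    unfolding SR by (rule det_trace_gram_diag_nonzero[OF P(1) R(1) R(3) R(2)])
  \<comment> \<open>Nondegeneracy of the form and independence of the first k powers are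
    nonvanishing determinants. Both hold in the limit \<open>R\<close>, hence for some
    \<open>X t\<close>, while symmetry, invariance and rationality hold for every t.\<close>
  obtain X where X: "\<And>t. X t \<in> carrier_mat n n" "mat_lim n n (\<lambda>t. map_mat of_rat (X t)) R"
    by (rule rational_mat_approx[OF R(1)]) (rule that)
  let ?X = "\<lambda>t. map_mat real_of_rat (X t)"
  have limB: "mat_lim n n (\<lambda>t. ?B (?X t)) (?B R)" by (rule mat_lim_averaged_form[OF rc(2) one_carrier_mat X(2)])
  have limF: "mat_lim n n (\<lambda>t. ?F (?X t)) (?F R)" by (rule mat_lim_averaged_form[OF rc(2) \<Theta>c(1) X(2)])
  have "\<forall>\<^sub>F t in sequentially. det (?B (?X t)) \<noteq> 0"
    by (rule tendsto_imp_eventually_ne[OF mat_lim_det[OF limB] detBR])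
  moreover have "\<forall>\<^sub>F t in sequentially. det (trace_gram n k (adj_mat (?B (?X t)) * ?F (?X t))) \<noteq> 0"
    by (rule tendsto_imp_eventually_ne[OF mat_lim_det[OF mat_lim_trace_gram[OF
            mat_lim_mult[OF mat_lim_adj[OF limB] limF]]] detG])
  ultimately have "\<forall>\<^sub>F t in sequentially. det (?B (?X t)) \<noteq> 0 \<and>
      det (trace_gram n k (adj_mat (?B (?X t)) * ?F (?X t))) \<noteq> 0"
    by (rule eventually_conj)
  then obtain t where t: "det (?B (?X t)) \<noteq> 0" "det (trace_gram n k (adj_mat (?B (?X t)) * ?F (?X t))) \<noteq> 0"
    by (auto simp: eventually_sequentially)
  define BQ where "BQ = averaged_form H n \<rho> (1\<^sub>m n) (X t)"
  define FQ where "FQ = averaged_form H n \<rho> \<Theta>Q (X t)"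
  \<comment> \<open>Using the adjugate instead of the inverse only scales the quotient of the forms
    by \<open>det BQ\<close>; neither commuting nor self-adjointness is affected.\<close>
  define S where "S = adj_mat BQ * FQ"
  have c: "BQ \<in> carrier_mat n n" "FQ \<in> carrier_mat n n" "adj_mat BQ \<in> carrier_mat n n"
    by (auto simp: BQ_def FQ_def intro!: adj_mat(1))
  have Sc: "S \<in> carrier_mat n n" using c by (simp add: S_def)
  have mB: "map_mat real_of_rat BQ = ?B (?X t)"
    unfolding BQ_def using map_mat_averaged_form[OF rc(1) X(1) one_carrier_mat] one by simp
  have mF: "map_mat real_of_rat FQ = ?F (?X t)"
    unfolding FQ_def using map_mat_averaged_form[OF rc(1) X(1) \<Theta>c(2)] \<Theta>map by simp
  have mS: "map_mat real_of_rat S = adj_mat (?B (?X t)) * ?F (?X t)"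
    unfolding S_def map_mat_of_rat_mult[OF c(3,2)] map_mat_adj[OF c(1)] mB mF ..
  have BS: "B * (adj_mat B * F) = det B \<cdot>\<^sub>m F" if "B \<in> carrier_mat n n" "F \<in> carrier_mat n n"
    for B F :: "'x::field mat"
    using assoc_mult_mat[OF that(1) adj_mat(1)[OF that(1)] that(2)] adj_mat(2)[OF that(1)] that
      mult_smult_assoc_mat[OF one_carrier_mat that(2)] by simp
  have detBQ: "det BQ \<noteq> 0"
  proof
    assume "det BQ = 0"
    then have "det (map_mat real_of_rat BQ) = 0" by simp
    then show False using t(1) mB by simp
  qed
  show ?thesis
  proof (rule that[of S "?B (?X t)"])
    show "S \<in> carrier_mat n n" by fact
    show "\<forall>h \<in> carrier H. S * \<rho> h = \<rho> h * S"
    proof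
      fix g assume g: "g \<in> carrier H"
      show "S * \<rho> g = \<rho> g * S"
        by (rule form_quotient_commutes[OF c(1,2) Sc rc(1)[OF g] _ _ _ detBQ rc(3)[OF g]])
           (use averaged_form_invariant[OF H(1) \<rho> X(1) one_carrier_mat g]
             averaged_form_invariant[OF H(1) \<rho> X(1) \<Theta>c(2) g] BS[OF c(1,2)]
            in \<open>simp_all add: BQ_def FQ_def S_def\<close>)
    qed
    show "?B (?X t) \<in> carrier_mat n n" by simp
    have Xc: "?X t \<in> carrier_mat n n" using X(1) by simp
    show "(?B (?X t))\<^sup>T = ?B (?X t)"
      by (rule averaged_form_symmetric[OF rc(2) Xc one_carrier_mat transpose_one])
    have Ft: "(?F (?X t))\<^sup>T = ?F (?X t)"
      by (rule averaged_form_symmetric[OF rc(2) Xc \<Theta>c(1) \<Theta>t])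
    have "?B (?X t) * map_mat real_of_rat S = det (?B (?X t)) \<cdot>\<^sub>m ?F (?X t)"
      unfolding mS by (rule BS) simp_all
    moreover have "(a \<cdot>\<^sub>m M)\<^sup>T = a \<cdot>\<^sub>m M\<^sup>T" for a :: real and M by (intro eq_matI) auto
    ultimately show "(?B (?X t) * map_mat real_of_rat S)\<^sup>T = ?B (?X t) * map_mat real_of_rat S"
      using Ft by simp
    show "\<forall>v \<in> carrier_vec n. v \<bullet> (?B (?X t) *\<^sub>v v) \<le> 0 \<longrightarrow> v = 0\<^sub>v n"
    proof (intro ballI impI)
      fix v :: "real vec" assume v: "v \<in> carrier_vec n" "v \<bullet> (?B (?X t) *\<^sub>v v) \<le> 0"
      have "?B (?X t) *\<^sub>v v = 0\<^sub>v n" by (rule averaged_form_positive(1)[OF H(2) rc(2) Xc v])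
      then show "v = 0\<^sub>v n"
        using det_0_iff_vec_prod_zero_field[of "?B (?X t)" n] t(1) v(1) by auto
    qed
    show "\<forall>c. mat_poly n (length ds) c (map_mat real_of_rat S) = 0\<^sub>m n n \<longrightarrow> (\<forall>l<length ds. c l = 0)"
    proof (intro allI impI)
      fix c l assume c: "mat_poly n (length ds) c (map_mat real_of_rat S) = 0\<^sub>m n n" "l < length ds"
      have "det (trace_gram n k (map_mat real_of_rat S)) \<noteq> 0" using t(2) unfolding mS .
      then show "c l = 0"
        using det_trace_gram_zero[of "map_mat real_of_rat S" n k c l] Sc c by (auto simp: k_def)
    qed
  qed
qed

section \<open>Multiplicities of the real components\<close>

text \<open>The eigenvector is written as x + i y with real x and y, so that only the real form q
  given by \<open>B\<close> occurs. Symmetry of \<open>B * M\<close> yields Im z (q(x,x) + q(y,y)) =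
  0, and the second factor is positive.\<close>

lemma selfadjoint_eigenvalue_real:
  fixes M B :: "real mat"
  assumes M: "M \<in> carrier_mat n n" and B: "B \<in> carrier_mat n n" "B\<^sup>T = B" "(B * M)\<^sup>T = B * M"
    and pos: "\<And>v. v \<in> carrier_vec n \<Longrightarrow> v \<bullet> (B *\<^sub>v v) \<le> 0 \<Longrightarrow> v = 0\<^sub>v n"
    and ev: "eigenvalue (map_mat complex_of_real M) z"
  shows "Im z = 0"
proof -
  obtain v where v: "v \<in> carrier_vec n" "v \<noteq> 0\<^sub>v n" "map_mat complex_of_real M *\<^sub>v v = z \<cdot>\<^sub>v v"
    using ev M by (auto simp: eigenvalue_def eigenvector_def)
  define x where "x = map_vec Re v"
  define y where "y = map_vec Im v"
  have xy: "x \<in> carrier_vec n" "y \<in> carrier_vec n" using v by (auto simp: x_def y_def)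
  have e: "(\<Sum>j<n. complex_of_real (M $$ (i, j)) * v $ j) = z * v $ i" if "i < n" for i
  proof -
    have "(map_mat complex_of_real M *\<^sub>v v) $ i = (\<Sum>j<n. complex_of_real (M $$ (i, j)) * v $ j)"
      using M v(1) that by (auto simp: scalar_prod_def atLeast0LessThan)
    then show ?thesis using v that by simp
  qed
  have Mx: "M *\<^sub>v x = Re z \<cdot>\<^sub>v x - Im z \<cdot>\<^sub>v y" and My: "M *\<^sub>v y = Im z \<cdot>\<^sub>v x + Re z \<cdot>\<^sub>v y"
  proof -
    have "(M *\<^sub>v x) $ i = Re (z * v $ i) \<and> (M *\<^sub>v y) $ i = Im (z * v $ i)" if i: "i < n" for i
      unfolding e[OF i, symmetric]
      using i M v(1) by (auto simp: x_def y_def scalar_prod_def atLeast0LessThan Re_sum Im_sum)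
    then show "M *\<^sub>v x = Re z \<cdot>\<^sub>v x - Im z \<cdot>\<^sub>v y" "M *\<^sub>v y = Im z \<cdot>\<^sub>v x + Re z \<cdot>\<^sub>v y"
      using M v(1) by (auto intro!: eq_vecI simp del: index_mult_mat_vec simp: x_def y_def)
  qed
  have adj: "u \<bullet> (A *\<^sub>v w) = w \<bullet> (A *\<^sub>v u)"
    if "A \<in> carrier_mat n n" "A\<^sup>T = A" "u \<in> carrier_vec n" "w \<in> carrier_vec n" for A :: "real mat" and u w
    using transpose_vec_mult_scalar[OF that(1) that(3,4)] that comm_scalar_prod[of u n "A *\<^sub>v w"]
      comm_scalar_prod[of w n "A *\<^sub>v u"] by simp
  have BM: "B * M \<in> carrier_mat n n" using B M by simp
  define q where "q u w = u \<bullet> (B *\<^sub>v w)" for u w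
  have qadd: "q u (a \<cdot>\<^sub>v w + b \<cdot>\<^sub>v w') = a * q u w + b * q u w'"
    if "u \<in> carrier_vec n" "w \<in> carrier_vec n" "w' \<in> carrier_vec n" for u w w' a b
    using that B by (simp add: q_def mult_add_distrib_mat_vec[OF B(1)] mult_mat_vec[OF B(1)]
        scalar_prod_add_distrib[of _ n])
  have "q x (M *\<^sub>v y) = q y (M *\<^sub>v x)"
    unfolding q_def using adj[OF BM B(3) xy] xy assoc_mult_mat_vec[OF B(1) M] by simp
  moreover have "q x (M *\<^sub>v y) = Im z * q x x + Re z * q x y" unfolding My by (rule qadd) (use xy in auto)
  moreover have "M *\<^sub>v x = Re z \<cdot>\<^sub>v x + (- Im z) \<cdot>\<^sub>v y" unfolding Mx using xy by (intro eq_vecI) auto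
  then have "q y (M *\<^sub>v x) = Re z * q y x + (- Im z) * q y y" using qadd xy by simp
  moreover have "q x y = q y x" unfolding q_def by (rule adj[OF B(1,2) xy])
  ultimately have "Im z * (q x x + q y y) = 0" by (simp add: algebra_simps)
  moreover have "q x x + q y y > 0"
  proof -
    have "q u u \<ge> 0" if "u \<in> carrier_vec n" for u
    proof (rule ccontr)
      assume "\<not> ?thesis"
      then have "q u u < 0" by simp
      then have "u = 0\<^sub>v n" using pos[OF that] by (simp add: q_def)
      then show False using \<open>q u u < 0\<close> mat_mult_zero_vec[OF B(1)] by (simp add: q_def)
    qed
    moreover have "\<not> (q x x \<le> 0 \<and> q y y \<le> 0)"
    proof
      assume "q x x \<le> 0 \<and> q y y \<le> 0"
      then have z: "x = 0\<^sub>v n" "y = 0\<^sub>v n" using pos xy by (auto simp: q_def)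
      have "v $ i = 0" if "i < n" for i
      proof -
        have "x $ i = 0" "y $ i = 0" using z that by simp_all
        then show ?thesis using that v(1) by (simp add: x_def y_def complex_eq_iff)
      qed
      then show False using v(1,2) by (auto intro: eq_vecI)
    qed
    ultimately show ?thesis using xy by (smt (verit))
  qed
  ultimately show ?thesis by simp
qed

lemma selfadjoint_char_poly_splits:
  fixes M B :: "real mat"
  assumes M: "M \<in> carrier_mat n n" and B: "B \<in> carrier_mat n n" "B\<^sup>T = B" "(B * M)\<^sup>T = B * M"
    and pos: "\<And>v. v \<in> carrier_vec n \<Longrightarrow> v \<bullet> (B *\<^sub>v v) \<le> 0 \<Longrightarrow> v = 0\<^sub>v n"
  shows "\<exists>as. char_poly M = (\<Prod>a\<leftarrow>as. [:- a, 1:])"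
proof -
  interpret pr: map_poly_inj_idom_hom complex_of_real ..
  let ?M = "map_mat complex_of_real M"
  have Mc: "?M \<in> carrier_mat n n" using M by simp
  obtain zs where zs: "char_poly ?M = (\<Prod>a\<leftarrow>zs. [:- a, 1:])" using char_poly_factorized[OF Mc] by blast
  have "Im z = 0" if "z \<in> set zs" for z
  proof -
    have "poly (char_poly ?M) z = 0" unfolding zs poly_prod_list using that by (auto simp: prod_list_zero_iff)
    then show ?thesis
      using selfadjoint_eigenvalue_real[OF M B pos] eigenvalue_root_char_poly[OF Mc] by blast
  qed
  then have "zs = map (\<lambda>z. complex_of_real (Re z)) zs"
    by (intro map_idI[symmetric]) (simp add: complex_eq_iff)
  then have "(\<Prod>a\<leftarrow>zs. [:- a, 1:]) = (\<Prod>a\<leftarrow>map (\<lambda>z. complex_of_real (Re z)) zs. [:- a, 1:])" by simp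
  also have "\<dots> = map_poly complex_of_real (\<Prod>a\<leftarrow>map Re zs. [:- a, 1:])"
    by (induction zs) (simp_all add: hom_distribs pr.hom_mult pr.hom_minus)
  finally have "map_poly complex_of_real (char_poly M) = map_poly complex_of_real (\<Prod>a\<leftarrow>map Re zs. [:- a, 1:])"
    using zs of_real_hom.char_poly_hom[OF M] by metis
  then have "char_poly M = (\<Prod>a\<leftarrow>map Re zs. [:- a, 1:])" by simp
  then show ?thesis by blast
qed

lemma jordan_matrix_trivial_blocks:
  "\<forall>x\<in>set n_as. fst x = 1 \<Longrightarrow> jordan_matrix n_as = mat_diag (length n_as) (\<lambda>i. snd (n_as ! i))"
proof (induction n_as)
  case Nil
  then show ?case by (auto simp: jordan_matrix_def mat_diag_def)
next
  case (Cons x n_as)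
  obtain a where x: "x = (1, a)" using Cons.prems by (cases x) auto
  have l: "sum_list (map fst n_as) = length n_as"
    using Cons.prems by (induction n_as) auto
  show ?case
    unfolding x jordan_matrix_Cons l using Cons
    by (intro eq_matI) (auto simp: mat_diag_def nth_Cons' jordan_block_def)
qed

lemma sum_list_eq_imp_pointwise:
  fixes f g :: "'x \<Rightarrow> nat"
  assumes "sum_list (map f xs) = sum_list (map g xs)" "\<And>x. x \<in> set xs \<Longrightarrow> f x \<le> g x" "x \<in> set xs"
  shows "f x = g x"
  using assms
proof (induction xs)
  case (Cons a xs)
  have "sum_list (map f xs) \<le> sum_list (map g xs)" "f a \<le> g a"
    using Cons.prems(2) by (auto intro: sum_list_mono)
  then have "f a = g a" "sum_list (map f xs) = sum_list (map g xs)" using Cons.prems(1) by auto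
  then show ?case using Cons by auto
qed simp

lemma kernel_dim_cong:
  assumes "dim_col A = dim_col B" "mat_kernel A = mat_kernel B"
  shows "kernel_dim A = kernel_dim B"
  using assms unfolding kernel_dim_def by simp

text \<open>The characteristic polynomial splits over \<real>, so there is a Jordan form. For a
  self-adjoint matrix, M - a and its square have the same kernel, which excludes Jordan blocks of
  size 2 or more.\<close>

lemma selfadjoint_diagonalizable:
  fixes M B :: "real mat"
  assumes M: "M \<in> carrier_mat n n" and B: "B \<in> carrier_mat n n" "B\<^sup>T = B" "(B * M)\<^sup>T = B * M"
    and pos: "\<And>v. v \<in> carrier_vec n \<Longrightarrow> v \<bullet> (B *\<^sub>v v) \<le> 0 \<Longrightarrow> v = 0\<^sub>v n"
  obtains P Q f where "P \<in> carrier_mat n n" "Q \<in> carrier_mat n n" "P * Q = 1\<^sub>m n" "Q * P = 1\<^sub>m n"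
    "M = P * mat_diag n f * Q"
proof -
  obtain as where as: "char_poly M = (\<Prod>a\<leftarrow>as. [:- a, 1:])"
    using selfadjoint_char_poly_splits[OF assms] by blast
  obtain n_as where jnf: "jordan_nf M n_as" using jordan_nf_exists[OF M as] by blast
  have BM: "B * M \<in> carrier_mat n n" using B M by simp
  have ker: "mat_kernel (char_matrix M a ^\<^sub>m 1) = mat_kernel (char_matrix M a ^\<^sub>m 2)" for a
  proof -
    define N where "N = char_matrix M a"
    have N: "N \<in> carrier_mat n n" using M by (simp add: N_def)
    have N1: "N ^\<^sub>m 1 = N" and N2: "N ^\<^sub>m 2 = N * N" using N by (simp_all add: numeral_2_eq_2)
    have NN: "N * N \<in> carrier_mat n n" using N by simp
    have NB: "(B * N)\<^sup>T = B * N"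
    proof -
      have "B * N = B * M + (- a) \<cdot>\<^sub>m B"
        unfolding N_def char_matrix_def using M B
        by (simp add: mult_add_distrib_mat[of _ n n _ n] mult_smult_distrib[of _ n n _ n])
      moreover have "(B * M + (- a) \<cdot>\<^sub>m B)\<^sup>T = (B * M)\<^sup>T + (- a) \<cdot>\<^sub>m B\<^sup>T"
        using BM B(1) by (intro eq_matI) auto
      ultimately show ?thesis using B by simp
    qed
    \<comment> \<open>For w = N v the inner product gives (w, w) = (w, N v) = (N w, v) = 0.\<close>
    have "v \<in> mat_kernel N" if v: "v \<in> mat_kernel (N * N)" for v
    proof -
      have vc: "v \<in> carrier_vec n" and z: "N * N *\<^sub>v v = 0\<^sub>v n" using mat_kernelD[OF NN v] by auto
      define w where "w = N *\<^sub>v v"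
      have w: "w \<in> carrier_vec n" using N vc by (simp add: w_def)
      have Nw: "N *\<^sub>v w = 0\<^sub>v n" using z assoc_mult_mat_vec[OF N N vc] by (simp add: w_def)
      have BN: "B * N \<in> carrier_mat n n" using B N by simp
      have "w \<bullet> (B *\<^sub>v w) = w \<bullet> ((B * N) *\<^sub>v v)"
        unfolding w_def using assoc_mult_mat_vec[OF B(1) N vc] by simp
      also have "\<dots> = ((B * N)\<^sup>T *\<^sub>v w) \<bullet> v"
        by (rule transpose_vec_mult_scalar[OF BN vc w, symmetric])
      also have "(B * N)\<^sup>T *\<^sub>v w = B *\<^sub>v (N *\<^sub>v w)" unfolding NB by (rule assoc_mult_mat_vec[OF B(1) N w])
      also have "\<dots> = 0\<^sub>v n" unfolding Nw by (rule mat_mult_zero_vec[OF B(1)])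
      finally have "w = 0\<^sub>v n" using pos[OF w] vc by simp
      then show ?thesis using mat_kernelI[OF N vc] by (simp add: w_def)
    qed
    moreover have "v \<in> mat_kernel (N * N)" if v: "v \<in> mat_kernel N" for v
    proof -
      have vc: "v \<in> carrier_vec n" and z: "N *\<^sub>v v = 0\<^sub>v n" using mat_kernelD[OF N v] by auto
      then have "N * N *\<^sub>v v = 0\<^sub>v n" using assoc_mult_mat_vec[OF N N vc] mat_mult_zero_vec[OF N] by simp
      then show ?thesis using mat_kernelI[OF NN vc] by simp
    qed
    ultimately show ?thesis unfolding N_def[symmetric] N1 N2 by blast
  qed
  have dg: "dim_gen_eigenspace M a 1 = dim_gen_eigenspace M a 2" for a
    unfolding dim_gen_eigenspace_def
  proof (rule kernel_dim_cong[OF _ ker])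
    have "char_matrix M a ^\<^sub>m k \<in> carrier_mat n n" for k using M by (intro pow_carrier_mat) simp
    then show "dim_col (char_matrix M a ^\<^sub>m 1) = dim_col (char_matrix M a ^\<^sub>m 2)"
      by (metis carrier_matD(2))
  qed
  \<comment> \<open>A block of size s for the eigenvalue a adds min 1 s and min 2 s to the
    dimensions of the kernels of the first and second power of M - a. Equal sums force equality
    block by block, hence s = 1.\<close>
  have one: "fst x = 1" if x: "x \<in> set n_as" for x
  proof -
    let ?l = "map fst [(n, e)\<leftarrow>n_as . e = snd x]"
    have "sum_list (map (min 1) ?l) = sum_list (map (min 2) ?l)"
      using dg[of "snd x"] unfolding dim_gen_eigenspace[OF jnf] .
    moreover have "fst x \<in> set ?l" using x by (auto simp: image_iff split: prod.splits intro!: bexI[of _ x])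
    ultimately have "min 1 (fst x) = min 2 (fst x)" by (intro sum_list_eq_imp_pointwise[of "min 1" ?l "min 2"]) auto
    moreover have "fst x \<noteq> 0" using jnf x by (force simp: jordan_nf_def)
    ultimately show ?thesis by (simp add: min_def split: if_splits)
  qed
  obtain m P Q where PQ: "{M, jordan_matrix n_as, P, Q} \<subseteq> carrier_mat m m" "P * Q = 1\<^sub>m m" "Q * P = 1\<^sub>m m"
      "M = P * jordan_matrix n_as * Q"
    using similar_matD[of M "jordan_matrix n_as"] jnf unfolding jordan_nf_def by blast
  have m: "m = n" using PQ(1) M by auto
  have J: "jordan_matrix n_as = mat_diag (length n_as) (\<lambda>i. snd (n_as ! i))"
    by (rule jordan_matrix_trivial_blocks) (use one in blast)
  have "length n_as = n" using PQ(1) unfolding m J by (auto simp: mat_diag_def)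
  then show ?thesis using that[of P Q "\<lambda>i. snd (n_as ! i)"] PQ J m by simp
qed

lemma mat_poly_carrier [simp]: "mat_poly n k c S \<in> carrier_mat n n"
  by (simp add: mat_poly_def)

lemma mat_poly_conjugate_diag:
  fixes P :: "'a::field mat"
  assumes P: "P \<in> carrier_mat n n" and Q: "Q \<in> carrier_mat n n" "P * Q = 1\<^sub>m n" "Q * P = 1\<^sub>m n"
  shows "mat_poly n k c (P * mat_diag n f * Q) = P * mat_diag n (\<lambda>i. \<Sum>l<k. c l * f i ^ l) * Q"
proof -
  let ?D = "\<lambda>l. c l \<cdot>\<^sub>m mat_diag n (\<lambda>i. f i ^ l)"
  have D: "?D l \<in> carrier_mat n n" "mat_diag n (\<lambda>i. f i ^ l) \<in> carrier_mat n n"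
      "P * mat_diag n (\<lambda>i. f i ^ l) \<in> carrier_mat n n" "P * ?D l \<in> carrier_mat n n" for l
    using mult_carrier_mat[OF P mat_diag_dim] mult_carrier_mat[OF P smult_carrier_mat[OF mat_diag_dim]] by auto
  have "mat_poly n k c (P * mat_diag n f * Q) = mat_sum n n (\<lambda>l. P * ?D l * Q) {..<k}"
    unfolding mat_poly_def conjugate_diag_pow[OF P Q(1,3,2)]
  proof (rule mat_sum_cong)
    fix l
    show "c l \<cdot>\<^sub>m (P * mat_diag n (\<lambda>i. f i ^ l) * Q) = P * ?D l * Q"
      unfolding mult_smult_distrib[OF P D(2)] mult_smult_assoc_mat[OF D(3) Q(1)] ..
  qed
  also have "\<dots> = mat_sum n n (\<lambda>l. P * ?D l) {..<k} * Q"
    by (rule mult_mat_sum_right[OF Q(1) D(4), symmetric])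
  also have "mat_sum n n (\<lambda>l. P * ?D l) {..<k} = P * mat_sum n n ?D {..<k}"
    by (rule mult_mat_sum_left[OF P D(1), symmetric])
  also have "mat_sum n n ?D {..<k} = mat_diag n (\<lambda>i. \<Sum>l<k. c l * f i ^ l)"
    by (intro eq_matI) (auto simp: mat_diag_def)
  finally show ?thesis .
qed

lemma det_conjugate_diag:
  fixes P :: "'a::field mat"
  assumes P: "P \<in> carrier_mat n n" and Q: "Q \<in> carrier_mat n n" "P * Q = 1\<^sub>m n"
  shows "det (P * mat_diag n f * Q) = (\<Prod>i<n. f i)"
proof -
  have D: "det (mat_diag n f) = (\<Prod>i<n. f i)"
  proof -
    have "det (mat_diag n f) = prod_list (diag_mat (mat_diag n f))"
      by (rule det_upper_triangular[OF _ mat_diag_dim]) (auto simp: upper_triangular_def mat_diag_def)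
    also have "diag_mat (mat_diag n f) = map f [0..<n]"
      by (auto simp: diag_mat_def mat_diag_def intro: map_cong)
    also have "prod_list (map f [0..<n]) = (\<Prod>i<n. f i)"
      by (simp add: prod.distinct_set_conv_list[symmetric] atLeast0LessThan)
    finally show ?thesis .
  qed
  have "det (P * mat_diag n f * Q) = det P * det (mat_diag n f) * det Q"
    using det_mult[OF mult_carrier_mat[OF P mat_diag_dim] Q(1)] det_mult[OF P mat_diag_dim] by simp
  also have "\<dots> = det (P * Q) * det (mat_diag n f)" using det_mult[OF P Q(1)] by simp
  finally show ?thesis using Q(2) D by simp
qed

lemma char_poly_conjugate_diag:
  fixes P :: "'a::field mat"
  assumes P: "P \<in> carrier_mat n n" and Q: "Q \<in> carrier_mat n n" "P * Q = 1\<^sub>m n" "Q * P = 1\<^sub>m n"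
  shows "char_poly (P * mat_diag n f * Q) = (\<Prod>i<n. [:- f i, 1:])"
proof -
  have c: "P * mat_diag n f * Q \<in> carrier_mat n n"
    using mult_carrier_mat[OF mult_carrier_mat[OF P mat_diag_dim] Q(1)] .
  have "similar_mat_wit (P * mat_diag n f * Q) (mat_diag n f) P Q"
    by (rule similar_mat_witI[OF Q(2,3) refl c mat_diag_dim P Q(1)])
  then have "char_poly (P * mat_diag n f * Q) = char_poly (mat_diag n f)"
    by (intro char_poly_similar) (auto simp: similar_mat_def)
  also have "\<dots> = (\<Prod>a\<leftarrow>diag_mat (mat_diag n f). [:- a, 1:])"
    by (rule char_poly_upper_triangular[OF mat_diag_dim]) (auto simp: upper_triangular_def mat_diag_def)
  also have "diag_mat (mat_diag n f) = map f [0..<n]"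
    by (auto simp: diag_mat_def mat_diag_def intro: map_cong)
  also have "(\<Prod>a\<leftarrow>map f [0..<n]. [:- a, 1:]) = (\<Prod>i<n. [:- f i, 1:])"
    by (simp add: prod.distinct_set_conv_list[symmetric] atLeast0LessThan o_def)
  finally show ?thesis .
qed

lemma order_prod_linear:
  fixes f :: "nat \<Rightarrow> 'a::field"
  shows "Polynomial.order x (\<Prod>i<n. [:- f i, 1:]) = card {i. i < n \<and> f i = x}"
proof (induction n)
  case 0
  then show ?case by simp
next
  case (Suc n)
  have nz: "(\<Prod>i<m. [:- f i, 1:]) \<noteq> 0" for m by (simp add: prod_zero_iff)
  have s: "{i. i < Suc n \<and> f i = x} = (if f n = x then insert n {i. i < n \<and> f i = x} else {i. i < n \<and> f i = x})"
    by (auto simp: less_Suc_eq)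
  have "Polynomial.order x (\<Prod>i<Suc n. [:- f i, 1:]) = Polynomial.order x (\<Prod>i<n. [:- f i, 1:]) + Polynomial.order x [:- f n, 1:]"
    using nz[of "Suc n"] by (simp add: order_mult del: mult_pCons_right mult_pCons_left)
  then show ?case using Suc.IH s by (auto simp: order_linear')
qed

lemma order_power_mult:
  fixes p :: "'a::idom poly"
  shows "p \<noteq> 0 \<Longrightarrow> Polynomial.order x (p ^ N) = N * Polynomial.order x p"
  by (induction N) (simp_all add: order_mult)

lemma pow_mat_commute:
  fixes S :: "'a::semiring_1 mat"
  assumes "S \<in> carrier_mat n n" "R \<in> carrier_mat n n" "S * R = R * S"
  shows "S ^\<^sub>m l * R = R * S ^\<^sub>m l"
proof (induction l)
  case (Suc l)
  have Sl: "S ^\<^sub>m l \<in> carrier_mat n n" by (rule pow_carrier_mat[OF assms(1)])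
  have "S ^\<^sub>m l * S * R = S ^\<^sub>m l * (R * S)"
    unfolding assoc_mult_mat[OF Sl assms(1,2)] assms(3) ..
  also have "\<dots> = (S ^\<^sub>m l * R) * S" by (rule assoc_mult_mat[OF Sl assms(2,1), symmetric])
  also have "\<dots> = R * (S ^\<^sub>m l * S)" unfolding Suc by (rule assoc_mult_mat[OF assms(2) Sl assms(1)])
  finally show ?case by simp
qed (use assms in auto)

lemma mat_poly_commute:
  fixes S :: "'a::comm_ring_1 mat"
  assumes S: "S \<in> carrier_mat n n" and R: "R \<in> carrier_mat n n" and comm: "S * R = R * S"
  shows "mat_poly n k c S * R = R * mat_poly n k c S"
proof -
  have Sl: "S ^\<^sub>m l \<in> carrier_mat n n" "c l \<cdot>\<^sub>m (S ^\<^sub>m l) \<in> carrier_mat n n" for l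
    using pow_carrier_mat[OF S] by auto
  have "mat_poly n k c S * R = mat_sum n n (\<lambda>l. c l \<cdot>\<^sub>m (S ^\<^sub>m l) * R) {..<k}"
    unfolding mat_poly_def by (rule mult_mat_sum_right[OF R Sl(2)])
  also have "\<dots> = mat_sum n n (\<lambda>l. R * (c l \<cdot>\<^sub>m (S ^\<^sub>m l))) {..<k}"
  proof (rule mat_sum_cong)
    fix l
    show "c l \<cdot>\<^sub>m (S ^\<^sub>m l) * R = R * (c l \<cdot>\<^sub>m (S ^\<^sub>m l))"
      unfolding mult_smult_assoc_mat[OF Sl(1) R] mult_smult_distrib[OF R Sl(1)] pow_mat_commute[OF S R comm] ..
  qed
  also have "\<dots> = R * mat_poly n k c S"
    unfolding mat_poly_def by (rule mult_mat_sum_left[OF R Sl(2), symmetric])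
  finally show ?thesis .
qed

lemma (in comm_ring_hom) mat_poly_hom:
  assumes S: "S \<in> carrier_mat n n"
  shows "map_mat hom (mat_poly n k c S) = mat_poly n k (\<lambda>l. hom (c l)) (map_mat hom S)"
proof (rule eq_matI)
  fix i j assume "i < dim_row (mat_poly n k (\<lambda>l. hom (c l)) (map_mat hom S))"
    "j < dim_col (mat_poly n k (\<lambda>l. hom (c l)) (map_mat hom S))"
  then have ij: "i < n" "j < n" by (auto simp: mat_poly_def)
  have S': "map_mat hom S \<in> carrier_mat n n" using S by simp
  have "hom (\<Sum>l<k. (c l \<cdot>\<^sub>m (S ^\<^sub>m l)) $$ (i, j)) = (\<Sum>l<k. (hom (c l) \<cdot>\<^sub>m (map_mat hom S ^\<^sub>m l)) $$ (i, j))"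
    unfolding hom_sum
  proof (rule sum.cong[OF refl])
    fix l
    show "hom ((c l \<cdot>\<^sub>m (S ^\<^sub>m l)) $$ (i, j)) = (hom (c l) \<cdot>\<^sub>m (map_mat hom S ^\<^sub>m l)) $$ (i, j)"
      unfolding mat_hom_pow[OF S, symmetric]
      using ij carrier_matD[OF pow_carrier_mat[OF S, of l]] by (simp add: hom_mult)
  qed
  then show "map_mat hom (mat_poly n k c S) $$ (i, j) = mat_poly n k (\<lambda>l. hom (c l)) (map_mat hom S) $$ (i, j)"
    using ij by (simp add: mat_poly_def)
qed (auto simp: mat_poly_def)

lemma poly_as_lessThan_sum:
  fixes p :: "'a::comm_semiring_1 poly"
  shows "(\<Sum>l<Suc (degree p). coeff p l * x ^ l) = poly p x"
  by (simp add: poly_altdef lessThan_Suc_atMost)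

text \<open>Conjugate roots have the same minimal polynomial. Let d be of least degree for b; it
  divides everything rational that vanishes at b, in particular g = d q. Since a is a root of d or
  of q, minimality of g makes q or d constant, and d cannot be.\<close>

lemma minimal_polynomial_divides:
  fixes g h :: "rat poly" and a b :: real
  assumes g: "g \<noteq> 0" "poly (map_poly of_rat g) a = 0"
    and min: "\<And>q. q \<noteq> 0 \<Longrightarrow> poly (map_poly of_rat q) a = 0 \<Longrightarrow> degree g \<le> degree q"
    and b: "poly (map_poly of_rat g) b = 0" "poly (map_poly of_rat h) b = 0"
  shows "g dvd h"
proof -
  interpret pr: map_poly_inj_idom_hom "of_rat :: rat \<Rightarrow> real" ..
  let ?ev = "\<lambda>q x. poly (map_poly real_of_rat q) x"
  define Z where "Z q \<longleftrightarrow> q \<noteq> 0 \<and> ?ev q b = 0" for q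
  have "Z g" using g b by (simp add: Z_def)
  then obtain d where d: "Z d" "\<And>q. Z q \<Longrightarrow> degree d \<le> degree q"
    using ex_has_least_nat[of Z g degree] by blast
  have dvd: "d dvd q" if "?ev q b = 0" for q
  proof (rule ccontr)
    assume nd: "\<not> d dvd q"
    have d0: "d \<noteq> 0" using d(1) by (simp add: Z_def)
    have "?ev (q mod d) b = 0"
    proof -
      have "map_poly real_of_rat q = map_poly real_of_rat (q div d * d + q mod d)" by simp
      also have "\<dots> = map_poly real_of_rat (q div d) * map_poly real_of_rat d + map_poly real_of_rat (q mod d)"
        by (simp only: pr.hom_add pr.hom_mult)
      finally show ?thesis using d(1) that by (simp add: Z_def)
    qed
    moreover have "q mod d \<noteq> 0" using nd by (simp add: dvd_eq_mod_eq_0)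
    ultimately have "degree d \<le> degree (q mod d)" using d(2) by (simp add: Z_def)
    then show False using degree_mod_less[OF d0, of q] \<open>q mod d \<noteq> 0\<close> by simp
  qed
  obtain q where q: "g = d * q" using dvd[OF b(1)] by (auto simp: dvd_def)
  have nz: "d \<noteq> 0" "q \<noteq> 0" using g(1) q by auto
  have deg: "degree g = degree d + degree q" unfolding q using nz by (rule degree_mult_eq)
  have "?ev d a * ?ev q a = 0" using g(2) by (simp add: q pr.hom_mult)
  then have "?ev d a = 0 \<or> ?ev q a = 0" by simp
  then show ?thesis
  proof
    assume "?ev d a = 0"
    then have "degree q = 0" using min[OF nz(1)] deg by simp
    then obtain c where c: "q = [:c:]" by (rule degree_eq_zeroE)
    then have "c \<noteq> 0" using nz by simp
    then have "g dvd d" unfolding q c by (simp add: smult_dvd_iff)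
    then show ?thesis using dvd[OF b(2)] by (rule dvd_trans)
  next
    assume "?ev q a = 0"
    then have "degree d = 0" using min[OF nz(2)] deg by simp
    then obtain c where "d = [:c:]" by (rule degree_eq_zeroE)
    moreover have "map_poly real_of_rat [:c:] = [:of_rat c:]"
      by (intro poly_eqI) (simp add: coeff_pCons split: nat.split)
    ultimately show ?thesis using d(1) by (simp add: Z_def)
  qed
qed

text \<open>Let g be the minimal polynomial over \<rat> of one eigenvalue. Then g(S) is singular and
  lies in the commutant, so it is 0 by Schur's lemma, and all eigenvalues are roots of g. These
  roots are simple in g, so the multiplicity of each is the exponent of g in the characteristic
  polynomial.\<close>

lemma commutant_equal_multiplicities:
  fixes \<rho> :: "'h \<Rightarrow> rat mat"
  assumes irr: "irreducible_rep H n \<rho>" and S: "S \<in> carrier_mat n n"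
    and comm: "\<And>h. h \<in> carrier H \<Longrightarrow> S * \<rho> h = \<rho> h * S"
    and P: "P \<in> carrier_mat n n" and Q: "Q \<in> carrier_mat n n" "P * Q = 1\<^sub>m n" "Q * P = 1\<^sub>m n"
    and diag: "map_mat real_of_rat S = P * mat_diag n f * Q"
  obtains N where "\<And>i. i < n \<Longrightarrow> card {j. j < n \<and> f j = f i} = N"
proof -
  interpret pr: map_poly_inj_idom_hom "of_rat :: rat \<Rightarrow> real" ..
  let ?ev = "\<lambda>q x. poly (map_poly real_of_rat q) x"
  have n: "n > 0" using irr by (simp add: irreducible_rep_iff)
  have \<rho>c: "\<rho> h \<in> carrier_mat n n" if "h \<in> carrier H" for h
    using irr that by (simp add: irreducible_rep_iff representation_iff)
  define \<chi> where "\<chi> = char_poly S"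
  have \<chi>: "map_poly real_of_rat \<chi> = (\<Prod>i<n. [:- f i, 1:])"
  proof -
    have "map_poly real_of_rat \<chi> = char_poly (map_mat real_of_rat S)"
      unfolding \<chi>_def by (rule of_rat_hom.char_poly_hom[OF S, symmetric])
    then show ?thesis using char_poly_conjugate_diag[OF P Q] diag by simp
  qed
  have \<chi>0: "\<chi> \<noteq> 0" using degree_monic_char_poly[OF S] n unfolding \<chi>_def by auto
  have \<chi>root: "?ev \<chi> (f i) = 0" if "i < n" for i
    unfolding \<chi> poly_prod using that by (auto simp: prod_zero_iff)
  define Z where "Z q \<longleftrightarrow> q \<noteq> 0 \<and> ?ev q (f 0) = 0" for q
  have "Z \<chi>" using \<chi>0 \<chi>root[OF n] by (simp add: Z_def)
  then obtain g where g: "Z g" "\<And>q. Z q \<Longrightarrow> degree g \<le> degree q"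
    using ex_has_least_nat[of Z \<chi> degree] by blast
  have g0: "g \<noteq> 0" and ga: "?ev g (f 0) = 0" using g(1) by (auto simp: Z_def)
  have gdvd: "g dvd h" if "?ev g b = 0" "?ev h b = 0" for h b
    by (rule minimal_polynomial_divides[OF g0 ga _ that]) (use g(2) in \<open>auto simp: Z_def\<close>)
  define k where "k = Suc (degree g)"
  have gS: "map_mat real_of_rat (mat_poly n k (coeff g) S) = P * mat_diag n (\<lambda>i. ?ev g (f i)) * Q"
  proof -
    have "(\<Sum>l<k. real_of_rat (coeff g l) * x ^ l) = ?ev g x" for x
      using poly_as_lessThan_sum[of "map_poly real_of_rat g" x] by (simp add: k_def)
    then show ?thesis
      unfolding of_rat_hom.mat_poly_hom[OF S] diag mat_poly_conjugate_diag[OF P Q] by simp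
  qed
  have "real_of_rat (det (mat_poly n k (coeff g) S)) = (\<Prod>i<n. ?ev g (f i))"
    using det_conjugate_diag[OF P Q(1,2)] gS by (metis of_rat_hom.hom_det)
  also have "\<dots> = 0" using ga n by (auto simp: prod_zero_iff)
  finally have "det (mat_poly n k (coeff g) S) = 0" by simp
  then have "mat_poly n k (coeff g) S = 0\<^sub>m n n"
    by (intro schur_rational[OF irr mat_poly_carrier]) (rule mat_poly_commute[OF S \<rho>c comm])
  then have z: "P * mat_diag n (\<lambda>i. ?ev g (f i)) * Q = 0\<^sub>m n n"
    unfolding gS[symmetric] by (intro eq_matI) auto
  have groot: "?ev g (f i) = 0" if i: "i < n" for i
  proof -
    let ?D = "mat_diag n (\<lambda>i. ?ev g (f i))"
    have D: "?D \<in> carrier_mat n n" by simp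
    have PD: "P * ?D \<in> carrier_mat n n" by (rule mult_carrier_mat[OF P D])
    have "Q * (P * ?D * Q) * P = Q * P * ?D * (Q * P)"
      using assoc_mult_mat[OF PD Q(1) P] assoc_mult_mat[OF Q(1) mult_carrier_mat[OF PD Q(1)] P]
        assoc_mult_mat[OF Q(1) PD mult_carrier_mat[OF Q(1) P]] assoc_mult_mat[OF Q(1) P D] by simp
    then have "?D = Q * (P * ?D * Q) * P" unfolding Q(3) using D left_mult_one_mat[OF D] right_mult_one_mat[OF D] by simp
    also have "\<dots> = 0\<^sub>m n n" unfolding z using P Q(1) by simp
    finally have "?D $$ (i, i) = 0\<^sub>m n n $$ (i, i)" by simp
    then show ?thesis using i by (simp add: mat_diag_def)
  qed
  have degg: "degree g > 0"
  proof (rule ccontr)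
    assume "\<not> ?thesis"
    then obtain c where "g = [:c:]" using degree_eq_zeroE by blast
    then show False using g0 ga by simp
  qed
  \<comment> \<open>A multiple root would also be a root of the derivative; then g would divide a
    nonzero polynomial of smaller degree.\<close>
  have simple: "Polynomial.order (f i) (map_poly real_of_rat g) = 1" if i: "i < n" for i
  proof -
    have "\<not> ?ev (pderiv g) (f i) = 0"
    proof
      assume "?ev (pderiv g) (f i) = 0"
      then have "g dvd pderiv g" by (rule gdvd[OF groot[OF i]])
      moreover have "pderiv g \<noteq> 0" using degg by (simp add: pderiv_eq_0_iff)
      ultimately have "degree g \<le> degree (pderiv g)" by (rule dvd_imp_degree_le)
      then show False using degg by (simp add: degree_pderiv)
    qed
    moreover have "map_poly real_of_rat (pderiv g) = pderiv (map_poly real_of_rat g)"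
      by (rule of_rat_hom.map_poly_pderiv)
    ultimately have "poly (pderiv (map_poly real_of_rat g)) (f i) \<noteq> 0" by simp
    moreover have gn: "map_poly real_of_rat g \<noteq> 0" using g0 by simp
    moreover have "Polynomial.order (f i) (map_poly real_of_rat g) \<noteq> 0" using groot[OF i] gn by (simp add: order_root)
    moreover have "pderiv (map_poly real_of_rat g) \<noteq> 0" using \<open>poly (pderiv _) _ \<noteq> 0\<close> by auto
    ultimately have "Polynomial.order (f i) (map_poly real_of_rat g) = Suc (Polynomial.order (f i) (pderiv (map_poly real_of_rat g)))"
      using groot[OF i] by (intro order_pderiv) auto
    moreover have "Polynomial.order (f i) (pderiv (map_poly real_of_rat g)) = 0"
      using \<open>poly (pderiv _) _ \<noteq> 0\<close> by (rule order_0I)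
    ultimately show ?thesis by simp
  qed
  have "\<exists>N h. \<chi> = g ^ N * h \<and> \<not> g dvd h"
  proof -
    have bnd: "N \<le> degree \<chi>" if "g ^ N dvd \<chi>" for N
    proof -
      have "degree (g ^ N) \<le> degree \<chi>" by (rule dvd_imp_degree_le[OF that \<chi>0])
      then have "N * degree g \<le> degree \<chi>" using g0 by (simp add: degree_power_eq mult.commute)
      then show ?thesis using degg by (metis le_trans mult.right_neutral mult_le_mono2 Suc_leI One_nat_def)
    qed
    define N where "N = (GREATEST N. g ^ N dvd \<chi>)"
    have N: "g ^ N dvd \<chi>" unfolding N_def
      by (rule GreatestI_nat[of "\<lambda>N. g ^ N dvd \<chi>" 0 "degree \<chi>"]) (use bnd in auto)
    then obtain h where h: "\<chi> = g ^ N * h" by (auto simp: dvd_def)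
    have "\<not> g dvd h"
    proof
      assume "g dvd h"
      then have "g ^ Suc N dvd \<chi>" unfolding h by (simp add: mult.commute mult_dvd_mono)
      then have "Suc N \<le> N" unfolding N_def
        by (rule Greatest_le_nat[of "\<lambda>N. g ^ N dvd \<chi>" _ "degree \<chi>"]) (use bnd in auto)
      then show False by simp
    qed
    then show ?thesis using h by blast
  qed
  \<comment> \<open>The cofactor \<open>h\<close> vanishes at no eigenvalue, since an eigenvalue is
    a root of \<open>g\<close> and a common root would make \<open>g\<close> divide
    \<open>h\<close>.\<close>
  then obtain N h where Nh: "\<chi> = g ^ N * h" "\<not> g dvd h" by blast
  have "card {j. j < n \<and> f j = f i} = N" if i: "i < n" for i
  proof -
    have "?ev h (f i) \<noteq> 0" using gdvd[OF groot[OF i]] Nh(2) by blast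
    then have h0: "Polynomial.order (f i) (map_poly real_of_rat h) = 0" by (rule order_0I)
    have gn: "map_poly real_of_rat g \<noteq> 0" using g0 by simp
    have "map_poly real_of_rat \<chi> \<noteq> 0" using \<chi>0 by simp
    then have nz: "map_poly real_of_rat g ^ N * map_poly real_of_rat h \<noteq> 0"
      unfolding Nh(1) pr.hom_mult pr.hom_power .
    have "card {j. j < n \<and> f j = f i} = Polynomial.order (f i) (map_poly real_of_rat \<chi>)"
      unfolding \<chi> order_prod_linear ..
    also have "\<dots> = Polynomial.order (f i) (map_poly real_of_rat g ^ N * map_poly real_of_rat h)"
      unfolding Nh(1) by (simp only: pr.hom_mult pr.hom_power)
    also have "\<dots> = N * Polynomial.order (f i) (map_poly real_of_rat g) + Polynomial.order (f i) (map_poly real_of_rat h)"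
      unfolding order_mult[OF nz] order_power_mult[OF gn] ..
    finally show ?thesis using simple[OF i] h0 by simp
  qed
  then show ?thesis by (rule that)
qed

lemma sdim_coordinate_subspace:
  fixes P :: "'a::field mat"
  assumes P: "P \<in> carrier_mat n n" and Q: "Q \<in> carrier_mat n n" "Q * P = 1\<^sub>m n" and I: "I \<subseteq> {..<n}"
  defines "W \<equiv> {P *\<^sub>v v |v. v \<in> carrier_vec n \<and> (\<forall>j<n. j \<notin> I \<longrightarrow> v $ j = 0)}"
  shows "VectorSpace.subspace class_ring W (module_vec TYPE('a) n)" "sdim n W = card I"
proof -
  define xs where "xs = sorted_list_of_set I"
  have fin: "finite I" using I finite_subset by blast
  have xs: "set xs = I" "distinct xs" "length xs = card I" using fin by (auto simp: xs_def)
  \<comment> \<open>\<open>E\<close> places its arguments at the positions in \<open>I\<close>, in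
    increasing order. So \<open>W\<close> is the injective image under \<open>P * E\<close> of a
    full coordinate space.\<close>
  define E :: "'a mat" where "E = mat n (card I) (\<lambda>(i, l). if i = xs ! l then 1 else 0)"
  have E: "E \<in> carrier_mat n (card I)" by (simp add: E_def)
  have PE: "P * E \<in> carrier_mat n (card I)" using P E by simp
  have nthn: "xs ! l < n" if "l < card I" for l using that xs I nth_mem by fastforce
  have Eu: "(E *\<^sub>v u) $ (xs ! l) = u $ l" if "u \<in> carrier_vec (card I)" "l < card I" for u l
  proof -
    have "(E *\<^sub>v u) $ (xs ! l) = (\<Sum>m<card I. (if xs ! l = xs ! m then 1 else 0) * u $ m)"
      using that nthn[OF that(2)] by (auto simp: E_def scalar_prod_def atLeast0LessThan)
    also have "\<dots> = (\<Sum>m<card I. if m = l then u $ m else 0)"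
      using that xs by (intro sum.cong) (auto simp: nth_eq_iff_index_eq)
    finally show ?thesis using that by simp
  qed
  have Ez: "(E *\<^sub>v u) $ i = 0" if "u \<in> carrier_vec (card I)" "i < n" "i \<notin> I" for u i
  proof -
    have "i \<noteq> xs ! m" if "m < card I" for m using that xs \<open>i \<notin> I\<close> by (metis nth_mem)
    then show ?thesis using that by (auto simp: E_def scalar_prod_def)
  qed
  have Weq: "W = (*\<^sub>v) (P * E) ` carrier_vec (card I)"
  proof (intro Set.set_eqI iffI)
    fix w assume "w \<in> W"
    then obtain v where v: "w = P *\<^sub>v v" "v \<in> carrier_vec n" "\<forall>j<n. j \<notin> I \<longrightarrow> v $ j = 0"
      unfolding W_def by auto
    define u where "u = vec (card I) (\<lambda>l. v $ (xs ! l))"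
    have u: "u \<in> carrier_vec (card I)" by (simp add: u_def)
    have "E *\<^sub>v u = v"
    proof (rule eq_vecI)
      fix i assume "i < dim_vec v"
      then have i: "i < n" using v by simp
      show "(E *\<^sub>v u) $ i = v $ i"
      proof (cases "i \<in> I")
        case True
        then obtain l where "l < card I" "xs ! l = i" using xs by (metis in_set_conv_nth)
        then show ?thesis using Eu[OF u] by (auto simp: u_def)
      next
        case False
        then show ?thesis using Ez[OF u i] v i by simp
      qed
    qed (use E v in auto)
    then have "w = (P * E) *\<^sub>v u" using v assoc_mult_mat_vec[OF P E u] by simp
    then show "w \<in> (*\<^sub>v) (P * E) ` carrier_vec (card I)" using u by blast
  next
    fix w assume "w \<in> (*\<^sub>v) (P * E) ` carrier_vec (card I)"
    then obtain u where u: "w = (P * E) *\<^sub>v u" "u \<in> carrier_vec (card I)" by auto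
    then have "w = P *\<^sub>v (E *\<^sub>v u)" using assoc_mult_mat_vec[OF P E u(2)] by simp
    moreover have "E *\<^sub>v u \<in> carrier_vec n" using E u(2) by simp
    ultimately show "w \<in> W" unfolding W_def using Ez[OF u(2)] by blast
  qed
  show "VectorSpace.subspace class_ring W (module_vec TYPE('a) n)"
    unfolding Weq by (rule subspace_mat_image[OF subspace_carrier PE])
  have "sdim n W = sdim (card I) (carrier_vec (card I) :: 'a vec set)"
    unfolding Weq
  proof (rule sdim_mat_image_inj[OF subspace_carrier PE])
    fix u :: "'a vec" assume u: "u \<in> carrier_vec (card I)" "(P * E) *\<^sub>v u = 0\<^sub>v n"
    have Ec: "E *\<^sub>v u \<in> carrier_vec n" using E u(1) by simp
    have "P *\<^sub>v (E *\<^sub>v u) = 0\<^sub>v n" using u assoc_mult_mat_vec[OF P E u(1)] by simp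
    then have "Q *\<^sub>v (P *\<^sub>v (E *\<^sub>v u)) = 0\<^sub>v n" using mat_mult_zero_vec[OF Q(1)] by simp
    then have z: "E *\<^sub>v u = 0\<^sub>v n" using assoc_mult_mat_vec[OF Q(1) P Ec] Q(2) Ec by simp
    show "u = 0\<^sub>v (card I)"
    proof (rule eq_vecI)
      fix l assume "l < dim_vec (0\<^sub>v (card I) :: 'a vec)"
      then have l: "l < card I" by simp
      then show "u $ l = 0\<^sub>v (card I) $ l" using Eu[OF u(1) l] z nthn[OF l] by simp
    qed (use u in simp)
  qed
  then show "sdim n W = card I" by (simp add: sdim_carrier)
qed

text \<open>Adding one eigenspace at a time gives a flag of invariant subspaces of dimensions 0, N,
  2N, .... Their index sets in the filtration by the summands grow strictly, but only
  \<open>length ds\<close> indices exist and there are at least as many steps. So every step adds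
  exactly one index, and the degree at that index is the jump N.\<close>

lemma irreducible_summands_equal_degree:
  fixes \<rho> :: "'h \<Rightarrow> real mat"
  assumes rep: "representation H n \<rho>"
    and irr: "list_all2 (irreducible_rep H) ds \<sigma>s" and n: "sum_list ds = n"
    and P: "P \<in> carrier_mat n n" "det P \<noteq> 0"
    and split: "\<And>h. h \<in> carrier H \<Longrightarrow> \<rho> h * P = P * direct_sum_rep \<sigma>s h"
    and M: "M \<in> carrier_mat n n" "\<And>h. h \<in> carrier H \<Longrightarrow> M * \<rho> h = \<rho> h * M"
    and U: "U \<in> carrier_mat n n" "V \<in> carrier_mat n n" "U * V = 1\<^sub>m n" "V * U = 1\<^sub>m n"
    and diag: "M = U * mat_diag n f * V"
    and mult: "\<And>i. i < n \<Longrightarrow> card {j. j < n \<and> f j = f i} = N" and N: "N > 0"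
    and many: "card (f ` {..<n}) \<ge> length ds"
  shows "card (f ` {..<n}) = length ds" "\<forall>d\<in>set ds. d = N"
proof -
  let ?inv = "invariant_subspace H n (direct_sum_rep \<sigma>s)"
  obtain J where J: "\<And>W. ?inv W \<Longrightarrow> J W \<subseteq> {..<length ds}"
      "\<And>W. ?inv W \<Longrightarrow> sdim n W = (\<Sum>j\<in>J W. ds ! j)"
      "\<And>W W'. ?inv W \<Longrightarrow> ?inv W' \<Longrightarrow> W \<subseteq> W' \<Longrightarrow> J W \<subseteq> J W'"
    using invariant_subspace_dimension_filtration[OF irr] unfolding n by blast
  have \<rho>c: "\<rho> h \<in> carrier_mat n n" if "h \<in> carrier H" for h using rep that by (simp add: representation_iff)
  have \<sigma>c: "direct_sum_rep \<sigma>s h \<in> carrier_mat n n" if "h \<in> carrier H" for h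
    using irreducible_rep_carrier[OF irr that] n by simp
  obtain R where R: "R \<in> carrier_mat n n" "P * R = 1\<^sub>m n" "R * P = 1\<^sub>m n"
    using det_inverse_exists[OF P] by metis
  have R\<rho>: "R * \<rho> h = direct_sum_rep \<sigma>s h * R" if h: "h \<in> carrier H" for h
  proof -
    note ac = assoc_mult_mat[of _ n n _ n _ n]
    have "R * \<rho> h = R * (\<rho> h * (P * R))" using R \<rho>c[OF h] by simp
    also have "\<dots> = R * (\<rho> h * P) * R" using R(1) \<rho>c[OF h] P by (simp add: ac)
    also have "\<dots> = (R * P) * direct_sum_rep \<sigma>s h * R"
      unfolding split[OF h] using R(1) P \<sigma>c[OF h] by (simp add: ac)
    finally show ?thesis using R \<sigma>c[OF h] by simp
  qed
  define r where "r = card (f ` {..<n})"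
  obtain s where s: "bij_betw s {..<r} (f ` {..<n})"
    using ex_bij_betw_nat_finite[of "f ` {..<n}"] by (auto simp: r_def atLeast0LessThan)
  define I where "I t = {j. j < n \<and> (\<exists>l<t. f j = s l)}" for t
  define W where "W t = {U *\<^sub>v v |v. v \<in> carrier_vec n \<and> (\<forall>j<n. j \<notin> I t \<longrightarrow> v $ j = 0)}" for t
  have I: "I t \<subseteq> {..<n}" for t by (auto simp: I_def)
  have cardI: "card (I t) = t * N" if "t \<le> r" for t
    using that
  proof (induction t)
    case 0
    then show ?case by (simp add: I_def)
  next
    case (Suc t)
    have "s t \<in> f ` {..<n}" using s Suc.prems by (auto simp: bij_betw_def)
    then obtain i where i: "i < n" "f i = s t" by auto
    have "I (Suc t) = I t \<union> {j. j < n \<and> f j = s t}" by (auto simp: I_def less_Suc_eq)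
    moreover have "I t \<inter> {j. j < n \<and> f j = s t} = {}"
      using s Suc.prems by (force simp: I_def bij_betw_def inj_on_def)
    moreover have "finite (I t)" using I finite_subset by blast
    ultimately have "card (I (Suc t)) = card (I t) + card {j. j < n \<and> f j = s t}"
      by (simp add: card_Un_disjoint)
    then show ?case using Suc mult[OF i(1)] i(2) by simp
  qed
  have Wsub: "VectorSpace.subspace class_ring (W t) (module_vec TYPE(real) n)" "sdim n (W t) = card (I t)" for t
    using sdim_coordinate_subspace[OF U(1,2,4) I] by (simp_all add: W_def)
  \<comment> \<open>In the eigenbasis the group acts by matrices that commute with a diagonal
    matrix. They have no entries between different eigenvalues, which is why sums of eigenspaces are
    invariant.\<close>
  have VrU: "V * \<rho> h * U * mat_diag n f = mat_diag n f * (V * \<rho> h * U)" if h: "h \<in> carrier H" for h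
  proof -
    note ac = assoc_mult_mat[of _ n n _ n _ n]
    define D where "D = mat_diag n f"
    have D: "D \<in> carrier_mat n n" by (simp add: D_def)
    have "V * (M * \<rho> h) * U = (V * U) * D * (V * \<rho> h * U)"
      unfolding diag D_def[symmetric] using U(1,2) D \<rho>c[OF h] by (simp add: ac)
    moreover have "V * (\<rho> h * M) * U = (V * \<rho> h * U) * D * (V * U)"
      unfolding diag D_def[symmetric] using U(1,2) D \<rho>c[OF h] by (simp add: ac)
    ultimately have "(V * U) * D * (V * \<rho> h * U) = (V * \<rho> h * U) * D * (V * U)" using M(2)[OF h] by simp
    moreover have "V * \<rho> h * U \<in> carrier_mat n n" using U(1,2) \<rho>c[OF h] by simp
    ultimately show ?thesis unfolding U(4) D_def[symmetric] using D by simp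
  qed
  have Wpres: "\<rho> h *\<^sub>v w \<in> W t" if h: "h \<in> carrier H" and w: "w \<in> W t" for h w t
  proof -
    obtain v where v: "w = U *\<^sub>v v" "v \<in> carrier_vec n" "\<forall>j<n. j \<notin> I t \<longrightarrow> v $ j = 0"
      using w unfolding W_def by auto
    define Y where "Y = V * \<rho> h * U"
    have Y: "Y \<in> carrier_mat n n" using U \<rho>c[OF h] by (simp add: Y_def)
    have Y0: "Y $$ (i, j) = 0" if "i < n" "j < n" "f i \<noteq> f j" for i j
    proof -
      have "(Y * mat_diag n f) $$ (i, j) = (mat_diag n f * Y) $$ (i, j)" using VrU[OF h] by (simp add: Y_def)
      then show ?thesis
        using that unfolding mat_diag_mult_left[OF Y] mat_diag_mult_right[OF Y] by simp
    qed
    have "U *\<^sub>v (Y *\<^sub>v v) = (U * Y) *\<^sub>v v" using assoc_mult_mat_vec[OF U(1) Y v(2)] by simp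
    also have "U * Y = \<rho> h * U"
    proof -
      have "U * Y = (U * V) * \<rho> h * U"
        unfolding Y_def using U(1,2) \<rho>c[OF h] by (simp add: assoc_mult_mat[of _ n n _ n _ n])
      then show ?thesis unfolding U(3) using \<rho>c[OF h] by simp
    qed
    also have "(\<rho> h * U) *\<^sub>v v = \<rho> h *\<^sub>v w" using v(1) assoc_mult_mat_vec[OF \<rho>c[OF h] U(1) v(2)] by simp
    finally have "\<rho> h *\<^sub>v w = U *\<^sub>v (Y *\<^sub>v v)" by simp
    moreover have "(Y *\<^sub>v v) $ i = 0" if i: "i < n" "i \<notin> I t" for i
    proof -
      have "Y $$ (i, j) * v $ j = 0" if j: "j < n" for j
      proof (cases "j \<in> I t")
        case True
        then have "f i \<noteq> f j" using i j by (auto simp: I_def)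
        then show ?thesis using Y0 i j by simp
      qed (use v j in simp)
      then show ?thesis using i Y v(2) by (auto simp: scalar_prod_def intro!: sum.neutral)
    qed
    moreover have "Y *\<^sub>v v \<in> carrier_vec n" using Y v(2) by simp
    ultimately show ?thesis unfolding W_def by blast
  qed
  define W' where "W' t = (*\<^sub>v) R ` W t" for t
  have Winv: "invariant_subspace H n \<rho> (W t)" for t
    unfolding invariant_subspace_def using Wsub Wpres by blast
  have Wc: "w \<in> carrier_vec n" if "w \<in> W t" for w t using that U(1) by (auto simp: W_def)
  have inv: "?inv (W' t)" for t
    unfolding W'_def
  proof (rule invariant_subspace_image[OF Winv R(1)])
    fix h w assume h: "h \<in> carrier H" and w: "w \<in> W t"
    show "R *\<^sub>v (\<rho> h *\<^sub>v w) = direct_sum_rep \<sigma>s h *\<^sub>v (R *\<^sub>v w)"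
      using assoc_mult_mat_vec[OF R(1) \<rho>c[OF h] Wc[OF w]] assoc_mult_mat_vec[OF \<sigma>c[OF h] R(1) Wc[OF w]] R\<rho>[OF h]
      by simp
  qed
  have sd: "sdim n (W' t) = t * N" if "t \<le> r" for t
  proof -
    have "sdim n (W' t) = sdim n (W t)"
      unfolding W'_def
    proof (rule sdim_mat_image_inj[OF Wsub(1) R(1)])
      fix w assume w: "w \<in> W t" "R *\<^sub>v w = 0\<^sub>v n"
      have "P *\<^sub>v (R *\<^sub>v w) = 0\<^sub>v n" using w(2) mat_mult_zero_vec[OF P(1)] by simp
      then show "w = 0\<^sub>v n" using assoc_mult_mat_vec[OF P(1) R(1) Wc[OF w(1)]] R(2) Wc[OF w(1)] by simp
    qed
    then show ?thesis using Wsub(2) cardI[OF that] by simp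
  qed
  have mono: "W' t \<subseteq> W' (Suc t)" for t
  proof -
    have "I t \<subseteq> I (Suc t)" unfolding I_def using less_SucI by blast
    then show ?thesis unfolding W'_def W_def by (intro image_mono) blast
  qed
  define K where "K t = J (W' t)" for t
  have Kf: "finite (K t)" "K t \<subseteq> {..<length ds}" for t
    using J(1)[OF inv] finite_subset unfolding K_def by blast+
  have Ksum: "(\<Sum>j\<in>K t. ds ! j) = t * N" if "t \<le> r" for t
    using J(2)[OF inv, of t] sd[OF that] by (simp add: K_def)
  have Kmono: "K t \<subseteq> K (Suc t)" for t unfolding K_def by (rule J(3)[OF inv inv mono])
  \<comment> \<open>Consecutive dimensions differ by \<open>N > 0\<close>, so the index sets cannot
    be equal.\<close>
  have Kstrict: "card (K t) < card (K (Suc t))" if "Suc t \<le> r" for t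
  proof (rule psubset_card_mono[OF Kf(1)])
    have "K t \<noteq> K (Suc t)" using Ksum[of t] Ksum[OF that] that N by auto
    then show "K t \<subset> K (Suc t)" using Kmono by blast
  qed
  have Kge: "card (K t) \<ge> t" if "t \<le> r" for t
    using that
  proof (induction t)
    case (Suc t)
    then show ?case using Kstrict[of t] by simp
  qed simp
  \<comment> \<open>Climbing from t to r gains at least r - t indices. As r =
    \<open>length ds\<close> indices exist in all, this bounds \<open>card (K t)\<close> by t from
    above.\<close>
  have Kdiff: "card (K t) + i \<le> card (K (t + i))" if "t + i \<le> r" for t i
    using that
  proof (induction i)
    case (Suc i)
    then show ?case using Kstrict[of "t + i"] by simp
  qed simp
  have Kle: "card (K t) \<le> length ds" for t
    using card_mono[of "{..<length ds}" "K t"] Kf(2) by simp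
  have r: "r = length ds" using Kge[of r] Kle[of r] many by (simp add: r_def)
  then show "card (f ` {..<n}) = length ds" by (simp add: r_def)
  have Kcard: "card (K t) = t" if "t \<le> r" for t
    using Kge[OF that] Kdiff[of t "r - t"] Kle[of r] that r by simp
  have "\<forall>j\<in>K t. ds ! j = N" if "t \<le> r" for t
    using that
  proof (induction t)
    case 0
    then show ?case using Kcard[of 0] Kf(1) by auto
  next
    case (Suc t)
    have "card (K (Suc t) - K t) = 1"
      using card_Diff_subset[OF Kf(1) Kmono, of t] Kcard[of t] Kcard[OF Suc.prems] Suc.prems by simp
    then obtain j where j: "K (Suc t) - K t = {j}" by (auto simp: card_1_singleton_iff)
    then have K: "K (Suc t) = insert j (K t)" "j \<notin> K t" using Kmono[of t] by auto
    have "ds ! j + t * N = Suc t * N"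
      using Ksum[OF Suc.prems] Ksum[of t] Suc.prems K Kf(1) by simp
    then have "ds ! j = N" by simp
    then show ?case using Suc K by simp
  qed
  moreover have "K r = {..<length ds}"
    by (rule card_subset_eq) (use Kf(2) Kcard[of r] r in auto)
  ultimately have "ds ! j = N" if "j < length ds" for j using that by blast
  then show "\<forall>d\<in>set ds. d = N" by (auto simp: in_set_conv_nth)
qed

text \<open>Serves both directions: the common degree N controls the dimensions of real invariant
  subspaces, and the diagonalised \<open>S\<close> with exactly \<open>length ds\<close> eigenvalues
  is what the units are built from.\<close>

theorem real_components_equal_degree:
  fixes \<rho> :: "'h \<Rightarrow> rat mat"
  assumes H: "group H" "finite (carrier H)" and irr\<rho>: "irreducible_rep H n \<rho>"
    and irr: "list_all2 (irreducible_rep H) ds \<sigma>s" and n: "sum_list ds = n"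
    and P: "P \<in> carrier_mat n n" "det P \<noteq> 0"
    and split: "\<And>h. h \<in> carrier H \<Longrightarrow> real_extension \<rho> h * P = P * direct_sum_rep \<sigma>s h"
  obtains S U V f N where "S \<in> carrier_mat n n" "\<forall>h \<in> carrier H. S * \<rho> h = \<rho> h * S"
    "U \<in> carrier_mat n n" "V \<in> carrier_mat n n" "U * V = 1\<^sub>m n" "V * U = 1\<^sub>m n"
    "map_mat real_of_rat S = U * mat_diag n f * V" "N > 0"
    "\<forall>i<n. card {j. j < n \<and> f j = f i} = N" "card (f ` {..<n}) = length ds" "\<forall>d\<in>set ds. d = N"
proof -
  have rep: "representation H n \<rho>" and n0: "n > 0" using irr\<rho> by (auto simp: irreducible_rep_iff)
  obtain S B where S: "S \<in> carrier_mat n n" "\<forall>h \<in> carrier H. S * \<rho> h = \<rho> h * S"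
    and B: "B \<in> carrier_mat n n" "B\<^sup>T = B" "(B * map_mat real_of_rat S)\<^sup>T = B * map_mat real_of_rat S"
      "\<forall>v \<in> carrier_vec n. v \<bullet> (B *\<^sub>v v) \<le> 0 \<longrightarrow> v = 0\<^sub>v n"
    and indep: "\<forall>c. mat_poly n (length ds) c (map_mat real_of_rat S) = 0\<^sub>m n n \<longrightarrow> (\<forall>l<length ds. c l = 0)"
    by (rule rational_selfadjoint_commutant_element[OF H rep irr n P split]) (assumption | rule that)+
  let ?M = "map_mat real_of_rat S"
  have M: "?M \<in> carrier_mat n n" using S by simp
  obtain U V f where U: "U \<in> carrier_mat n n" "V \<in> carrier_mat n n" "U * V = 1\<^sub>m n" "V * U = 1\<^sub>m n"
    and diag: "?M = U * mat_diag n f * V"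
    by (rule selfadjoint_diagonalizable[OF M B(1,2,3)]) (use B(4) in blast, rule that)
  obtain N where N: "\<And>i. i < n \<Longrightarrow> card {j. j < n \<and> f j = f i} = N"
    using commutant_equal_multiplicities[OF irr\<rho> S(1) _ U diag] S(2) by blast
  have N0: "N > 0"
  proof -
    have "finite {j. j < n \<and> f j = f 0}" "0 \<in> {j. j < n \<and> f j = f 0}" using n0 by auto
    then have "card {j. j < n \<and> f j = f 0} > 0" by (auto simp: card_gt_0_iff)
    then show ?thesis using N[OF n0] by simp
  qed
  have many: "card (f ` {..<n}) \<ge> length ds"
  proof (rule ccontr)
    assume "\<not> ?thesis"
    then have less: "card (f ` {..<n}) < length ds" by simp
    \<comment> \<open>With fewer than \<open>length ds\<close> eigenvalues, the product of X - a
      over the different eigenvalues would be a relation among the first \<open>length ds\<close>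
      powers of the matrix, nontrivial because it is monic.\<close>
    define p where "p = (\<Prod>a\<in>f ` {..<n}. [:- a, 1:])"
    have deg: "degree p = card (f ` {..<n})" unfolding p_def
      by (subst degree_prod_eq_sum_degree) auto
    have lc: "coeff p (degree p) = 1" unfolding p_def by (rule lead_coeff_prod[THEN trans]) simp
    have "(\<Sum>l<length ds. coeff p l * x ^ l) = poly p x" for x
    proof -
      have "(\<Sum>l<length ds. coeff p l * x ^ l) = (\<Sum>l\<le>degree p. coeff p l * x ^ l)"
        using less deg by (intro sum.mono_neutral_right) (auto simp: coeff_eq_0)
      then show ?thesis by (simp add: poly_altdef)
    qed
    moreover have "poly p (f i) = 0" if "i < n" for i
      using that unfolding p_def poly_prod by (auto simp: prod_zero_iff)
    ultimately have "mat_diag n (\<lambda>i. \<Sum>l<length ds. coeff p l * f i ^ l) = 0\<^sub>m n n"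
      by (intro eq_matI) (auto simp: mat_diag_def)
    then have "mat_poly n (length ds) (coeff p) ?M = 0\<^sub>m n n"
      unfolding diag mat_poly_conjugate_diag[OF U] using U by simp
    then have "coeff p (degree p) = 0" using indep less deg by simp
    then show False using lc by simp
  qed
  have comm: "?M * real_extension \<rho> h = real_extension \<rho> h * ?M" if "h \<in> carrier H" for h
  proof -
    have "\<rho> h \<in> carrier_mat n n" using rep that by (simp add: representation_iff)
    then show ?thesis
      using S(2) that map_mat_of_rat_mult[OF S(1), of "\<rho> h" n] map_mat_of_rat_mult[OF _ S(1), of "\<rho> h" n]
      by (simp add: real_extension_def)
  qed
  note eq = irreducible_summands_equal_degree[OF real_extension_representation[OF rep] irr n P split M comm U diag N N0 many]
  have N': "\<forall>i<n. card {j. j < n \<and> f j = f i} = N" using N by blast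
  show ?thesis by (rule that[OF S U diag N0 N' eq])
qed

section \<open>Eigenvalues of matrices commuting with a multiple\<close>

lemma cmod_det_eigenvalues:
  fixes A :: "complex mat"
  assumes A: "A \<in> carrier_mat n n" and zs: "char_poly A = (\<Prod>a\<leftarrow>zs. [:- a, 1:])"
  shows "cmod (det A) = prod_list (map cmod zs)"
proof -
  have "- (char_matrix A 0) = (-1) \<cdot>\<^sub>m A" using A by (intro eq_matI) (auto simp: char_matrix_def)
  then have "poly (char_poly A) 0 = (-1) ^ n * det A"
    using char_poly_matrix[OF A, of 0] A by simp
  moreover have "poly (char_poly A) 0 = prod_list (map uminus zs)"
    unfolding zs poly_prod_list by (simp add: o_def)
  ultimately have "cmod (det A) = cmod (prod_list (map uminus zs))"
    by (metis mult_1 norm_minus_cancel norm_mult norm_one norm_power power_one)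
  also have "\<dots> = prod_list (map cmod zs)" by (induction zs) (simp_all add: norm_mult)
  finally show ?thesis .
qed

text \<open>For a = Re w and b = |w|^2 this is (X - w)(X - cnj w). It is real even if w is not, so
  its kernel is a real subspace, to which the dimension count applies.\<close>

definition quadratic_mat :: "nat \<Rightarrow> real mat \<Rightarrow> real \<Rightarrow> real \<Rightarrow> real mat" where
  "quadratic_mat n X a b = X * X + ((- (2 * a)) \<cdot>\<^sub>m X + b \<cdot>\<^sub>m 1\<^sub>m n)"

lemma quadratic_mat_carrier [simp]: "X \<in> carrier_mat n n \<Longrightarrow> quadratic_mat n X a b \<in> carrier_mat n n"
  by (simp add: quadratic_mat_def)

lemma quadratic_mat_index:
  assumes "X \<in> carrier_mat n n" "i < n" "j < n"
  shows "quadratic_mat n X a b $$ (i, j) =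
    (\<Sum>l<n. X $$ (i, l) * X $$ (l, j)) - 2 * a * X $$ (i, j) + (if i = j then b else 0)"
  using assms mat_mult_index_sum[OF assms(1,1,2,3)] by (simp add: quadratic_mat_def)

lemma quadratic_mat_eigenvector:
  assumes X: "X \<in> carrier_mat n n" and v: "v \<in> carrier_vec n"
    and ev: "map_mat complex_of_real X *\<^sub>v v = z \<cdot>\<^sub>v v" and i: "i < n"
  shows "(\<Sum>j<n. of_real (quadratic_mat n X a b $$ (i, j)) * v $ j) = (z\<^sup>2 - 2 * of_real a * z + of_real b) * v $ i"
proof -
  have e: "(\<Sum>j<n. complex_of_real (X $$ (l, j)) * v $ j) = z * v $ l" if "l < n" for l
  proof -
    have "(map_mat complex_of_real X *\<^sub>v v) $ l = (\<Sum>j<n. complex_of_real (X $$ (l, j)) * v $ j)"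
      using X v that by (auto simp: scalar_prod_def atLeast0LessThan)
    then show ?thesis using v that ev by simp
  qed
  have "(\<Sum>j<n. (\<Sum>l<n. complex_of_real (X $$ (i, l)) * of_real (X $$ (l, j))) * v $ j) =
      (\<Sum>j<n. \<Sum>l<n. of_real (X $$ (i, l)) * (of_real (X $$ (l, j)) * v $ j))"
    by (simp add: sum_distrib_right mult.assoc)
  also have "\<dots> = (\<Sum>l<n. \<Sum>j<n. of_real (X $$ (i, l)) * (of_real (X $$ (l, j)) * v $ j))"
    by (rule sum.swap)
  also have "\<dots> = (\<Sum>l<n. of_real (X $$ (i, l)) * (z * v $ l))"
    by (simp add: e sum_distrib_left[symmetric])
  also have "\<dots> = z * (\<Sum>l<n. of_real (X $$ (i, l)) * v $ l)"
    by (simp add: sum_distrib_left mult_ac)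
  also have "\<dots> = z\<^sup>2 * v $ i" using e[OF i] by (simp add: power2_eq_square)
  finally have s2: "(\<Sum>j<n. (\<Sum>l<n. complex_of_real (X $$ (i, l)) * of_real (X $$ (l, j))) * v $ j) = z\<^sup>2 * v $ i" .
  have "(\<Sum>j<n. of_real (quadratic_mat n X a b $$ (i, j)) * v $ j) =
      (\<Sum>j<n. (\<Sum>l<n. complex_of_real (X $$ (i, l)) * of_real (X $$ (l, j))) * v $ j
        - 2 * of_real a * (of_real (X $$ (i, j)) * v $ j) + (if i = j then of_real b * v $ j else 0))"
  proof (rule sum.cong[OF refl])
    fix j assume "j \<in> {..<n}"
    then have j: "j < n" by simp
    show "of_real (quadratic_mat n X a b $$ (i, j)) * v $ j =
        (\<Sum>l<n. complex_of_real (X $$ (i, l)) * of_real (X $$ (l, j))) * v $ j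
        - 2 * of_real a * (of_real (X $$ (i, j)) * v $ j) + (if i = j then of_real b * v $ j else 0)"
      unfolding quadratic_mat_index[OF X i j] by (simp add: algebra_simps)
  qed
  also have "\<dots> = z\<^sup>2 * v $ i - 2 * of_real a * (z * v $ i) + of_real b * v $ i"
    using i by (simp add: sum.distrib sum_subtractf s2 sum_distrib_left[symmetric] e)
  finally show ?thesis by (simp add: algebra_simps)
qed

lemma quadratic_roots:
  "z\<^sup>2 - 2 * of_real (Re w) * z + of_real ((cmod w)\<^sup>2) = (z - w) * (z - cnj w)"
proof -
  have "w * cnj w = of_real ((cmod w)\<^sup>2)" by (rule complex_norm_square[symmetric])
  moreover have "w + cnj w = 2 * of_real (Re w)" by (simp add: complex_add_cnj)
  moreover have "(z - w) * (z - cnj w) = z\<^sup>2 - (w + cnj w) * z + w * cnj w"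
    by (simp add: algebra_simps power2_eq_square)
  ultimately show ?thesis by simp
qed

text \<open>Every eigenvalue is w or its conjugate, and the two have the same absolute value, so
  their multiplicities need not be known.\<close>

lemma det_annihilated_by_quadratic:
  assumes X: "X \<in> carrier_mat n n" and zero: "quadratic_mat n X (Re w) ((cmod w)\<^sup>2) = 0\<^sub>m n n"
  shows "\<bar>det X\<bar> = cmod w ^ n"
proof -
  let ?X = "map_mat complex_of_real X"
  have Xc: "?X \<in> carrier_mat n n" using X by simp
  obtain zs where zs: "char_poly ?X = (\<Prod>a\<leftarrow>zs. [:- a, 1:])" "length zs = n"
    using char_poly_factorized[OF Xc] by blast
  have "cmod z = cmod w" if z: "z \<in> set zs" for z
  proof -
    have "poly (char_poly ?X) z = 0" unfolding zs poly_prod_list using z by (auto simp: prod_list_zero_iff)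
    then have "eigenvalue ?X z" using eigenvalue_root_char_poly[OF Xc] by blast
    then obtain v where v: "v \<in> carrier_vec n" "v \<noteq> 0\<^sub>v n" "?X *\<^sub>v v = z \<cdot>\<^sub>v v"
      using X by (auto simp: eigenvalue_def eigenvector_def)
    then obtain i where i: "i < n" "v $ i \<noteq> 0" by (metis carrier_vecD eq_vecI index_zero_vec)
    have "(z - w) * (z - cnj w) * v $ i = 0"
      unfolding quadratic_roots[symmetric] quadratic_mat_eigenvector[OF X v(1,3) i(1), symmetric]
      using i(1) by (simp add: zero)
    then have "z = w \<or> z = cnj w" using i(2) by simp
    then show ?thesis by auto
  qed
  then have "map cmod zs = replicate n (cmod w)" using zs(2) by (intro nth_equalityI) auto
  then have "cmod (det ?X) = cmod w ^ n" using cmod_det_eigenvalues[OF Xc zs(1)] by simp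
  then show ?thesis by simp
qed

text \<open>The real and the imaginary part of a complex eigenvector are both in the kernel, and
  they are not both zero.\<close>

lemma quadratic_mat_kernel_nonzero:
  assumes X: "X \<in> carrier_mat n n" and ev: "eigenvalue (map_mat complex_of_real X) w"
  shows "\<exists>u\<in>carrier_vec n. u \<noteq> 0\<^sub>v n \<and> quadratic_mat n X (Re w) ((cmod w)\<^sup>2) *\<^sub>v u = 0\<^sub>v n"
proof -
  let ?A = "quadratic_mat n X (Re w) ((cmod w)\<^sup>2)"
  have A: "?A \<in> carrier_mat n n" using X by simp
  obtain v where v: "v \<in> carrier_vec n" "v \<noteq> 0\<^sub>v n" "map_mat complex_of_real X *\<^sub>v v = w \<cdot>\<^sub>v v"
    using ev X by (auto simp: eigenvalue_def eigenvector_def)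
  obtain i where i: "i < n" "v $ i \<noteq> 0" using v by (metis carrier_vecD eq_vecI index_zero_vec)
  have z: "(\<Sum>j<n. of_real (?A $$ (i, j)) * v $ j) = 0" if "i < n" for i
    unfolding quadratic_mat_eigenvector[OF X v(1,3) that] quadratic_roots by simp
  have "?A *\<^sub>v map_vec Re v = 0\<^sub>v n"
  proof (rule eq_vecI)
    fix i assume "i < dim_vec (0\<^sub>v n :: real vec)"
    then have i: "i < n" by simp
    have "(?A *\<^sub>v map_vec Re v) $ i = Re (\<Sum>j<n. of_real (?A $$ (i, j)) * v $ j)"
      using i A v(1) by (auto simp: scalar_prod_def atLeast0LessThan Re_sum)
    then show "(?A *\<^sub>v map_vec Re v) $ i = 0\<^sub>v n $ i" using z[OF i] i by simp
  qed (use A in auto)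
  moreover have "?A *\<^sub>v map_vec Im v = 0\<^sub>v n"
  proof (rule eq_vecI)
    fix i assume "i < dim_vec (0\<^sub>v n :: real vec)"
    then have i: "i < n" by simp
    have "(?A *\<^sub>v map_vec Im v) $ i = Im (\<Sum>j<n. of_real (?A $$ (i, j)) * v $ j)"
      using i A v(1) by (auto simp: scalar_prod_def atLeast0LessThan Im_sum)
    then show "(?A *\<^sub>v map_vec Im v) $ i = 0\<^sub>v n $ i" using z[OF i] i by simp
  qed (use A in auto)
  moreover have "map_vec Re v \<noteq> 0\<^sub>v n \<or> map_vec Im v \<noteq> 0\<^sub>v n"
  proof (rule ccontr)
    assume "\<not> ?thesis"
    then have "map_vec Re v $ i = 0" "map_vec Im v $ i = 0" using i(1) by auto
    then show False using i v(1) by (simp add: complex_eq_iff)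
  qed
  moreover have "map_vec Re v \<in> carrier_vec n" "map_vec Im v \<in> carrier_vec n" using v(1) by auto
  ultimately show ?thesis by blast
qed

lemma quadratic_mat_commute:
  assumes X: "X \<in> carrier_mat n n" and Y: "Y \<in> carrier_mat n n" and comm: "X * Y = Y * X"
  shows "quadratic_mat n X a b * Y = Y * quadratic_mat n X a b"
proof -
  have XX: "X * X \<in> carrier_mat n n" and c: "(- (2 * a)) \<cdot>\<^sub>m X \<in> carrier_mat n n" "b \<cdot>\<^sub>m 1\<^sub>m n \<in> carrier_mat n n"
    "(- (2 * a)) \<cdot>\<^sub>m X + b \<cdot>\<^sub>m 1\<^sub>m n \<in> carrier_mat n n" using X by auto
  have "X * X * Y = Y * (X * X)"
    using assoc_mult_mat[OF X X Y] assoc_mult_mat[OF X Y X] assoc_mult_mat[OF Y X X] comm by simp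
  moreover have "((- (2 * a)) \<cdot>\<^sub>m X + b \<cdot>\<^sub>m 1\<^sub>m n) * Y = Y * ((- (2 * a)) \<cdot>\<^sub>m X + b \<cdot>\<^sub>m 1\<^sub>m n)"
    unfolding add_mult_distrib_mat[OF c(1,2) Y] mult_add_distrib_mat[OF Y c(1,2)]
      mult_smult_assoc_mat[OF X Y] mult_smult_distrib[OF Y X] mult_smult_assoc_mat[OF one_carrier_mat Y]
      mult_smult_distrib[OF Y one_carrier_mat] comm
    using Y by simp
  ultimately show ?thesis
    unfolding quadratic_mat_def add_mult_distrib_mat[OF XX c(3) Y] mult_add_distrib_mat[OF Y XX c(3)] by simp
qed

lemma quadratic_mat_conjugate:
  assumes X: "X \<in> carrier_mat n n" and P: "P \<in> carrier_mat n n"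
    and Q: "Q \<in> carrier_mat n n" "P * Q = 1\<^sub>m n" "Q * P = 1\<^sub>m n"
  shows "quadratic_mat n (Q * X * P) a b = Q * quadratic_mat n X a b * P"
proof -
  have c: "X * X \<in> carrier_mat n n" "(- (2 * a)) \<cdot>\<^sub>m X \<in> carrier_mat n n" "b \<cdot>\<^sub>m 1\<^sub>m n \<in> carrier_mat n n"
    "(- (2 * a)) \<cdot>\<^sub>m X + b \<cdot>\<^sub>m 1\<^sub>m n \<in> carrier_mat n n" "Q * X \<in> carrier_mat n n"
    "Q * (X * X) \<in> carrier_mat n n" "Q * ((- (2 * a)) \<cdot>\<^sub>m X) \<in> carrier_mat n n" "Q * (b \<cdot>\<^sub>m 1\<^sub>m n) \<in> carrier_mat n n"
    using X Q(1) by auto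
  have "Q * quadratic_mat n X a b * P = Q * (X * X) * P + (Q * ((- (2 * a)) \<cdot>\<^sub>m X) * P + Q * (b \<cdot>\<^sub>m 1\<^sub>m n) * P)"
    unfolding quadratic_mat_def mult_add_distrib_mat[OF Q(1) c(1,4)] mult_add_distrib_mat[OF Q(1) c(2,3)]
      add_mult_distrib_mat[OF c(6) add_carrier_mat[OF c(8)] P] add_mult_distrib_mat[OF c(7,8) P] ..
  also have "Q * (X * X) * P = Q * X * P * (Q * X * P)" by (rule conjugate_mult[OF P Q(1,2) X X])
  also have "Q * ((- (2 * a)) \<cdot>\<^sub>m X) * P = (- (2 * a)) \<cdot>\<^sub>m (Q * X * P)"
    unfolding mult_smult_distrib[OF Q(1) X] mult_smult_assoc_mat[OF c(5) P] ..
  also have "Q * (b \<cdot>\<^sub>m 1\<^sub>m n) * P = b \<cdot>\<^sub>m 1\<^sub>m n"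
    unfolding mult_smult_distrib[OF Q(1) one_carrier_mat] right_mult_one_mat[OF Q(1)]
      mult_smult_assoc_mat[OF Q(1) P] Q(3) ..
  finally show ?thesis unfolding quadratic_mat_def by simp
qed

lemma eigenvalue_block_triangular:
  fixes X1 :: "complex mat"
  assumes "X1 \<in> carrier_mat d d" "X3 \<in> carrier_mat d e" "X2 \<in> carrier_mat e e" "eigenvalue X2 z"
  shows "eigenvalue (four_block_mat X1 X3 (0\<^sub>m e d) X2) z"
proof -
  have T: "four_block_mat X1 X3 (0\<^sub>m e d) X2 \<in> carrier_mat (d + e) (d + e)" using assms by auto
  have "char_poly (four_block_mat X1 X3 (0\<^sub>m e d) X2) = char_poly X1 * char_poly X2"
    by (rule char_poly_0_block[OF refl _ _ assms(1-3)]) (use char_poly_factorized assms in blast)+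
  then show ?thesis
    using assms(4) unfolding eigenvalue_root_char_poly[OF assms(3)] eigenvalue_root_char_poly[OF T] by simp
qed

lemma eigenvalue_similar:
  fixes X :: "complex mat"
  assumes "X \<in> carrier_mat n n" "P \<in> carrier_mat n n" "Q \<in> carrier_mat n n" "P * Q = 1\<^sub>m n" "Q * P = 1\<^sub>m n"
    and "eigenvalue (Q * X * P) z"
  shows "eigenvalue X z"
proof -
  have T: "Q * X * P \<in> carrier_mat n n" using assms by simp
  have "similar_mat_wit (Q * X * P) X Q P"
    by (rule similar_mat_witI[OF assms(5,4) refl T assms(1,3,2)])
  then have "char_poly (Q * X * P) = char_poly X" by (intro char_poly_similar) (auto simp: similar_mat_def)
  then show ?thesis
    using assms(6) unfolding eigenvalue_root_char_poly[OF T] eigenvalue_root_char_poly[OF assms(1)] by simp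
qed

lemma proj_last_index:
  assumes "y \<in> carrier_vec (d + n)" "i < n"
  shows "(proj_last d n *\<^sub>v y) $ i = y $ (d + i)"
  using assms
  by (auto simp: proj_last_def scalar_prod_def if_distrib[of "\<lambda>x. x * _"] cong: if_cong)

lemma map_mat_complex_mult:
  assumes "A \<in> carrier_mat r m" "B \<in> carrier_mat m c"
  shows "map_mat complex_of_real (A * B) = map_mat complex_of_real A * map_mat complex_of_real B"
  by (rule of_real_hom.mat_hom_mult[OF assms])

text \<open>Each step splits off the kernel of \<open>X\<^sup>2 - 2 Re w X + |w|\<^sup>2\<close>, on which all eigenvalues of \<open>X\<close>
  have absolute value \<open>|w|\<close>; its dimension is a multiple of \<open>N\<close>.\<close>

lemma eigenvalue_list_of_norm_det:
  fixes \<mu> :: "'h \<Rightarrow> real mat"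
  assumes H: "group H"
  shows "representation H n \<mu> \<Longrightarrow> X \<in> carrier_mat n n \<Longrightarrow> \<forall>h\<in>carrier H. X * \<mu> h = \<mu> h * X \<Longrightarrow>
    \<forall>W. invariant_subspace H n \<mu> W \<longrightarrow> N dvd sdim n W \<Longrightarrow>
    \<exists>ls. length ls * N = n \<and> (\<forall>z\<in>set ls. eigenvalue (map_mat complex_of_real X) z) \<and>
      prod_list (map cmod ls) ^ N = \<bar>det X\<bar>"
\<comment> \<open>The induction runs over all representations whose invariant subspaces have
  dimension divisible by \<open>N\<close>. The quotient by the kernel need not be presented as a
  multiple, but it inherits this property.\<close>
proof (induction n arbitrary: \<mu> X rule: less_induct)
  case (less n)
  note rep = less.prems(1) and X = less.prems(2) and comm = less.prems(3) and dvdN = less.prems(4)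
  show ?case
  proof (cases "n = 0")
    case True
    then show ?thesis using X by (intro exI[of _ "[]"]) simp
  next
    case False
    have \<mu>c: "\<mu> h \<in> carrier_mat n n" if "h \<in> carrier H" for h using rep that by (simp add: representation_iff)
    have "spectrum (map_mat complex_of_real X) \<noteq> {}"
      by (rule spectrum_non_empty[of _ n]) (use X False in auto)
    then obtain w where w: "eigenvalue (map_mat complex_of_real X) w" by (auto simp: spectrum_def)
    define A where "A = quadratic_mat n X (Re w) ((cmod w)\<^sup>2)"
    have A: "A \<in> carrier_mat n n" using X by (simp add: A_def)
    define W where "W = {u \<in> carrier_vec n. A *\<^sub>v u = 0\<^sub>v n}"
    \<comment> \<open>Whatever commutes with \<open>X\<close> preserves the kernel; this is used for
      the group and for \<open>X\<close> itself.\<close>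
    have pres: "Y *\<^sub>v u \<in> W" if Y: "Y \<in> carrier_mat n n" "X * Y = Y * X" and u: "u \<in> W" for Y u
    proof -
      have uc: "u \<in> carrier_vec n" and z: "A *\<^sub>v u = 0\<^sub>v n" using u by (auto simp: W_def)
      have "A *\<^sub>v (Y *\<^sub>v u) = Y *\<^sub>v (A *\<^sub>v u)"
        using assoc_mult_mat_vec[OF A Y(1) uc] assoc_mult_mat_vec[OF Y(1) A uc]
          quadratic_mat_commute[OF X Y] by (simp add: A_def)
      then show ?thesis using Y(1) uc z mat_mult_zero_vec[OF Y(1)] by (simp add: W_def)
    qed
    have "invariant_subspace H n \<mu> (carrier_vec n)"
      using mult_mat_vec_carrier[OF \<mu>c] by (auto simp: invariant_subspace_def subspace_carrier)
    then have W: "invariant_subspace H n \<mu> W"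
      unfolding W_def
    proof (rule invariant_subspace_kernel[OF _ A])
      fix h u assume "h \<in> carrier H" "u \<in> carrier_vec n" "A *\<^sub>v u = 0\<^sub>v n"
      then show "A *\<^sub>v (\<mu> h *\<^sub>v u) = 0\<^sub>v n" using pres[OF \<mu>c] comm by (auto simp: W_def)
    qed
    obtain P Q d e A1 B D where n: "n = d + e" and d: "d = sdim n W"
      and P: "P \<in> carrier_mat n n" and Q: "Q \<in> carrier_mat n n" and PQ: "P * Q = 1\<^sub>m n" "Q * P = 1\<^sub>m n"
      and detP: "det P \<noteq> 0"
      and Weq: "W = {P *\<^sub>v v |v. v \<in> carrier_vec n \<and> (\<forall>j<n. d \<le> j \<longrightarrow> v $ j = 0)}"
      and blk: "\<forall>Y \<in> carrier_mat n n. (\<forall>w \<in> W. Y *\<^sub>v w \<in> W) \<longrightarrow>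
        Q * Y * P = four_block_mat (upper_left d e (Q * Y * P)) (upper_right d e (Q * Y * P))
          (0\<^sub>m e d) (lower_right d e (Q * Y * P))"
      and form: "\<forall>h \<in> carrier H. Q * \<mu> h * P = four_block_mat (A1 h) (B h) (0\<^sub>m e d) (D h)"
      and A1: "representation H d A1" and D: "representation H e D"
      and B: "\<forall>h \<in> carrier H. B h \<in> carrier_mat d e"
      and coc: "\<forall>g \<in> carrier H. \<forall>h \<in> carrier H. B (g \<otimes>\<^bsub>H\<^esub> h) = A1 g * B h + B g * D h"
      by (rule triangular_representation[OF H rep W]) (rule that)
    have A1c: "A1 h \<in> carrier_mat d d" and Dc: "D h \<in> carrier_mat e e" if "h \<in> carrier H" for h
      using that A1 D by (auto simp: representation_iff)
    define T where "T = Q * X * P"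
    define X1 where "X1 = upper_left d e T"
    define X3 where "X3 = upper_right d e T"
    define X2 where "X2 = lower_right d e T"
    have Xc: "X1 \<in> carrier_mat d d" "X3 \<in> carrier_mat d e" "X2 \<in> carrier_mat e e"
      by (simp_all add: X1_def X2_def X3_def)
    have Tc: "T \<in> carrier_mat n n" using X P Q by (simp add: T_def)
    have T: "T = four_block_mat X1 X3 (0\<^sub>m e d) X2"
      unfolding X1_def X2_def X3_def T_def using blk X pres[OF X refl] by blast
    have d0: "d \<noteq> 0"
    proof
      assume "d = 0"
      obtain u where u: "u \<in> carrier_vec n" "u \<noteq> 0\<^sub>v n" "A *\<^sub>v u = 0\<^sub>v n"
        using quadratic_mat_kernel_nonzero[OF X w] by (auto simp: A_def)
      then have "u \<in> W" by (simp add: W_def)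
      then obtain v where v: "u = P *\<^sub>v v" "v \<in> carrier_vec n" "\<forall>j<n. d \<le> j \<longrightarrow> v $ j = 0"
        unfolding Weq by blast
      have "v = 0\<^sub>v n" using v(2,3) \<open>d = 0\<close> by (intro eq_vecI) auto
      then show False using u(2) v(1) mat_mult_zero_vec[OF P] by simp
    qed
    have en: "e < n" using n d0 by simp
    have "quadratic_mat d X1 (Re w) ((cmod w)\<^sup>2) = 0\<^sub>m d d"
    proof (rule eq_matI)
      fix i j assume "i < dim_row (0\<^sub>m d d :: real mat)" "j < dim_col (0\<^sub>m d d :: real mat)"
      then have ij: "i < d" "j < d" by auto
      then have ijn: "i < n" "j < n" using n by auto
      have T1: "T $$ (a, b) = X1 $$ (a, b)" if "a < d" "b < d" for a b
        using that Xc n unfolding T by simp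
      have T0: "T $$ (a, b) = 0" if "d \<le> a" "a < n" "b < d" for a b
        using that Xc n unfolding T by simp
      \<comment> \<open>As \<open>T\<close> is triangular, the upper left block of its square is the
        square of \<open>X1\<close>. So the quadratic in \<open>X1\<close> is a corner of the
        quadratic in \<open>T\<close>, and that corner is the action on \<open>W\<close>, where it
        vanishes.\<close>
      have "(\<Sum>l<n. T $$ (i, l) * T $$ (l, j)) = (\<Sum>l<d. X1 $$ (i, l) * X1 $$ (l, j))"
        using T0 T1 ij n by (intro sum.mono_neutral_cong_right) auto
      then have "quadratic_mat d X1 (Re w) ((cmod w)\<^sup>2) $$ (i, j) = quadratic_mat n T (Re w) ((cmod w)\<^sup>2) $$ (i, j)"
        unfolding quadratic_mat_index[OF Xc(1) ij] quadratic_mat_index[OF Tc ijn] using T1[OF ij] by simp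
      also have "quadratic_mat n T (Re w) ((cmod w)\<^sup>2) = Q * A * P"
        unfolding T_def A_def by (rule quadratic_mat_conjugate[OF X P Q PQ])
      also have "(Q * A * P) $$ (i, j) = 0"
      proof -
        let ?u = "unit_vec n j :: real vec"
        have uc: "?u \<in> carrier_vec n" by simp
        have "P *\<^sub>v ?u \<in> W" unfolding Weq using ij ijn by auto
        then have "A *\<^sub>v (P *\<^sub>v ?u) = 0\<^sub>v n" by (simp add: W_def)
        moreover have "(Q * A * P) *\<^sub>v ?u = Q *\<^sub>v (A *\<^sub>v (P *\<^sub>v ?u))"
          using assoc_mult_mat_vec[OF mult_carrier_mat[OF Q A] P uc]
            assoc_mult_mat_vec[OF Q A mult_mat_vec_carrier[OF P uc]] by simp
        ultimately have "(Q * A * P) *\<^sub>v ?u = 0\<^sub>v n" using mat_mult_zero_vec[OF Q] by simp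
        then have "((Q * A * P) *\<^sub>v ?u) $ i = 0" using ijn by simp
        then show ?thesis using ijn Q A P by (simp add: scalar_prod_right_unit[of j n])
      qed
      finally show "quadratic_mat d X1 (Re w) ((cmod w)\<^sup>2) $$ (i, j) = 0\<^sub>m d d $$ (i, j)" using ij by simp
    qed (use Xc(1) in \<open>auto simp: quadratic_mat_def\<close>)
    then have det1: "\<bar>det X1\<bar> = cmod w ^ d" by (rule det_annihilated_by_quadratic[OF Xc(1)])
    have detQP: "det Q * det P = 1" using det_mult[OF Q P] PQ(2) by simp
    have "det T = det Q * det X * det P" unfolding T_def using Q X P by (simp add: det_mult[of _ n])
    then have "det T = det X" using detQP by (simp add: mult.commute mult.left_commute)
    moreover have "det T = det X1 * det X2"
      unfolding T by (rule det_four_block_mat_lower_left_zero[OF Xc(1,2) refl Xc(3)])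
    ultimately have detX: "det X = det X1 * det X2" by simp
    have comm2: "\<forall>h\<in>carrier H. X2 * D h = D h * X2"
    proof
      fix h assume h: "h \<in> carrier H"
      have "T * (Q * \<mu> h * P) = (Q * \<mu> h * P) * T"
        unfolding T_def conjugate_mult[OF P Q PQ(1) X \<mu>c[OF h], symmetric]
          conjugate_mult[OF P Q PQ(1) \<mu>c[OF h] X, symmetric] using comm h by simp
      then have eq: "four_block_mat (X1 * A1 h) (X1 * B h + X3 * D h) (0\<^sub>m e d) (X2 * D h) =
          four_block_mat (A1 h * X1) (A1 h * X3 + B h * X2) (0\<^sub>m e d) (D h * X2)"
        unfolding T form[rule_format, OF h]
          mult_block_upper_triangular[OF Xc A1c[OF h] B[rule_format, OF h] Dc[OF h]]
          mult_block_upper_triangular[OF A1c[OF h] B[rule_format, OF h] Dc[OF h] Xc] .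
      have c: "X1 * A1 h \<in> carrier_mat d d" "X1 * B h + X3 * D h \<in> carrier_mat d e" "X2 * D h \<in> carrier_mat e e"
          "A1 h * X1 \<in> carrier_mat d d" "A1 h * X3 + B h * X2 \<in> carrier_mat d e" "D h * X2 \<in> carrier_mat e e"
        using Xc A1c[OF h] B h Dc[OF h] by auto
      show "X2 * D h = D h * X2"
        using four_block_mat_blocks(3)[OF c(1,2) zero_carrier_mat c(3)]
          four_block_mat_blocks(3)[OF c(4,5) zero_carrier_mat c(6)] eq by metis
    qed
    have Nd: "N dvd d" using dvdN W d by blast
    have dvd2: "\<forall>W2. invariant_subspace H e D W2 \<longrightarrow> N dvd sdim e W2"
    proof (intro allI impI)
      fix W2 assume W2: "invariant_subspace H e D W2"
      define M2 :: "real mat" where "M2 = proj_last d e"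
      have M2: "M2 \<in> carrier_mat e n" unfolding M2_def n by simp
      define L where "L = M2 * Q"
      have L: "L \<in> carrier_mat e n" using M2 Q by (simp add: L_def)
      have Lu: "L *\<^sub>v u = M2 *\<^sub>v (Q *\<^sub>v u)" if "u \<in> carrier_vec n" for u
        unfolding L_def by (rule assoc_mult_mat_vec[OF M2 Q that])
      \<comment> \<open>The preimage of \<open>W2\<close> under the projection to the quotient. It
        is invariant of dimension \<open>sdim e W2 + d\<close>, and \<open>N\<close> divides both
        this number and d.\<close>
      define W3 where "W3 = {u \<in> carrier_vec n. L *\<^sub>v u \<in> W2}"
      have W2c: "b \<in> carrier_vec e" if "b \<in> W2" for b
        using W2 that by (auto simp: invariant_subspace_def subspace_iff)
      have sub3: "VectorSpace.subspace class_ring W3 (module_vec TYPE(real) n)"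
        using W2 L mat_mult_zero_vec[OF L] unfolding W3_def invariant_subspace_def subspace_iff
        by (auto simp: mult_add_distrib_mat_vec[OF L] mult_mat_vec[OF L])
      have act: "L *\<^sub>v (\<mu> h *\<^sub>v u) = D h *\<^sub>v (L *\<^sub>v u)" if h: "h \<in> carrier H" and u: "u \<in> carrier_vec n" for h u
      proof -
        define y where "y = Q *\<^sub>v u"
        have y: "y \<in> carrier_vec (d + e)" using Q u n by (simp add: y_def)
        define a where "a = vec_first y d"
        define b where "b = vec_last y e"
        have ab: "y = a @\<^sub>v b" "a \<in> carrier_vec d" "b \<in> carrier_vec e"
          using vec_first_last_append[OF y] by (auto simp: a_def b_def)
        have yc: "y \<in> carrier_vec n" using y n by simp
        have "u = P *\<^sub>v y" unfolding y_def using assoc_mult_mat_vec[OF P Q u] PQ u by simp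
        then have "Q *\<^sub>v (\<mu> h *\<^sub>v u) = (Q * \<mu> h * P) *\<^sub>v y"
          using assoc_mult_mat_vec[OF mult_carrier_mat[OF Q \<mu>c[OF h]] P yc]
            assoc_mult_mat_vec[OF Q \<mu>c[OF h] mult_mat_vec_carrier[OF P yc]] by simp
        also have "\<dots> = (A1 h *\<^sub>v a + B h *\<^sub>v b) @\<^sub>v (0\<^sub>m e d *\<^sub>v a + D h *\<^sub>v b)"
          unfolding form[rule_format, OF h] ab(1)
          by (rule four_block_mat_mult_vec[OF A1c[OF h] B[rule_format, OF h] zero_carrier_mat Dc[OF h] ab(2,3)])
        finally have QQ: "Q *\<^sub>v (\<mu> h *\<^sub>v u) = (A1 h *\<^sub>v a + B h *\<^sub>v b) @\<^sub>v (0\<^sub>m e d *\<^sub>v a + D h *\<^sub>v b)" .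
        have c1: "A1 h *\<^sub>v a + B h *\<^sub>v b \<in> carrier_vec d"
          by (rule add_carrier_vec[OF mult_mat_vec_carrier[OF A1c[OF h] ab(2)]
                mult_mat_vec_carrier[OF B[rule_format, OF h] ab(3)]])
        have c2: "0\<^sub>m e d *\<^sub>v a + D h *\<^sub>v b \<in> carrier_vec e"
          by (rule add_carrier_vec[OF mult_mat_vec_carrier[OF zero_carrier_mat ab(2)]
                mult_mat_vec_carrier[OF Dc[OF h] ab(3)]])
        have "M2 *\<^sub>v (Q *\<^sub>v (\<mu> h *\<^sub>v u)) = 0\<^sub>m e d *\<^sub>v a + D h *\<^sub>v b"
          unfolding QQ M2_def by (rule proj_last_append[OF c1 c2])
        also have "\<dots> = D h *\<^sub>v b" using Dc[OF h] ab by (simp add: zero_mat_mult_vec)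
        also have "b = M2 *\<^sub>v (Q *\<^sub>v u)"
          unfolding M2_def y_def[symmetric] ab(1) using ab(2,3) by (simp add: proj_last_append)
        finally show ?thesis using Lu[OF u] Lu[of "\<mu> h *\<^sub>v u"] \<mu>c[OF h] u by simp
      qed
      have inv3: "invariant_subspace H n \<mu> W3"
        unfolding invariant_subspace_def
      proof (intro conjI ballI sub3)
        fix h u assume h: "h \<in> carrier H" and u: "u \<in> W3"
        then have "D h *\<^sub>v (L *\<^sub>v u) \<in> W2" using W2 by (auto simp: W3_def invariant_subspace_def)
        then show "\<mu> h *\<^sub>v u \<in> W3" using act[OF h] u \<mu>c[OF h] by (auto simp: W3_def)
      qed
      have im: "(*\<^sub>v) L ` W3 = W2"
      proof
        show "(*\<^sub>v) L ` W3 \<subseteq> W2" by (auto simp: W3_def)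
        show "W2 \<subseteq> (*\<^sub>v) L ` W3"
        proof
          fix b assume b: "b \<in> W2"
          have y: "0\<^sub>v d @\<^sub>v b \<in> carrier_vec n" using W2c[OF b] n by simp
          have Pu: "P *\<^sub>v (0\<^sub>v d @\<^sub>v b) \<in> carrier_vec n" using P y by simp
          have "Q *\<^sub>v (P *\<^sub>v (0\<^sub>v d @\<^sub>v b)) = 0\<^sub>v d @\<^sub>v b"
            using assoc_mult_mat_vec[OF Q P y] PQ y by simp
          then have "L *\<^sub>v (P *\<^sub>v (0\<^sub>v d @\<^sub>v b)) = b"
            unfolding Lu[OF Pu] M2_def using W2c[OF b] by (simp add: proj_last_append)
          then show "b \<in> (*\<^sub>v) L ` W3" using Pu b by (intro image_eqI[of _ _ "P *\<^sub>v (0\<^sub>v d @\<^sub>v b)"]) (auto simp: W3_def)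
        qed
      qed
      have ker: "{u \<in> W3. L *\<^sub>v u = 0\<^sub>v e} = W"
      proof (intro Set.set_eqI iffI)
        fix u assume "u \<in> {u \<in> W3. L *\<^sub>v u = 0\<^sub>v e}"
        then have u: "u \<in> carrier_vec n" "L *\<^sub>v u = 0\<^sub>v e" by (auto simp: W3_def)
        have y: "Q *\<^sub>v u \<in> carrier_vec n" using Q u by simp
        have "(Q *\<^sub>v u) $ j = 0" if "j < n" "d \<le> j" for j
        proof -
          have "(M2 *\<^sub>v (Q *\<^sub>v u)) $ (j - d) = (Q *\<^sub>v u) $ j"
            unfolding M2_def using proj_last_index[of "Q *\<^sub>v u" d e "j - d"] y that n by simp
          then show ?thesis using u(2) Lu[OF u(1)] that n by simp
        qed
        moreover have "u = P *\<^sub>v (Q *\<^sub>v u)" using assoc_mult_mat_vec[OF P Q u(1)] PQ u by simp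
        ultimately show "u \<in> W" unfolding Weq using y by blast
      next
        fix u assume "u \<in> W"
        then obtain v where v: "u = P *\<^sub>v v" "v \<in> carrier_vec n" "\<forall>j<n. d \<le> j \<longrightarrow> v $ j = 0"
          unfolding Weq by blast
        have u: "u \<in> carrier_vec n" using v P by simp
        have "Q *\<^sub>v u = v" using v assoc_mult_mat_vec[OF Q P v(2)] PQ by simp
        then have "L *\<^sub>v u = M2 *\<^sub>v v" using Lu[OF u] by simp
        also have "\<dots> = 0\<^sub>v e"
        proof (rule eq_vecI)
          fix i assume "i < dim_vec (0\<^sub>v e :: real vec)"
          then show "(M2 *\<^sub>v v) $ i = 0\<^sub>v e $ i"
            unfolding M2_def using proj_last_index[of v d e i] v n by simp
        qed (use M2 in simp)
        finally show "u \<in> {u \<in> W3. L *\<^sub>v u = 0\<^sub>v e}"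
          using u W2 by (auto simp: W3_def invariant_subspace_def subspace_iff)
      qed
      have "sdim n W3 = sdim e W2 + d"
        using sdim_mat_image[OF sub3 L] im ker d by simp
      moreover have "N dvd sdim n W3" using dvdN inv3 by blast
      ultimately show "N dvd sdim e W2" using Nd by (simp add: dvd_add_left_iff)
    qed
    obtain ls where ls: "length ls * N = e" "\<forall>z\<in>set ls. eigenvalue (map_mat complex_of_real X2) z"
        "prod_list (map cmod ls) ^ N = \<bar>det X2\<bar>"
      using less.IH[OF en D Xc(3) comm2 dvd2] by blast
    have ev: "eigenvalue (map_mat complex_of_real X) z" if "z \<in> set ls" for z
    proof -
      have "map_mat complex_of_real T = four_block_mat (map_mat of_real X1) (map_mat of_real X3) (0\<^sub>m e d) (map_mat of_real X2)"
        unfolding T using Xc by (intro eq_matI) auto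
      moreover have "eigenvalue (four_block_mat (map_mat complex_of_real X1) (map_mat of_real X3) (0\<^sub>m e d) (map_mat of_real X2)) z"
        by (rule eigenvalue_block_triangular) (use Xc ls(2) that in auto)
      moreover have "map_mat complex_of_real T = map_mat of_real Q * map_mat of_real X * map_mat of_real P"
        unfolding T_def map_mat_complex_mult[OF mult_carrier_mat[OF Q X] P] map_mat_complex_mult[OF Q X] ..
      ultimately have "eigenvalue (map_mat complex_of_real Q * map_mat of_real X * map_mat of_real P) z" by simp
      moreover have "map_mat complex_of_real (1\<^sub>m n) = 1\<^sub>m n" by (intro eq_matI) auto
      ultimately show ?thesis
        by (intro eigenvalue_similar[of "map_mat complex_of_real X" n "map_mat of_real P" "map_mat of_real Q"])
           (use X P Q PQ map_mat_complex_mult[OF P Q] map_mat_complex_mult[OF Q P] in auto)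
    qed
    obtain q where q: "d = N * q" using Nd by (auto simp: dvd_def)
    show ?thesis
    \<comment> \<open>The kernel contributes |w|^d with d = N q to the determinant, which is the
      N-th power of |w|^q. So q copies of w represent it, whatever the multiplicities of w and its
      conjugate are.\<close>
    proof (intro exI[of _ "replicate q w @ ls"] conjI)
      show "length (replicate q w @ ls) * N = n" using ls(1) q n by (simp add: algebra_simps)
      show "\<forall>z\<in>set (replicate q w @ ls). eigenvalue (map_mat complex_of_real X) z" using ev w by auto
      have "prod_list (map cmod (replicate q w @ ls)) ^ N = cmod w ^ d * \<bar>det X2\<bar>"
        using ls(3) by (simp add: q power_mult_distrib power_mult[symmetric] mult.commute)
      then show "prod_list (map cmod (replicate q w @ ls)) ^ N = \<bar>det X\<bar>"
        using det1 detX by (simp add: abs_mult)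
    qed
  qed
qed

section \<open>Multiples of a representation and divisibility of dimensions\<close>

lemma representation_block_diag:
  fixes A B :: "'h \<Rightarrow> 'a::field mat"
  assumes A: "representation H d A" and B: "representation H e B"
  shows "representation H (d + e) (\<lambda>h. four_block_mat (A h) (0\<^sub>m d e) (0\<^sub>m e d) (B h))"
proof -
  have c: "A h \<in> carrier_mat d d" "B h \<in> carrier_mat e e" if "h \<in> carrier H" for h
    using A B that by (auto simp: representation_iff)
  show ?thesis
    unfolding representation_iff
  proof (intro conjI ballI)
    fix h assume h: "h \<in> carrier H"
    show "four_block_mat (A h) (0\<^sub>m d e) (0\<^sub>m e d) (B h) \<in> carrier_mat (d + e) (d + e)"
      using c[OF h] by auto
    show "det (four_block_mat (A h) (0\<^sub>m d e) (0\<^sub>m e d) (B h)) \<noteq> 0"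
      using A B h unfolding det_block_diag[OF c[OF h]] by (auto simp: representation_iff)
  next
    fix g h assume g: "g \<in> carrier H" and h: "h \<in> carrier H"
    show "four_block_mat (A (g \<otimes>\<^bsub>H\<^esub> h)) (0\<^sub>m d e) (0\<^sub>m e d) (B (g \<otimes>\<^bsub>H\<^esub> h)) =
        four_block_mat (A g) (0\<^sub>m d e) (0\<^sub>m e d) (B g) * four_block_mat (A h) (0\<^sub>m d e) (0\<^sub>m e d) (B h)"
      unfolding mult_block_upper_triangular[OF c(1)[OF g] zero_carrier_mat c(2)[OF g] c(1)[OF h] zero_carrier_mat c(2)[OF h]]
      using A B g h
      by (simp add: representation_iff right_mult_zero_mat[OF c(1)[OF g]] left_mult_zero_mat[OF c(2)[OF h]])
  qed
qed

lemma representation_cong: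
  assumes "\<And>h. h \<in> carrier H \<Longrightarrow> \<rho> h = \<sigma> h" "group H" "representation H n \<rho>"
  shows "representation H n \<sigma>"
proof -
  interpret group H by fact
  show ?thesis using assms(1,3) unfolding representation_iff by (metis m_closed)
qed

lemma representation_direct_sum:
  assumes H: "group H" and "list_all2 (representation H) ds \<sigma>s"
  shows "representation H (sum_list ds) (direct_sum_rep \<sigma>s)"
  using assms(2)
proof (induction rule: list_all2_induct)
  case Nil
  then show ?case by (auto simp: representation_iff direct_sum_rep_def)
next
  case (Cons d ds \<sigma> \<sigma>s)
  have c: "\<sigma> h \<in> carrier_mat d d" "direct_sum_rep \<sigma>s h \<in> carrier_mat (sum_list ds) (sum_list ds)"
    if "h \<in> carrier H" for h
    using Cons.IH Cons(1) that by (auto simp: representation_iff)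
  have "representation H (d + sum_list ds)
      (\<lambda>h. four_block_mat (\<sigma> h) (0\<^sub>m d (sum_list ds)) (0\<^sub>m (sum_list ds) d) (direct_sum_rep \<sigma>s h))"
    by (rule representation_block_diag[OF Cons(1) Cons.IH])
  then have "representation H (d + sum_list ds) (direct_sum_rep (\<sigma> # \<sigma>s))"
    by (rule representation_cong[OF _ H, rotated])
       (simp add: direct_sum_rep_Cons Let_def carrier_matD[OF c(1)] carrier_matD[OF c(2)])
  then show ?case by simp
qed

lemma representation_multiple:
  assumes "group H" "representation H n \<rho>"
  shows "representation H (m * n) (direct_sum_rep (replicate m \<rho>))"
proof -
  have "list_all2 (representation H) (replicate m n) (replicate m \<rho>)"
    using assms(2) by (simp add: list_all2_conv_all_nth)
  from representation_direct_sum[OF assms(1) this] show ?thesis by (simp add: sum_list_replicate)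
qed

text \<open>Splitting off one copy writes the dimension as a sum of two, each divisible by
  \<open>N\<close>.\<close>

lemma sdim_dvd_multiple:
  fixes \<mu> :: "'h \<Rightarrow> 'a::field mat"
  assumes H: "group H" and \<mu>: "representation H n \<mu>"
    and dvd: "\<And>W. invariant_subspace H n \<mu> W \<Longrightarrow> N dvd sdim n W"
  shows "invariant_subspace H (m * n) (direct_sum_rep (replicate m \<mu>)) W \<Longrightarrow> N dvd sdim (m * n) W"
proof (induction m arbitrary: W)
  case 0
  then have "W = {0\<^sub>v 0}" by (auto simp: invariant_subspace_def subspace_iff intro!: eq_vecI)
  then show ?case using sdim_zero[of 0, where ?'a = 'a] by simp
next
  case (Suc m)
  let ?\<sigma> = "direct_sum_rep (replicate m \<mu>)"
  have c: "\<mu> h \<in> carrier_mat n n" "?\<sigma> h \<in> carrier_mat (m * n) (m * n)" if "h \<in> carrier H" for h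
    using \<mu> representation_multiple[OF H \<mu>] that by (auto simp: representation_iff)
  have "direct_sum_rep (replicate (Suc m) \<mu>) h =
      four_block_mat (\<mu> h) (0\<^sub>m n (m * n)) (0\<^sub>m (m * n) n) (?\<sigma> h)" if "h \<in> carrier H" for h
    using carrier_matD[OF c(1)[OF that]] carrier_matD[OF c(2)[OF that]] by (simp add: direct_sum_rep_Cons Let_def)
  then have "invariant_subspace H (n + m * n) (\<lambda>h. four_block_mat (\<mu> h) (0\<^sub>m n (m * n)) (0\<^sub>m (m * n) n) (?\<sigma> h)) W"
    using Suc.prems by (simp add: invariant_subspace_def)
  note summands = invariant_subspace_block_diag[OF c this]
  show ?case using dvd[OF summands(1)] Suc.IH[OF summands(2)] summands(3) by simp
qed

lemma map_mat_direct_sum: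
  "map_mat real_of_rat (direct_sum_rep (replicate m \<rho>) h) = direct_sum_rep (replicate m (real_extension \<rho>)) h"
proof (induction m)
  case 0
  then show ?case by (auto simp: direct_sum_rep_def)
next
  case (Suc m)
  let ?A = "\<rho> h" and ?D = "direct_sum_rep (replicate m \<rho>) h"
  have "map_mat real_of_rat (direct_sum_rep (replicate (Suc m) \<rho>) h) =
      four_block_mat (map_mat of_rat ?A) (0\<^sub>m (dim_row ?A) (dim_col ?D)) (0\<^sub>m (dim_row ?D) (dim_col ?A)) (map_mat of_rat ?D)"
    by (intro eq_matI) (auto simp: direct_sum_rep_Cons Let_def)
  moreover have "dim_row (direct_sum_rep (replicate m (real_extension \<rho>)) h) = dim_row ?D"
      "dim_col (direct_sum_rep (replicate m (real_extension \<rho>)) h) = dim_col ?D"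
    unfolding Suc.IH[symmetric] by simp_all
  ultimately show ?case
    by (simp add: direct_sum_rep_Cons Let_def real_extension_def[of \<rho> h] Suc.IH)
qed

text \<open>Transported to the direct sum, the dimension of \<open>W\<close> becomes a sum of
  degrees of summands, all of which are \<open>N\<close>.\<close>

lemma sdim_dvd_of_equal_degrees:
  fixes \<rho> :: "'h \<Rightarrow> 'a::field mat"
  assumes rep: "representation H n \<rho>"
    and irr: "list_all2 (irreducible_rep H) ds \<sigma>s" and n: "sum_list ds = n"
    and P: "P \<in> carrier_mat n n" "det P \<noteq> 0"
    and split: "\<And>h. h \<in> carrier H \<Longrightarrow> \<rho> h * P = P * direct_sum_rep \<sigma>s h"
    and N: "\<forall>d\<in>set ds. d = N" and W: "invariant_subspace H n \<rho> W"
  shows "N dvd sdim n W"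
proof -
  let ?inv = "invariant_subspace H n (direct_sum_rep \<sigma>s)"
  obtain J where J: "\<And>W. ?inv W \<Longrightarrow> J W \<subseteq> {..<length ds}"
      "\<And>W. ?inv W \<Longrightarrow> sdim n W = (\<Sum>j\<in>J W. ds ! j)"
      "\<And>W W'. ?inv W \<Longrightarrow> ?inv W' \<Longrightarrow> W \<subseteq> W' \<Longrightarrow> J W \<subseteq> J W'"
    using invariant_subspace_dimension_filtration[OF irr] unfolding n by blast
  have \<rho>c: "\<rho> h \<in> carrier_mat n n" if "h \<in> carrier H" for h using rep that by (simp add: representation_iff)
  have \<sigma>c: "direct_sum_rep \<sigma>s h \<in> carrier_mat n n" if "h \<in> carrier H" for h
    using irreducible_rep_carrier[OF irr that] n by simp
  obtain R where R: "R \<in> carrier_mat n n" "P * R = 1\<^sub>m n" "R * P = 1\<^sub>m n"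
    using det_inverse_exists[OF P] by metis
  have Wc: "w \<in> carrier_vec n" if "w \<in> W" for w
    using W that by (auto simp: invariant_subspace_def subspace_iff)
  have inv: "?inv ((*\<^sub>v) R ` W)"
  proof (rule invariant_subspace_image[OF W R(1)])
    fix h w assume h: "h \<in> carrier H" and w: "w \<in> W"
    note ac = assoc_mult_mat[of _ n n _ n _ n]
    have "R * \<rho> h = R * (\<rho> h * (P * R))" using R \<rho>c[OF h] by simp
    also have "\<dots> = R * (\<rho> h * P) * R" using R(1) \<rho>c[OF h] P by (simp add: ac)
    also have "\<dots> = (R * P) * direct_sum_rep \<sigma>s h * R"
      unfolding split[OF h] using R(1) P \<sigma>c[OF h] by (simp add: ac)
    finally have "R * \<rho> h = direct_sum_rep \<sigma>s h * R" using R \<sigma>c[OF h] by simp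
    then show "R *\<^sub>v (\<rho> h *\<^sub>v w) = direct_sum_rep \<sigma>s h *\<^sub>v (R *\<^sub>v w)"
      using assoc_mult_mat_vec[OF R(1) \<rho>c[OF h] Wc[OF w]] assoc_mult_mat_vec[OF \<sigma>c[OF h] R(1) Wc[OF w]] by simp
  qed
  have "sdim n ((*\<^sub>v) R ` W) = sdim n W"
  proof (rule sdim_mat_image_inj[OF _ R(1)])
    show "VectorSpace.subspace class_ring W (module_vec TYPE('a) n)"
      using W by (simp add: invariant_subspace_def)
    fix w assume w: "w \<in> W" "R *\<^sub>v w = 0\<^sub>v n"
    have "P *\<^sub>v (R *\<^sub>v w) = 0\<^sub>v n" using w(2) mat_mult_zero_vec[OF P(1)] by simp
    then show "w = 0\<^sub>v n" using assoc_mult_mat_vec[OF P(1) R(1) Wc[OF w(1)]] R(2) Wc[OF w(1)] by simp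
  qed
  then have "sdim n W = (\<Sum>j\<in>J ((*\<^sub>v) R ` W). ds ! j)" using J(2)[OF inv] by simp
  also have "\<dots> = (\<Sum>j\<in>J ((*\<^sub>v) R ` W). N)" using J(1)[OF inv] N by (intro sum.cong) auto
  finally show ?thesis by simp
qed

lemma complex_of_real_of_rat: "complex_of_real (of_rat q) = of_rat q"
  by (cases q) (simp add: of_rat_rat)

lemma components_exceed_of_hyperbolic:
  fixes \<rho> :: "'h \<Rightarrow> rat mat"
  assumes m: "m \<ge> 1" and H: "group H" "finite (carrier H)" and irr\<rho>: "irreducible_rep H n \<rho>"
    and C: "C \<in> carrier (GL (m * n))" "integer_like C" "c_hyperbolic c C"
    and comm: "\<forall>h \<in> carrier H. C * multiple_rep m \<rho> h = multiple_rep m \<rho> h * C"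
  shows "\<exists>k. splits_in_components H n (real_extension \<rho>) k \<and> c < m * k"
proof -
  have rep: "representation H n \<rho>" and n0: "n > 0" using irr\<rho> by (auto simp: irreducible_rep_iff)
  note repR = real_extension_representation[OF rep]
  obtain ds \<sigma>s P where irr: "list_all2 (irreducible_rep H) ds \<sigma>s" and n: "sum_list ds = n"
    and P: "P \<in> carrier_mat n n" "det P \<noteq> 0"
    and split: "\<And>h. h \<in> carrier H \<Longrightarrow> real_extension \<rho> h * P = P * direct_sum_rep \<sigma>s h"
    using maschke[OF H repR] by blast
  obtain N where N: "N > 0" "\<forall>d\<in>set ds. d = N"
    by (rule real_components_equal_degree[OF H irr\<rho> irr n P split]) (assumption | rule that)+
  define k where "k = length ds"
  have nk: "n = k * N"
  proof -
    have "ds = replicate k N" using N(2) unfolding k_def by (metis replicate_length_same)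
    then have "sum_list ds = k * N" by (simp add: sum_list_replicate)
    then show ?thesis using n by simp
  qed
  have "list_all2 (representation H) ds \<sigma>s"
    by (rule list_all2_mono[OF irr]) (simp add: irreducible_rep_iff)
  then have rep\<sigma>: "representation H n (direct_sum_rep \<sigma>s)" using representation_direct_sum[OF H(1)] n by blast
  have splits: "splits_in_components H n (real_extension \<rho>) k"
    unfolding splits_in_components_def equivalent_rep_def
  proof (intro exI[of _ \<sigma>s] conjI ballI bexI[of _ P])
    show "length \<sigma>s = k" using list_all2_lengthD[OF irr] by (simp add: k_def)
    show "\<exists>d. irreducible_rep H d \<sigma>" if "\<sigma> \<in> set \<sigma>s" for \<sigma>
      using irr that by (metis in_set_conv_nth list_all2_conv_all_nth)
    show "P \<in> carrier (GL n)" using P by (simp add: GL_iff)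
  qed (use repR rep\<sigma> split in auto)
  have "c < m * k"
  proof (rule ccontr)
    assume "\<not> ?thesis"
    then have le: "m * k \<le> c" by simp
    let ?X = "map_mat real_of_rat C"
    have Cc: "C \<in> carrier_mat (m * n) (m * n)" using C(1) by (simp add: GL_iff)
    have X: "?X \<in> carrier_mat (m * n) (m * n)" using Cc by simp
    have mc: "multiple_rep m \<rho> h \<in> carrier_mat (m * n) (m * n)" if "h \<in> carrier H" for h
      using representation_multiple[OF H(1) rep] that by (auto simp: multiple_rep_def representation_iff)
    have "\<forall>h\<in>carrier H. ?X * direct_sum_rep (replicate m (real_extension \<rho>)) h =
        direct_sum_rep (replicate m (real_extension \<rho>)) h * ?X"
    proof
      fix h assume h: "h \<in> carrier H"
      show "?X * direct_sum_rep (replicate m (real_extension \<rho>)) h =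
        direct_sum_rep (replicate m (real_extension \<rho>)) h * ?X"
        using map_mat_of_rat_mult[OF Cc mc[OF h]] map_mat_of_rat_mult[OF mc[OF h] Cc] comm h
        by (simp add: map_mat_direct_sum[symmetric] multiple_rep_def)
    qed
    moreover have "\<forall>W. invariant_subspace H (m * n) (direct_sum_rep (replicate m (real_extension \<rho>))) W \<longrightarrow>
        N dvd sdim (m * n) W"
      using sdim_dvd_multiple[OF H(1) repR] sdim_dvd_of_equal_degrees[OF repR irr n P split N(2)] by blast
    ultimately obtain ls where ls: "length ls * N = m * n"
        "\<forall>z\<in>set ls. eigenvalue (map_mat complex_of_real ?X) z" "prod_list (map cmod ls) ^ N = \<bar>det ?X\<bar>"
      using eigenvalue_list_of_norm_det[OF H(1) representation_multiple[OF H(1) repR] X] by blast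
    \<comment> \<open>Since n = k N, the list has exactly m k entries. The N-th power of the
      absolute value of its product is |det| = 1, hence so is that absolute value.\<close>
    have len: "length ls = m * k" using ls(1) nk N(1) by simp
    have "\<bar>det ?X\<bar> = 1" using C(2) by (auto simp: integer_like_def)
    moreover have "0 \<le> prod_list (map cmod ls)" by (rule prod_list_nonneg) auto
    ultimately have "prod_list (map cmod ls) = 1"
      using ls(3) N(1) by (intro power_eq_imp_eq_base[of _ N 1]) auto
    moreover have "cmod (prod_list ls) = prod_list (map cmod ls)" by (induction ls) (simp_all add: norm_mult)
    ultimately have prod: "cmod (prod_list ls) = 1" by simp
    have "map_mat complex_of_real ?X = map_mat of_rat C"
      by (intro eq_matI) (auto simp: complex_of_real_of_rat)
    then have "set ls \<subseteq> spectrum (map_mat of_rat C)" using ls(2) by (auto simp: spectrum_def)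
    moreover have "1 \<le> length ls" using len m n0 nk by (cases "m * k") auto
    ultimately show False using C(3) prod len le unfolding c_hyperbolic_def by auto
  qed
  then show ?thesis using splits by blast
qed

section \<open>Units of the commutant\<close>

text \<open>Pigeonhole form of Minkowski's theorem for the lattice of values of integral polynomials.\<close>

lemma small_values_of_integral_polynomial:
  fixes A :: "real set"
  assumes A: "finite A" "card A = k" "k \<ge> 1"
  obtains K :: real where "K \<ge> 1"
    "\<And>e. (\<And>x. x \<in> A \<Longrightarrow> e x > 0) \<Longrightarrow> (\<Prod>x\<in>A. e x) = 1 \<Longrightarrow>
       \<exists>q :: nat \<Rightarrow> int. (\<exists>l<k. q l \<noteq> 0) \<and> (\<forall>x\<in>A. \<bar>\<Sum>l<k. of_int (q l) * x ^ l\<bar> \<le> K * e x)"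
proof -
  \<comment> \<open>A polynomial with coefficients in {0..T} takes values of absolute value at most
    M T on \<open>A\<close>. The summand 1 ensures that \<open>M\<close> is at least 1.\<close>
  define M where "M = 1 + (\<Sum>x\<in>A. \<Sum>l<k. \<bar>x\<bar> ^ l)"
  have M1: "M \<ge> 1" unfolding M_def by (simp add: sum_nonneg)
  define K where "K = 4 * M"
  have K1: "K \<ge> 1" using M1 by (simp add: K_def)
  have "\<exists>q :: nat \<Rightarrow> int. (\<exists>l<k. q l \<noteq> 0) \<and> (\<forall>x\<in>A. \<bar>\<Sum>l<k. of_int (q l) * x ^ l\<bar> \<le> K * e x)"
    if e: "\<And>x. x \<in> A \<Longrightarrow> e x > 0" "(\<Prod>x\<in>A. e x) = 1" for e
  proof -
    \<comment> \<open>\<open>T\<close> is the largest coefficient allowed. It is chosen so that each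
      \<open>y x\<close> below is at least 1, which absorbs rounding: at most 2 y + 2 boxes are at
      most 4 y.\<close>
    define T where "T = nat \<lceil>\<Sum>x\<in>A. 4 * e x\<rceil>"
    have T: "real T \<ge> 4 * e x" if "x \<in> A" for x
    proof -
      have "4 * e x \<le> (\<Sum>x\<in>A. 4 * e x)"
        using e(1) by (intro member_le_sum[OF that _ A(1)]) (auto simp: less_imp_le)
      then show ?thesis unfolding T_def by linarith
    qed
    define Q where "Q = PiE {..<k} (\<lambda>_. {0..int T})"
    define ev where "ev q x = (\<Sum>l<k. of_int (q l) * x ^ l)" for q :: "nat \<Rightarrow> int" and x :: real
    \<comment> \<open>The values at x lie in [-M T, M T] and the boxes have side K e(x), so about M
      T / (K e(x)) boxes lie on either side of 0; with K = 4 M this is y(x). Altogether there are at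
      most \<Prod> 4 y(x) = T^k boxes for (T + 1)^k polynomials, so two polynomials share a box and
      their difference is small everywhere.\<close>
    define y where "y x = real T / (4 * e x)" for x
    have y1: "y x \<ge> 1" if "x \<in> A" for x using T[OF that] e(1)[OF that] by (simp add: y_def divide_simps)
    define B where "B x = {\<lfloor>- y x\<rfloor>..\<lfloor>y x\<rfloor>}" for x
    define F where "F q = restrict (\<lambda>x. \<lfloor>ev q x / (K * e x)\<rfloor>) A" for q
    have bound: "\<bar>ev q x\<bar> \<le> M * T" if q: "q \<in> Q" and x: "x \<in> A" for q x
    proof -
      have "\<bar>ev q x\<bar> \<le> (\<Sum>l<k. \<bar>of_int (q l) * x ^ l\<bar>)" unfolding ev_def by (rule sum_abs)
      also have "\<dots> \<le> (\<Sum>l<k. real T * \<bar>x\<bar> ^ l)"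
      proof (rule sum_mono)
        fix l assume "l \<in> {..<k}"
        then have "q l \<in> {0..int T}" using q by (auto simp: Q_def PiE_def Pi_def)
        then have "\<bar>real_of_int (q l)\<bar> \<le> real T" by auto
        then show "\<bar>of_int (q l) * x ^ l\<bar> \<le> real T * \<bar>x\<bar> ^ l"
          by (simp add: abs_mult power_abs mult_right_mono)
      qed
      also have "\<dots> = real T * (\<Sum>l<k. \<bar>x\<bar> ^ l)" by (simp add: sum_distrib_left)
      also have "\<dots> \<le> real T * M"
      proof (rule mult_left_mono)
        have "(\<Sum>l<k. \<bar>x\<bar> ^ l) \<le> (\<Sum>x\<in>A. \<Sum>l<k. \<bar>x\<bar> ^ l)"
          using x A(1) by (intro member_le_sum[of x A "\<lambda>x. \<Sum>l<k. \<bar>x\<bar> ^ l"]) (auto intro: sum_nonneg)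
        then show "(\<Sum>l<k. \<bar>x\<bar> ^ l) \<le> M" by (simp add: M_def)
      qed simp
      finally show ?thesis by (simp add: mult.commute)
    qed
    have "F ` Q \<subseteq> PiE A B"
    proof
      fix g assume "g \<in> F ` Q"
      then obtain q where q: "q \<in> Q" "g = F q" by auto
      have "\<lfloor>ev q x / (K * e x)\<rfloor> \<in> B x" if x: "x \<in> A" for x
      proof -
        have ep: "e x > 0" by (rule e(1)[OF x])
        have "\<bar>ev q x / (K * e x)\<bar> = \<bar>ev q x\<bar> / (K * e x)" using ep K1 by (simp add: abs_mult)
        also have "\<dots> \<le> M * T / (K * e x)" using bound[OF q(1) x] ep K1 by (intro divide_right_mono) auto
        also have "\<dots> = y x" using M1 by (simp add: y_def K_def)
        finally have "- y x \<le> ev q x / (K * e x)" "ev q x / (K * e x) \<le> y x" by (simp_all only: abs_le_iff) linarith+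
        then show ?thesis unfolding B_def atLeastAtMost_iff by (intro conjI floor_mono)
      qed
      then show "g \<in> PiE A B" using q(2) by (auto simp: F_def)
    qed
    moreover have finB: "finite (PiE A B)" using A(1) by (intro finite_PiE) (auto simp: B_def)
    ultimately have "card (F ` Q) \<le> card (PiE A B)" by (intro card_mono)
    also have "card (PiE A B) < card Q"
    proof -
      have "real (card (B x)) \<le> 4 * y x" if "x \<in> A" for x
      proof -
        have "\<lfloor>y x\<rfloor> - \<lfloor>- y x\<rfloor> + 1 \<ge> 0" using y1[OF that] by linarith
        then have "real (card (B x)) = real_of_int (\<lfloor>y x\<rfloor> - \<lfloor>- y x\<rfloor> + 1)" by (simp add: B_def)
        also have "\<dots> \<le> 2 * y x + 2" by linarith
        finally show ?thesis using y1[OF that] by linarith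
      qed
      then have "(\<Prod>x\<in>A. real (card (B x))) \<le> (\<Prod>x\<in>A. 4 * y x)" by (intro prod_mono) auto
      also have "\<dots> = (\<Prod>x\<in>A. real T / e x)" by (intro prod.cong) (auto simp: y_def)
      also have "\<dots> = real T ^ k" using e(2) A by (simp add: prod_dividef)
      finally have "real (card (PiE A B)) \<le> real (T ^ k)" using A(1) by (simp add: card_PiE)
      moreover have "nat (int T + 1) = T + 1" by linarith
      then have "card Q = (T + 1) ^ k" by (simp add: Q_def card_PiE)
      moreover have "T ^ k < (T + 1) ^ k" using A(3) by (intro power_strict_mono) auto
      ultimately show ?thesis by linarith
    qed
    finally have "\<not> inj_on F Q" using pigeonhole[of F Q] by simp
    then obtain q1 q2 where q: "q1 \<in> Q" "q2 \<in> Q" "F q1 = F q2" "q1 \<noteq> q2" by (auto simp: inj_on_def)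
    show ?thesis
    proof (intro exI[of _ "\<lambda>l. q1 l - q2 l"] conjI ballI)
      obtain l where l: "q1 l \<noteq> q2 l" using q(4) by auto
      have "l < k"
      proof (rule ccontr)
        assume "\<not> l < k"
        then have "q1 l = undefined" "q2 l = undefined"
          using q(1,2) PiE_arb[of q1 "{..<k}" _ l] PiE_arb[of q2 "{..<k}" _ l] by (auto simp: Q_def)
        then show False using l by simp
      qed
      then show "\<exists>l<k. q1 l - q2 l \<noteq> 0" using l by auto
      fix x assume x: "x \<in> A"
      have ep: "e x > 0" by (rule e(1)[OF x])
      have "\<lfloor>ev q1 x / (K * e x)\<rfloor> = \<lfloor>ev q2 x / (K * e x)\<rfloor>"
        using fun_cong[OF q(3), of x] x by (simp add: F_def)
      then have "\<bar>ev q1 x / (K * e x) - ev q2 x / (K * e x)\<bar> \<le> 1" by linarith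
      moreover have "ev q1 x / (K * e x) - ev q2 x / (K * e x) = (ev q1 x - ev q2 x) / (K * e x)"
        by (simp add: diff_divide_distrib)
      ultimately have "\<bar>ev q1 x - ev q2 x\<bar> \<le> K * e x" using ep K1 by (simp add: divide_simps abs_mult)
      moreover have "(\<Sum>l<k. of_int (q1 l - q2 l) * x ^ l) = ev q1 x - ev q2 x"
        by (simp add: ev_def left_diff_distrib sum_subtractf)
      ultimately show "\<bar>\<Sum>l<k. of_int (q1 l - q2 l) * x ^ l\<bar> \<le> K * e x" by simp
    qed
  qed
  then show ?thesis using that[OF K1] by blast
qed

text \<open>The other factors are bounded above and the whole product is at least 1, so the factor
  at x cannot be much smaller than e(x).\<close>

lemma lower_bound_of_product:
  fixes g e :: "'x \<Rightarrow> real"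
  assumes A: "finite A" "x \<in> A" and K: "K > 0" and e: "\<And>x. x \<in> A \<Longrightarrow> e x > 0" "(\<Prod>x\<in>A. e x) = 1"
    and g: "\<And>x. x \<in> A \<Longrightarrow> g x \<ge> 0" "\<And>x. x \<in> A \<Longrightarrow> g x \<le> K * e x" "(\<Prod>x\<in>A. g x) \<ge> 1"
  shows "e x \<le> K ^ (card A - 1) * g x"
proof -
  have "1 \<le> g x * (\<Prod>y\<in>A - {x}. g y)" using g(3) prod.remove[OF A] by metis
  also have "\<dots> \<le> g x * (\<Prod>y\<in>A - {x}. K * e y)"
    using g A by (intro mult_left_mono prod_mono) auto
  also have "(\<Prod>y\<in>A - {x}. K * e y) = K ^ (card A - 1) * (\<Prod>y\<in>A - {x}. e y)"
    using A by (simp add: prod.distrib)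
  also have "(\<Prod>y\<in>A - {x}. e y) = 1 / e x"
    using prod.remove[OF A, of e] e(2) e(1)[OF A(2)] by (simp add: eq_divide_eq mult.commute)
  finally show ?thesis using e(1)[OF A(2)] by (simp add: field_simps)
qed

lemma conjugate_diag_mult:
  fixes U :: "'a::field mat"
  assumes U: "U \<in> carrier_mat n n" and V: "V \<in> carrier_mat n n" "V * U = 1\<^sub>m n"
  shows "(U * mat_diag n f * V) * (U * mat_diag n g * V) = U * mat_diag n (\<lambda>i. f i * g i) * V"
  using conjugate_mult[OF V(1) U V(2) mat_diag_dim mat_diag_dim, of f g] by simp

lemma conjugate_diag_extract:
  fixes U :: "'a::field mat"
  assumes U: "U \<in> carrier_mat n n" and V: "V \<in> carrier_mat n n" "V * U = 1\<^sub>m n"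
  shows "V * (U * mat_diag n f * V) * U = mat_diag n f"
proof -
  let ?D = "mat_diag n f"
  have D: "?D \<in> carrier_mat n n" by simp
  have UD: "U * ?D \<in> carrier_mat n n" by (rule mult_carrier_mat[OF U D])
  have "V * (U * ?D * V) * U = V * (U * ?D) * (V * U)"
    using assoc_mult_mat[OF V(1) mult_carrier_mat[OF UD V(1)] U] assoc_mult_mat[OF UD V(1) U]
      assoc_mult_mat[OF V(1) UD mult_carrier_mat[OF V(1) U]] by simp
  also have "V * (U * ?D) = (V * U) * ?D" by (rule assoc_mult_mat[OF V(1) U D, symmetric])
  finally show ?thesis unfolding V(2) left_mult_one_mat[OF D] right_mult_one_mat[OF D] .
qed

lemma prod_over_fibres:
  fixes g :: "'b \<Rightarrow> 'a::comm_semiring_1" and f :: "nat \<Rightarrow> 'b"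
  assumes "\<And>i. i < n \<Longrightarrow> card {j. j < n \<and> f j = f i} = N"
  shows "(\<Prod>i<n. g (f i)) = (\<Prod>x\<in>f ` {..<n}. g x) ^ N"
proof -
  have "(\<Prod>i<n. g (f i)) = (\<Prod>x\<in>f ` {..<n}. \<Prod>i\<in>{i \<in> {..<n}. f i = x}. g (f i))"
    by (rule prod.image_gen) simp
  also have "\<dots> = (\<Prod>x\<in>f ` {..<n}. g x ^ N)"
  proof (rule prod.cong[OF refl])
    fix x assume "x \<in> f ` {..<n}"
    then obtain i where i: "i < n" "x = f i" by auto
    have "{j \<in> {..<n}. f j = x} = {j. j < n \<and> f j = f i}" using i by auto
    then show "(\<Prod>j\<in>{j \<in> {..<n}. f j = x}. g (f j)) = g x ^ N"
      using assms[OF i(1)] i(2) by simp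
  qed
  finally show ?thesis by (simp add: prod_power_distrib)
qed

text \<open>Write \<alpha> = \<beta> + \<nu> E. The adjugate of \<beta> times \<beta> is \<nu> = det
  \<beta>, so \<alpha> = (1 + E adj \<beta>) \<beta>, and the quotient is integral although the
  inverse of \<beta> need not be.\<close>

lemma integer_quotient_matrix:
  fixes \<alpha> \<beta> :: "int mat"
  assumes c: "\<alpha> \<in> carrier_mat n n" "\<beta> \<in> carrier_mat n n" and d: "det \<alpha> = \<nu>" "det \<beta> = \<nu>" "\<nu> \<noteq> 0"
    and cong: "\<And>i j. i < n \<Longrightarrow> j < n \<Longrightarrow> \<alpha> $$ (i, j) mod \<nu> = \<beta> $$ (i, j) mod \<nu>"
  obtains w where "w \<in> carrier_mat n n" "w * \<beta> = \<alpha>" "det w = 1"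
proof -
  define E where "E = mat n n (\<lambda>ij. (\<alpha> $$ ij - \<beta> $$ ij) div \<nu>)"
  have E: "E \<in> carrier_mat n n" by (simp add: E_def)
  have adj: "adj_mat \<beta> \<in> carrier_mat n n" "adj_mat \<beta> * \<beta> = \<nu> \<cdot>\<^sub>m 1\<^sub>m n" using adj_mat[OF c(2)] d(2) by auto
  define w where "w = 1\<^sub>m n + E * adj_mat \<beta>"
  have EA: "E * adj_mat \<beta> \<in> carrier_mat n n" using E adj(1) by simp
  have w: "w \<in> carrier_mat n n" using EA by (simp add: w_def)
  have "w * \<beta> = \<beta> + E * (adj_mat \<beta> * \<beta>)"
    unfolding w_def add_mult_distrib_mat[OF one_carrier_mat EA c(2)] left_mult_one_mat[OF c(2)]
      assoc_mult_mat[OF E adj(1) c(2)] ..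
  also have "E * (adj_mat \<beta> * \<beta>) = \<nu> \<cdot>\<^sub>m E"
    unfolding adj(2) mult_smult_distrib[OF E one_carrier_mat] right_mult_one_mat[OF E] ..
  also have "\<beta> + \<nu> \<cdot>\<^sub>m E = \<alpha>"
  proof (rule eq_matI)
    fix i j assume "i < dim_row \<alpha>" "j < dim_col \<alpha>"
    then have ij: "i < n" "j < n" using c by auto
    have "\<nu> dvd \<alpha> $$ (i, j) - \<beta> $$ (i, j)" using cong[OF ij] by (simp add: mod_eq_dvd_iff)
    then show "(\<beta> + \<nu> \<cdot>\<^sub>m E) $$ (i, j) = \<alpha> $$ (i, j)" using ij c E by (simp add: E_def)
  qed (use c E in auto)
  finally have eq: "w * \<beta> = \<alpha>" .
  have "det w * \<nu> = \<nu>" using det_mult[OF w c(2)] eq d by simp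
  then have "det w = 1" using d(3) by simp
  then show ?thesis using that w eq by blast
qed

text \<open>Units of \<open>\<int>[Z]\<close> as in Dirichlet's theorem: quotients of elements of equal norm \<open>\<nu>\<close>
  that are congruent modulo \<open>\<nu>\<close>.\<close>

lemma commutant_units:
  fixes \<rho> :: "'h \<Rightarrow> rat mat" and Z :: "int mat" and U V :: "real mat"
  assumes irr: "irreducible_rep H n \<rho>" and Z: "Z \<in> carrier_mat n n"
    and comm: "\<And>h. h \<in> carrier H \<Longrightarrow> map_mat rat_of_int Z * \<rho> h = \<rho> h * map_mat rat_of_int Z"
    and U: "U \<in> carrier_mat n n" and V: "V \<in> carrier_mat n n" "U * V = 1\<^sub>m n" "V * U = 1\<^sub>m n"
    and diag: "map_mat real_of_int Z = U * mat_diag n f * V"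
    and mult: "\<And>i. i < n \<Longrightarrow> card {j. j < n \<and> f j = f i} = N"
    and k: "card (f ` {..<n}) = k" and x0: "x0 \<in> f ` {..<n}"
  obtains K :: real where "K \<ge> 1"
    "infinite {b :: nat. b \<ge> 1 \<and> (\<exists>(w :: int mat) (\<omega> :: real \<Rightarrow> real). w \<in> carrier_mat n n \<and> det w = 1 \<and>
       (\<forall>h \<in> carrier H. map_mat rat_of_int w * \<rho> h = \<rho> h * map_mat rat_of_int w) \<and>
       map_mat real_of_int w = U * mat_diag n (\<lambda>i. \<omega> (f i)) * V \<and>
       real b ^ (k - 1) \<le> K * \<bar>\<omega> x0\<bar> \<and> \<bar>\<omega> x0\<bar> \<le> K * real b ^ (k - 1) \<and>
       (\<forall>x \<in> f ` {..<n} - {x0}. 1 \<le> K * real b * \<bar>\<omega> x\<bar> \<and> real b * \<bar>\<omega> x\<bar> \<le> K))}"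
proof -
  define A where "A = f ` {..<n}"
  have A: "finite A" "card A = k" "x0 \<in> A" using k x0 by (auto simp: A_def)
  have k1: "k \<ge> 1" using A by (metis One_nat_def Suc_leI card_gt_0_iff empty_iff)
  have \<rho>c: "\<rho> h \<in> carrier_mat n n" if "h \<in> carrier H" for h
    using irr that by (simp add: irreducible_rep_iff representation_iff)
  obtain K where K: "K \<ge> 1"
    "\<And>e. (\<And>x. x \<in> A \<Longrightarrow> e x > 0) \<Longrightarrow> (\<Prod>x\<in>A. e x) = 1 \<Longrightarrow>
       \<exists>q :: nat \<Rightarrow> int. (\<exists>l<k. q l \<noteq> 0) \<and> (\<forall>x\<in>A. \<bar>\<Sum>l<k. of_int (q l) * x ^ l\<bar> \<le> K * e x)"
    using small_values_of_integral_polynomial[OF A(1,2) k1] by blast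
  define ev where "ev q x = (\<Sum>l<k. of_int (q l) * x ^ l)" for q :: "nat \<Rightarrow> int" and x :: real
  define \<alpha> where "\<alpha> q = mat_poly n k q Z" for q
  have \<alpha>c: "\<alpha> q \<in> carrier_mat n n" for q by (simp add: \<alpha>_def)
  have Zr: "map_mat rat_of_int Z \<in> carrier_mat n n" using Z by simp
  have \<alpha>real: "map_mat real_of_int (\<alpha> q) = U * mat_diag n (\<lambda>i. ev q (f i)) * V" for q
  proof -
    have "map_mat real_of_int (\<alpha> q) = mat_poly n k (\<lambda>l. real_of_int (q l)) (map_mat real_of_int Z)"
      unfolding \<alpha>_def by (rule of_int_hom.mat_poly_hom[OF Z])
    then show ?thesis unfolding diag mat_poly_conjugate_diag[OF U V] ev_def .
  qed
  have \<alpha>rat: "map_mat rat_of_int (\<alpha> q) = mat_poly n k (\<lambda>l. rat_of_int (q l)) (map_mat rat_of_int Z)" for q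
    unfolding \<alpha>_def by (rule of_int_hom.mat_poly_hom[OF Z])
  have \<alpha>comm: "map_mat rat_of_int (\<alpha> q) * \<rho> h = \<rho> h * map_mat rat_of_int (\<alpha> q)" if "h \<in> carrier H" for q h
    unfolding \<alpha>rat by (rule mat_poly_commute[OF Zr \<rho>c[OF that] comm[OF that]])
  have det\<alpha>: "real_of_int (det (\<alpha> q)) = (\<Prod>x\<in>A. ev q x) ^ N" for q
  proof -
    have "real_of_int (det (\<alpha> q)) = det (map_mat real_of_int (\<alpha> q))" by (rule of_int_hom.hom_det[symmetric])
    also have "\<dots> = (\<Prod>i<n. ev q (f i))" unfolding \<alpha>real by (rule det_conjugate_diag[OF U V(1,2)])
    also have "\<dots> = (\<Prod>x\<in>A. ev q x) ^ N" unfolding A_def by (rule prod_over_fibres[OF mult])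
    finally show ?thesis .
  qed
  \<comment> \<open>By Schur's lemma a singular value \<open>\<alpha> q\<close> would be zero. Then
    the polynomial, having k coefficients, would vanish at the k different eigenvalues of
    \<open>Z\<close> and so be zero.\<close>
  have det0: "det (\<alpha> q) \<noteq> 0" if q: "\<exists>l<k. q l \<noteq> 0" for q
  proof
    assume "det (\<alpha> q) = 0"
    then have "det (map_mat rat_of_int (\<alpha> q)) = 0" by (simp add: of_int_hom.hom_det)
    then have "map_mat rat_of_int (\<alpha> q) = 0\<^sub>m n n"
      by (intro schur_rational[OF irr _ \<alpha>comm]) (use \<alpha>c in auto)
    then have "map_mat rat_of_int (\<alpha> q) $$ (i, j) = (0\<^sub>m n n :: rat mat) $$ (i, j)" for i j by simp
    then have "\<alpha> q $$ (i, j) = 0" if "i < n" "j < n" for i j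
      using that \<alpha>c[of q] index_map_mat(1)[of i "\<alpha> q" j rat_of_int] by (metis carrier_matD index_zero_mat(1) of_int_eq_0_iff)
    then have "map_mat real_of_int (\<alpha> q) = 0\<^sub>m n n" using \<alpha>c[of q] by (intro eq_matI) auto
    then have "mat_diag n (\<lambda>i. ev q (f i)) = V * 0\<^sub>m n n * U"
      using conjugate_diag_extract[OF U V(1,3)] unfolding \<alpha>real by metis
    then have z: "mat_diag n (\<lambda>i. ev q (f i)) = 0\<^sub>m n n" using U V(1) by simp
    have "ev q (f i) = 0" if "i < n" for i
      using arg_cong[OF z, of "\<lambda>M. M $$ (i, i)"] that by (simp add: mat_diag_def)
    then have "(\<Sum>l<k. real_of_int (q l) * x ^ l) = 0" if "x \<in> A" for x using that by (auto simp: A_def ev_def)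
    then have "real_of_int (q l) = 0" if "l < k" for l
      using polynomial_many_roots_zero[of k A "\<lambda>l. real_of_int (q l)" l] A that by simp
    then show False using q by auto
  qed
  \<comment> \<open>The intended sizes: large at one eigenvalue and 1/b at the other k - 1, with
    product 1 as the pigeonhole lemma demands.\<close>
  define e where "e b x = (if x = x0 then real b ^ (k - 1) else 1 / real b)" for b :: nat and x
  have epos: "e b x > 0" if "b \<ge> 1" for b x using that by (simp add: e_def)
  have eprod: "(\<Prod>x\<in>A. e b x) = 1" if b: "b \<ge> 1" for b
  proof -
    have "(\<Prod>x\<in>A. e b x) = e b x0 * (\<Prod>x\<in>A - {x0}. e b x)" by (rule prod.remove[OF A(1,3)])
    also have "(\<Prod>x\<in>A - {x0}. e b x) = (1 / real b) ^ (k - 1)" using A by (simp add: e_def)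
    finally show ?thesis using b by (simp add: e_def power_one_over)
  qed
  have "\<exists>q. (\<exists>l<k. q l \<noteq> 0) \<and> (\<forall>x\<in>A. \<bar>ev q x\<bar> \<le> K * e b x)" if "b \<ge> 1" for b
    unfolding ev_def by (rule K(2)) (use epos eprod that in auto)
  then obtain q where q: "\<And>b. b \<ge> 1 \<Longrightarrow> \<exists>l<k. q b l \<noteq> 0"
      "\<And>b x. b \<ge> 1 \<Longrightarrow> x \<in> A \<Longrightarrow> \<bar>ev (q b) x\<bar> \<le> K * e b x" by metis
  define \<nu> where "\<nu> b = det (\<alpha> (q b))" for b
  have \<nu>0: "\<nu> b \<noteq> 0" if "b \<ge> 1" for b unfolding \<nu>_def by (rule det0[OF q(1)[OF that]])
  have \<nu>abs: "\<bar>real_of_int (\<nu> b)\<bar> = (\<Prod>x\<in>A. \<bar>ev (q b) x\<bar>) ^ N" for b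
    unfolding \<nu>_def det\<alpha> by (simp add: power_abs abs_prod)
  \<comment> \<open>The determinant is a nonzero integer and equals the N-th power of this product
    up to sign.\<close>
  have prod1: "(\<Prod>x\<in>A. \<bar>ev (q b) x\<bar>) \<ge> 1" if b: "b \<ge> 1" for b
  proof (rule ccontr)
    assume "\<not> ?thesis"
    then have "(\<Prod>x\<in>A. \<bar>ev (q b) x\<bar>) < 1" by simp
    moreover have "N > 0"
    proof -
      obtain i where i: "i < n" using x0 by auto
      then have "{j. j < n \<and> f j = f i} \<noteq> {}" by auto
      then have "card {j. j < n \<and> f j = f i} \<noteq> 0" by simp
      then show ?thesis using mult[OF i] by simp
    qed
    ultimately have "\<bar>real_of_int (\<nu> b)\<bar> < 1" unfolding \<nu>abs by (intro power_less_one_iff[THEN iffD2]) (auto intro: prod_nonneg)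
    then show False using \<nu>0[OF b] by linarith
  qed
  have lower: "e b x \<le> K ^ (k - 1) * \<bar>ev (q b) x\<bar>" if b: "b \<ge> 1" and x: "x \<in> A" for b x
    using lower_bound_of_product[of A x K "e b" "\<lambda>x. \<bar>ev (q b) x\<bar>"] A x K(1) epos eprod q(2) prod1 b by simp
  define B where "B = \<lceil>K ^ (k * N)\<rceil>"
  have \<nu>B: "\<bar>\<nu> b\<bar> \<le> B" if b: "b \<ge> 1" for b
  proof -
    have "(\<Prod>x\<in>A. \<bar>ev (q b) x\<bar>) \<le> (\<Prod>x\<in>A. K * e b x)" using q(2)[OF b] by (intro prod_mono) auto
    also have "\<dots> = K ^ k" using eprod[OF b] A(2) by (simp add: prod.distrib)
    finally have "\<bar>real_of_int (\<nu> b)\<bar> \<le> (K ^ k) ^ N" unfolding \<nu>abs by (intro power_mono) (auto intro: prod_nonneg)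
    then have "\<bar>real_of_int (\<nu> b)\<bar> \<le> K ^ (k * N)" by (simp add: power_mult)
    then have "real_of_int \<bar>\<nu> b\<bar> \<le> real_of_int B" unfolding B_def by linarith
    then show ?thesis by (simp only: of_int_le_iff)
  qed
  define I where "I = {..<n} \<times> {..<n}"
  \<comment> \<open>The class of b consists of the norm and the residues of the matrix modulo the
    norm. The norms are bounded independently of b, so there are finitely many classes, and some
    class contains infinitely many b.\<close>
  define c where "c b = (\<nu> b, restrict (\<lambda>ij. \<alpha> (q b) $$ ij mod \<nu> b) I)" for b
  have "c ` {1..} \<subseteq> {-B..B} \<times> PiE I (\<lambda>_. {-B..B})"
  proof
    fix y assume "y \<in> c ` {1..}"
    then obtain b where b: "b \<ge> 1" "y = c b" by auto
    have "a mod \<nu> b \<in> {-B..B}" for a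
    proof -
      have "\<bar>a mod \<nu> b\<bar> < \<bar>\<nu> b\<bar>" using \<nu>0[OF b(1)] by (rule abs_mod_less)
      then show ?thesis using \<nu>B[OF b(1)] by auto
    qed
    then show "y \<in> {-B..B} \<times> PiE I (\<lambda>_. {-B..B})" using \<nu>B[OF b(1)] b(2) by (auto simp: c_def abs_le_iff)
  qed
  moreover have "finite ({-B..B} \<times> PiE I (\<lambda>_. {-B..B}))" by (auto intro!: finite_PiE simp: I_def)
  ultimately have "finite (c ` {1..})" by (rule finite_subset)
  moreover have "infinite {1 :: nat..}" by (simp add: infinite_Ici)
  ultimately obtain b0 where b0: "b0 \<in> {1..}" "infinite {b \<in> {1..}. c b = c b0}"
    using pigeonhole_infinite[of "{1..}" c] by blast
  have b01: "b0 \<ge> 1" using b0 by simp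
  \<comment> \<open>The unit is the quotient by the element for the fixed b0. \<open>K'\<close>
    absorbs the size of that element: K and K^(k - 1) come from the upper and lower bounds, and b0^k
    bounds e(b0, x) and its inverse.\<close>
  define K' where "K' = K ^ k * real b0 ^ k"
  have Kk: "K ^ k \<ge> 1" using K(1) by simp
  have bk: "real b0 ^ k \<ge> 1" using b01 by simp
  have K'1: "K' \<ge> 1" unfolding K'_def using mult_mono[OF Kk bk] K(1) by simp
  have e0: "e b0 x \<le> real b0 ^ k" "1 \<le> real b0 ^ k * e b0 x" for x
  proof -
    have p: "real b0 ^ k = real b0 * real b0 ^ (k - 1)" using k1 by (cases k) auto
    have g: "real b0 ^ (k - 1) \<ge> 1" using b01 by simp
    have r1: "real b0 \<ge> 1" using b01 by simp
    have "real b0 ^ (k - 1) \<le> real b0 ^ k" unfolding p using mult_right_mono[OF r1, of "real b0 ^ (k - 1)"] by simp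
    moreover have "1 / real b0 \<le> 1" using r1 by simp
    ultimately show "e b0 x \<le> real b0 ^ k" using bk by (auto simp: e_def)
    have "1 \<le> real b0 ^ k * real b0 ^ (k - 1)" using mult_mono[OF bk g] b01 by simp
    moreover have "1 \<le> real b0 ^ k * (1 / real b0)" unfolding p using r1 g by simp
    ultimately show "1 \<le> real b0 ^ k * e b0 x" by (auto simp: e_def)
  qed
  let ?P = "\<lambda>(b :: nat) (w :: int mat) (\<omega> :: real \<Rightarrow> real). w \<in> carrier_mat n n \<and> det w = 1 \<and>
       (\<forall>h \<in> carrier H. map_mat rat_of_int w * \<rho> h = \<rho> h * map_mat rat_of_int w) \<and>
       map_mat real_of_int w = U * mat_diag n (\<lambda>i. \<omega> (f i)) * V \<and>
       real b ^ (k - 1) \<le> K' * \<bar>\<omega> x0\<bar> \<and> \<bar>\<omega> x0\<bar> \<le> K' * real b ^ (k - 1) \<and>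
       (\<forall>x \<in> f ` {..<n} - {x0}. 1 \<le> K' * real b * \<bar>\<omega> x\<bar> \<and> real b * \<bar>\<omega> x\<bar> \<le> K')"
  have unit: "\<exists>w \<omega>. ?P b w \<omega>" if b: "b \<ge> 1" and cb: "c b = c b0" for b
  proof -
    define \<beta> where "\<beta> = \<alpha> (q b0)"
    define a where "a = \<alpha> (q b)"
    have ac: "a \<in> carrier_mat n n" "\<beta> \<in> carrier_mat n n" by (simp_all add: a_def \<beta>_def \<alpha>c)
    have \<nu>eq: "\<nu> b = \<nu> b0" using cb by (simp add: c_def)
    have deta: "det a = \<nu> b0" "det \<beta> = \<nu> b0" using \<nu>eq by (simp_all add: a_def \<beta>_def \<nu>_def)
    have cong: "a $$ (i, j) mod \<nu> b0 = \<beta> $$ (i, j) mod \<nu> b0" if "i < n" "j < n" for i j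
    proof -
      have "restrict (\<lambda>ij. \<alpha> (q b) $$ ij mod \<nu> b) I (i, j) = restrict (\<lambda>ij. \<alpha> (q b0) $$ ij mod \<nu> b0) I (i, j)"
        using arg_cong[OF cb, of snd] unfolding c_def snd_conv by (rule fun_cong)
      then show ?thesis using that \<nu>eq by (simp add: I_def a_def \<beta>_def)
    qed
    obtain w where w: "w \<in> carrier_mat n n" "w * \<beta> = a" "det w = 1"
      using integer_quotient_matrix[OF ac deta \<nu>0[OF b01] cong] by blast
    have \<beta>0: "ev (q b0) x \<noteq> 0" if "x \<in> A" for x
      using lower[OF b01 that] epos[OF b01, of x] by auto
    define \<omega> where "\<omega> x = ev (q b) x / ev (q b0) x" for x
    have wcomm: "map_mat rat_of_int w * \<rho> h = \<rho> h * map_mat rat_of_int w" if h: "h \<in> carrier H" for h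
    proof -
      let ?w = "map_mat rat_of_int w" and ?b = "map_mat rat_of_int \<beta>" and ?a = "map_mat rat_of_int a"
      have c: "?w \<in> carrier_mat n n" "?b \<in> carrier_mat n n" "?a \<in> carrier_mat n n" using w ac by auto
      have wb: "?w * ?b = ?a" using of_int_hom.mat_hom_mult[OF w(1) ac(2)] w(2) by metis
      have "det ?b \<noteq> 0" using deta(2) \<nu>0[OF b01] by (simp add: of_int_hom.hom_det)
      then obtain b' where b': "b' \<in> carrier_mat n n" "?b * b' = 1\<^sub>m n" using det_inverse_exists[OF c(2)] by metis
      have bcomm: "?b * \<rho> h = \<rho> h * ?b" unfolding \<beta>_def by (rule \<alpha>comm[OF h])
      have acomm: "?a * \<rho> h = \<rho> h * ?a" unfolding a_def by (rule \<alpha>comm[OF h])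
      have "(?w * \<rho> h) * ?b = ?w * (?b * \<rho> h)" using c \<rho>c[OF h] bcomm by simp
      also have "\<dots> = ?a * \<rho> h" unfolding wb[symmetric] using c \<rho>c[OF h] by simp
      also have "\<dots> = \<rho> h * ?a" by (rule acomm)
      also have "\<dots> = (\<rho> h * ?w) * ?b" unfolding wb[symmetric] using c \<rho>c[OF h] by simp
      finally have "(?w * \<rho> h) * ?b * b' = (\<rho> h * ?w) * ?b * b'" by simp
      moreover have "Y * ?b * b' = Y" if "Y \<in> carrier_mat n n" for Y
        using assoc_mult_mat[OF that c(2) b'(1)] b'(2) that by simp
      ultimately show ?thesis using c(1) \<rho>c[OF h] by simp
    qed
    \<comment> \<open>The unit is not given as a polynomial in \<open>Z\<close>. Its diagonal form
      follows by cancelling \<beta>, which is diagonal in the same basis with nonzero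
      entries.\<close>
    have wdiag: "map_mat real_of_int w = U * mat_diag n (\<lambda>i. \<omega> (f i)) * V"
    proof -
      let ?w = "map_mat real_of_int w"
      let ?inv = "U * mat_diag n (\<lambda>i. 1 / ev (q b0) (f i)) * V"
      let ?b = "U * mat_diag n (\<lambda>i. ev (q b0) (f i)) * V"
      have ic: "U * mat_diag n g * V \<in> carrier_mat n n" for g
        by (rule mult_carrier_mat[OF mult_carrier_mat[OF U mat_diag_dim] V(1)])
      have wc: "?w \<in> carrier_mat n n" using w by simp
      have "map_mat real_of_int (w * \<beta>) = ?w * map_mat real_of_int \<beta>"
        by (rule of_int_hom.mat_hom_mult[OF w(1) ac(2)])
      then have "?w * ?b = U * mat_diag n (\<lambda>i. ev (q b) (f i)) * V"
        unfolding w(2) unfolding a_def \<beta>_def \<alpha>real by simp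
      then have "?w * ?b * ?inv = U * mat_diag n (\<lambda>i. \<omega> (f i)) * V"
        using conjugate_diag_mult[OF U V(1,3)] by (simp add: \<omega>_def)
      moreover have "?b * ?inv = 1\<^sub>m n"
      proof -
        have "mat_diag n (\<lambda>i. ev (q b0) (f i) * (1 / ev (q b0) (f i))) = 1\<^sub>m n"
          using \<beta>0 by (intro eq_matI) (auto simp: mat_diag_def A_def)
        then show ?thesis unfolding conjugate_diag_mult[OF U V(1,3)] using U V by simp
      qed
      then have "?w * ?b * ?inv = ?w"
        using assoc_mult_mat[OF wc ic ic] wc by simp
      ultimately show ?thesis by simp
    qed
    have K0: "K > 0" "K ^ (k - 1) > 0" using K(1) by simp_all
    have Kp: "K ^ k = K * K ^ (k - 1)" using k1 by (cases k) auto
    have up: "\<bar>\<omega> x\<bar> \<le> K' * e b x" and lo: "e b x \<le> K' * \<bar>\<omega> x\<bar>" if x: "x \<in> A" for x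
    proof -
      have p: "\<bar>ev (q b0) x\<bar> > 0" using \<beta>0[OF x] by simp
      have "\<bar>ev (q b) x\<bar> \<le> K * e b x" by (rule q(2)[OF b x])
      also have "\<dots> \<le> K * e b x * (real b0 ^ k * e b0 x)"
        using mult_left_mono[OF e0(2)[of x], of "K * e b x"] K0 epos[OF b, of x] by simp
      also have "\<dots> \<le> K * e b x * (real b0 ^ k * (K ^ (k - 1) * \<bar>ev (q b0) x\<bar>))"
        using lower[OF b01 x] K0 epos[OF b, of x] bk by (intro mult_left_mono) auto
      also have "\<dots> = K' * e b x * \<bar>ev (q b0) x\<bar>" by (simp add: K'_def Kp)
      finally show "\<bar>\<omega> x\<bar> \<le> K' * e b x" using p by (simp add: \<omega>_def abs_divide pos_divide_le_eq)
      have "e b x * \<bar>ev (q b0) x\<bar> \<le> e b x * (K * e b0 x)"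
        using q(2)[OF b01 x] epos[OF b, of x] by (intro mult_left_mono) auto
      also have "\<dots> \<le> e b x * (K * real b0 ^ k)"
        using e0(1)[of x] epos[OF b, of x] K0 by (intro mult_left_mono) auto
      also have "\<dots> \<le> (K ^ (k - 1) * \<bar>ev (q b) x\<bar>) * (K * real b0 ^ k)"
        using lower[OF b x] K0 bk by (intro mult_right_mono) auto
      also have "\<dots> = K' * \<bar>ev (q b) x\<bar>" by (simp add: K'_def Kp)
      finally show "e b x \<le> K' * \<bar>\<omega> x\<bar>" using p by (simp add: \<omega>_def abs_divide pos_le_divide_eq)
    qed
    have "?P b w \<omega>"
    proof (intro conjI ballI)
      show "real b ^ (k - 1) \<le> K' * \<bar>\<omega> x0\<bar>" "\<bar>\<omega> x0\<bar> \<le> K' * real b ^ (k - 1)"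
        using up[OF A(3)] lo[OF A(3)] by (simp_all add: e_def)
      fix x assume "x \<in> f ` {..<n} - {x0}"
      then have x: "x \<in> A" "x \<noteq> x0" by (auto simp: A_def)
      have bp: "real b > 0" using b by simp
      show "1 \<le> K' * real b * \<bar>\<omega> x\<bar>" "real b * \<bar>\<omega> x\<bar> \<le> K'"
        using up[OF x(1)] lo[OF x(1)] x(2) bp by (simp_all add: e_def field_simps)
    qed (use w wcomm wdiag in auto)
    then show ?thesis by blast
  qed
  have "infinite {b :: nat. b \<ge> 1 \<and> (\<exists>w \<omega>. ?P b w \<omega>)}"
    by (rule infinite_super[OF _ b0(2)]) (use unit in auto)
  then show ?thesis by (rule that[OF K'1])
qed

section \<open>Block companion matrices\<close>

definition block_mat :: "nat \<Rightarrow> nat \<Rightarrow> (nat \<Rightarrow> nat \<Rightarrow> 'a mat) \<Rightarrow> 'a mat" where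
  "block_mat m n F = mat (m * n) (m * n) (\<lambda>(i, j). F (i div n) (j div n) $$ (i mod n, j mod n))"

lemma block_mat_carrier [simp]: "block_mat m n F \<in> carrier_mat (m * n) (m * n)"
  by (simp add: block_mat_def)

lemma block_mat_dim [simp]: "dim_row (block_mat m n F) = m * n" "dim_col (block_mat m n F) = m * n"
  by (simp_all add: block_mat_def)

lemma block_mat_index:
  "i < m * n \<Longrightarrow> j < m * n \<Longrightarrow> block_mat m n F $$ (i, j) = F (i div n) (j div n) $$ (i mod n, j mod n)"
  by (simp add: block_mat_def)

lemma block_mat_cong:
  assumes "\<And>a b i j. a < m \<Longrightarrow> b < m \<Longrightarrow> i < n \<Longrightarrow> j < n \<Longrightarrow> F a b $$ (i, j) = G a b $$ (i, j)"
  shows "block_mat m n F = block_mat m n G"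
proof (rule eq_matI)
  fix i j assume "i < dim_row (block_mat m n G)" "j < dim_col (block_mat m n G)"
  then have ij: "i < m * n" "j < m * n" by (simp_all add: block_mat_def)
  then have "n > 0" by (cases n) auto
  then show "block_mat m n F $$ (i, j) = block_mat m n G $$ (i, j)"
    using ij assms[of "i div n" "j div n" "i mod n" "j mod n"]
    by (simp add: block_mat_index less_mult_imp_div_less)
qed (simp_all add: block_mat_def)

lemma map_block_mat:
  assumes "\<And>a b. a < m \<Longrightarrow> b < m \<Longrightarrow> F a b \<in> carrier_mat n n"
  shows "map_mat g (block_mat m n F) = block_mat m n (\<lambda>a b. map_mat g (F a b))"
proof (rule eq_matI)
  fix i j assume "i < dim_row (block_mat m n (\<lambda>a b. map_mat g (F a b)))" "j < dim_col (block_mat m n (\<lambda>a b. map_mat g (F a b)))"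
  then have ij: "i < m * n" "j < m * n" by (simp_all add: block_mat_def)
  then have "n > 0" by (cases n) auto
  then show "map_mat g (block_mat m n F) $$ (i, j) = block_mat m n (\<lambda>a b. map_mat g (F a b)) $$ (i, j)"
    using ij assms[of "i div n" "j div n"] block_mat_carrier[of m n F]
    by (simp add: block_mat_index less_mult_imp_div_less)
qed (simp_all add: block_mat_def)

lemma sum_over_blocks: "(\<Sum>j<m * n. g j) = (\<Sum>b<m. \<Sum>j<n. g (b * n + j :: nat))"
proof -
  have "(\<Sum>j<m * n. g j) = (\<Sum>b<m. sum g {b * n..<b * n + n})" by (rule sum.nat_group[symmetric])
  also have "\<dots> = (\<Sum>b<m. \<Sum>j<n. g (b * n + j))"
  proof (rule sum.cong[OF refl])
    fix b show "sum g {b * n..<b * n + n} = (\<Sum>j<n. g (b * n + j))"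
      using sum.atLeastLessThan_shift_0[of g "b * n" "b * n + n"] by (simp add: lessThan_atLeast0 comp_def)
  qed
  finally show ?thesis .
qed

lemma block_mat_mult_index:
  fixes F G :: "nat \<Rightarrow> nat \<Rightarrow> 'a :: comm_ring_1 mat"
  assumes F: "\<And>a b. a < m \<Longrightarrow> b < m \<Longrightarrow> F a b \<in> carrier_mat n n"
    and G: "\<And>a b. a < m \<Longrightarrow> b < m \<Longrightarrow> G a b \<in> carrier_mat n n"
    and ij: "i < m * n" "j < m * n"
  shows "(block_mat m n F * block_mat m n G) $$ (i, j) =
    (\<Sum>b<m. (F (i div n) b * G b (j div n)) $$ (i mod n, j mod n))"
proof -
  have n: "n > 0" using ij by (cases n) auto
  have d: "i div n < m" "j div n < m" using ij by (simp_all add: less_mult_imp_div_less)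
  have "(block_mat m n F * block_mat m n G) $$ (i, j) =
      (\<Sum>l<m * n. block_mat m n F $$ (i, l) * block_mat m n G $$ (l, j))"
    by (rule mat_mult_index_sum[OF block_mat_carrier block_mat_carrier ij])
  also have "\<dots> = (\<Sum>l<m * n. F (i div n) (l div n) $$ (i mod n, l mod n) * G (l div n) (j div n) $$ (l mod n, j mod n))"
    using ij by (intro sum.cong) (auto simp: block_mat_index)
  also have "\<dots> = (\<Sum>b<m. \<Sum>l<n. F (i div n) b $$ (i mod n, l) * G b (j div n) $$ (l, j mod n))"
    unfolding sum_over_blocks by (intro sum.cong) auto
  also have "\<dots> = (\<Sum>b<m. (F (i div n) b * G b (j div n)) $$ (i mod n, j mod n))"
    using n d by (intro sum.cong refl mat_mult_index_sum[OF F G, symmetric]) auto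
  finally show ?thesis .
qed

lemma block_mat_mult:
  fixes F G :: "nat \<Rightarrow> nat \<Rightarrow> 'a :: comm_ring_1 mat"
  assumes F: "\<And>a b. a < m \<Longrightarrow> b < m \<Longrightarrow> F a b \<in> carrier_mat n n"
    and G: "\<And>a b. a < m \<Longrightarrow> b < m \<Longrightarrow> G a b \<in> carrier_mat n n"
    and E: "\<And>a c i j. a < m \<Longrightarrow> c < m \<Longrightarrow> i < n \<Longrightarrow> j < n \<Longrightarrow> (\<Sum>b<m. (F a b * G b c) $$ (i, j)) = E a c $$ (i, j)"
  shows "block_mat m n F * block_mat m n G = block_mat m n E"
proof (rule eq_matI)
  fix i j assume "i < dim_row (block_mat m n E)" "j < dim_col (block_mat m n E)"
  then have ij: "i < m * n" "j < m * n" by (simp_all add: block_mat_def)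
  then have "n > 0" by (cases n) auto
  then show "(block_mat m n F * block_mat m n G) $$ (i, j) = block_mat m n E $$ (i, j)"
    using block_mat_mult_index[of m F n G i j, OF _ _ ij] F G ij E[of "i div n" "j div n" "i mod n" "j mod n"]
    by (simp add: block_mat_index less_mult_imp_div_less)
qed (simp_all add: block_mat_def)

lemma block_mat_one: "block_mat m n (\<lambda>a b. if a = b then 1\<^sub>m n else 0\<^sub>m n n) = 1\<^sub>m (m * n)"
proof (rule eq_matI)
  fix i j assume "i < dim_row (1\<^sub>m (m * n))" "j < dim_col (1\<^sub>m (m * n))"
  then have ij: "i < m * n" "j < m * n" by simp_all
  then have n: "n > 0" by (cases n) auto
  have "i = j \<longleftrightarrow> i div n = j div n \<and> i mod n = j mod n" by (metis div_mult_mod_eq)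
  then show "block_mat m n (\<lambda>a b. if a = b then 1\<^sub>m n else 0\<^sub>m n n) $$ (i, j) = 1\<^sub>m (m * n) $$ (i, j)"
    using ij n by (auto simp: block_mat_index)
qed (simp_all add: block_mat_def)

lemma diag_block_mat_replicate:
  assumes A: "A \<in> carrier_mat n n"
  shows "diag_block_mat (replicate m A) = block_mat m n (\<lambda>a b. if a = b then A else 0\<^sub>m n n)"
proof (induction m)
  case 0
  then show ?case by (intro eq_matI) (auto simp: block_mat_def)
next
  case (Suc m)
  let ?F = "\<lambda>a b :: nat. if a = b then A else 0\<^sub>m n n"
  have dA: "dim_row A = n" "dim_col A = n" using A by auto
  show ?case
  proof (rule eq_matI)
    fix i j assume "i < dim_row (block_mat (Suc m) n ?F)" "j < dim_col (block_mat (Suc m) n ?F)"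
    then have ij: "i < n + m * n" "j < n + m * n" by (simp_all add: block_mat_def)
    then have n: "n > 0" by (cases n) auto
    have r: "diag_block_mat (replicate (Suc m) A) = four_block_mat A (0\<^sub>m n (m * n)) (0\<^sub>m (m * n) n) (block_mat m n ?F)"
      by (simp add: Suc Let_def dA block_mat_def)
    have D: "(i - n) div n = i div n - 1" "(i - n) mod n = i mod n" "i div n \<noteq> 0" if "\<not> i < n" for i
      using that n le_div_geq[of n i] le_mod_geq[of n i] by (auto simp: div_eq_0_iff)
    have "i - n < m * n" if "\<not> i < n" using that ij by linarith
    moreover have "j - n < m * n" if "\<not> j < n" using that ij by linarith
    moreover have "block_mat (Suc m) n ?F $$ (i, j) = ?F (i div n) (j div n) $$ (i mod n, j mod n)"
      using ij by (simp add: block_mat_index)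
    ultimately show "diag_block_mat (replicate (Suc m) A) $$ (i, j) = block_mat (Suc m) n ?F $$ (i, j)"
      unfolding r using ij n dA D[of i] D[of j]
      by (cases "i < n"; cases "j < n") (auto simp: block_mat_index)
  qed (simp_all add: Suc Let_def dA block_mat_def)
qed

lemma block_mat_commute_multiple_rep:
  assumes F: "\<And>a b. a < m \<Longrightarrow> b < m \<Longrightarrow> F a b \<in> carrier_mat n n" and R: "\<rho> h \<in> carrier_mat n n"
    and comm: "\<And>a b. a < m \<Longrightarrow> b < m \<Longrightarrow> F a b * \<rho> h = \<rho> h * F a b"
  shows "block_mat m n F * multiple_rep m \<rho> h = multiple_rep m \<rho> h * block_mat m n (F :: nat \<Rightarrow> nat \<Rightarrow> rat mat)"
proof -
  let ?G = "\<lambda>a b :: nat. if a = b then \<rho> h else 0\<^sub>m n n"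
  have r: "multiple_rep m \<rho> h = block_mat m n ?G"
    using diag_block_mat_replicate[OF R, of m] by (simp add: multiple_rep_def direct_sum_rep_def)
  have G: "?G a b \<in> carrier_mat n n" for a b using R by simp
  have "block_mat m n F * block_mat m n ?G = block_mat m n (\<lambda>a c. F a c * \<rho> h)"
  proof (rule block_mat_mult[OF F G])
    fix a c i j assume a: "a < m" "c < m" "i < n" "j < n"
    have "(\<Sum>b<m. (F a b * ?G b c) $$ (i, j)) = (\<Sum>b<m. if b = c then (F a c * \<rho> h) $$ (i, j) else 0)"
      using a by (intro sum.cong) (auto simp: right_mult_zero_mat[OF F])
    then show "(\<Sum>b<m. (F a b * ?G b c) $$ (i, j)) = (F a c * \<rho> h) $$ (i, j)" using a by simp
  qed
  also have "\<dots> = block_mat m n (\<lambda>a c. \<rho> h * F a c)" using comm by (intro block_mat_cong) auto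
  also have "\<dots> = block_mat m n ?G * block_mat m n F"
  proof (rule block_mat_mult[OF G F, symmetric])
    fix a c i j assume a: "a < m" "c < m" "i < n" "j < n"
    have "(\<Sum>b<m. (?G a b * F b c) $$ (i, j)) = (\<Sum>b<m. if a = b then (\<rho> h * F a c) $$ (i, j) else 0)"
      using F a by (intro sum.cong) (auto simp: left_mult_zero_mat[OF F])
    then show "(\<Sum>b<m. (?G a b * F b c) $$ (i, j)) = (\<rho> h * F a c) $$ (i, j)" using a by simp
  qed
  finally show ?thesis unfolding r .
qed

text \<open>The companion matrix of X^m = u + v X^(m - 1), with ones above the diagonal. For m = 1
  the first and the last column coincide and the case order lets \<open>u\<close> win, so
  \<open>v\<close> disappears.\<close>

definition companion_block :: "nat \<Rightarrow> nat \<Rightarrow> 'a :: comm_ring_1 mat \<Rightarrow> 'a mat \<Rightarrow> nat \<Rightarrow> nat \<Rightarrow> 'a mat" where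
  "companion_block m n u v a b =
     (if a + 1 = m then (if b = 0 then u else if b + 1 = m then v else 0\<^sub>m n n)
      else if b = a + 1 then 1\<^sub>m n else 0\<^sub>m n n)"

lemma companion_block_carrier:
  "u \<in> carrier_mat n n \<Longrightarrow> v \<in> carrier_mat n n \<Longrightarrow> companion_block m n u v a b \<in> carrier_mat n n"
  by (simp add: companion_block_def)

text \<open>Over \<int> a right inverse makes the determinant a unit, so the determinant of the
  block matrix never has to be computed.\<close>

lemma companion_right_inverse:
  assumes m: "m \<ge> 1" and u: "u \<in> carrier_mat n n" "u' \<in> carrier_mat n n" "u * u' = 1\<^sub>m n" and v: "v \<in> carrier_mat n n"
  shows "\<exists>M \<in> carrier_mat (m * n) (m * n). block_mat m n (companion_block m n u v) * M = 1\<^sub>m (m * n)"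
proof
  \<comment> \<open>Obtained by solving y_a = x_(a+1) for a < m - 1 and y_(m-1) = u x_0 + v x_(m-1):
    then x_a = y_(a-1) for a > 0 and x_0 = u' (y_(m-1) - v y_(m-2)), where the last term is absent
    for m = 1.\<close>
  define G where "G a c =
    (if a = 0 then (if c + 1 = m then u' else if c + 2 = m then - (u' * v) else 0\<^sub>m n n)
     else if c + 1 = a then 1\<^sub>m n else 0\<^sub>m n n)" for a c
  have Fc: "companion_block m n u v a b \<in> carrier_mat n n" for a b using companion_block_carrier u v by blast
  have Gc: "G a b \<in> carrier_mat n n" for a b using u v by (simp add: G_def)
  have uu: "u * - (u' * v) = - v"
    using u v assoc_mult_mat[OF u(1,2) v] by (simp add: uminus_mult_right_mat)
  have "block_mat m n (companion_block m n u v) * block_mat m n G = block_mat m n (\<lambda>a b. if a = b then 1\<^sub>m n else 0\<^sub>m n n)"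
  proof (rule block_mat_mult[OF Fc Gc])
    fix a c i j assume a: "a < m" "c < m" and ij: "i < n" "j < n"
    let ?t = "\<lambda>b. (companion_block m n u v a b * G b c) $$ (i, j)"
    have z: "?t b = 0" if "companion_block m n u v a b = 0\<^sub>m n n" for b
      unfolding that using Gc[of b c] ij by simp
    show "sum ?t {..<m} = (if a = c then 1\<^sub>m n else 0\<^sub>m n n) $$ (i, j)"
    proof (cases "a + 1 = m")
      case False
      have "sum ?t {..<m} = sum ?t {a + 1}"
        using a False by (intro sum.mono_neutral_right ballI z) (auto simp: companion_block_def)
      also have "\<dots> = G (a + 1) c $$ (i, j)" using False Gc[of "a + 1" c] by (simp add: companion_block_def)
      also have "\<dots> = (if a = c then 1\<^sub>m n else 0\<^sub>m n n) $$ (i, j)" by (simp add: G_def)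
      finally show ?thesis .
    next
      case True
      have "sum ?t {..<m} = sum ?t {0, a}"
        using a True by (intro sum.mono_neutral_right ballI z) (auto simp: companion_block_def)
      also have "\<dots> = (if a = c then 1\<^sub>m n else 0\<^sub>m n n) $$ (i, j)"
      proof (cases "a = 0")
        case True
        then have "m = 1" "c = 0" using \<open>a + 1 = m\<close> a by auto
        then show ?thesis unfolding True by (simp add: companion_block_def G_def u(3))
      next
        case False
        then have "sum ?t {0, a} = (u * G 0 c) $$ (i, j) + (v * G a c) $$ (i, j)"
          using True by (simp add: companion_block_def)
        moreover have "u * G 0 c = (if c = a then 1\<^sub>m n else if c + 1 = a then - v else 0\<^sub>m n n)"
          using True u by (auto simp: G_def uu)
        moreover have "v * G a c = (if c + 1 = a then v else 0\<^sub>m n n)"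
          using False v by (auto simp: G_def)
        ultimately have "sum ?t {0, a} = (if a = c then 1\<^sub>m n else 0\<^sub>m n n) $$ (i, j)"
          using v ij by auto
        then show ?thesis .
      qed
      finally show ?thesis .
    qed
  qed
  then show "block_mat m n (companion_block m n u v) * block_mat m n G = 1\<^sub>m (m * n)"
    by (simp add: block_mat_one)
qed simp

text \<open>The upper block rows force an eigenvector to have the shape (y, \<mu> y, ..., \<mu>^(m -
  1) y); the last row is then the stated equation, and y is nonzero because it determines the whole
  vector.\<close>

lemma companion_eigenvector:
  fixes u v :: "'a :: field mat"
  assumes m: "m \<ge> 1" and u: "u \<in> carrier_mat n n" and v: "v \<in> carrier_mat n n"
    and z: "z \<in> carrier_vec (m * n)" "z \<noteq> 0\<^sub>v (m * n)"
    and eig: "block_mat m n (companion_block m n u v) *\<^sub>v z = \<mu> \<cdot>\<^sub>v z"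
  shows "\<exists>y \<in> carrier_vec n. y \<noteq> 0\<^sub>v n \<and>
    (u + (if m = 1 then 0 else \<mu> ^ (m - 1)) \<cdot>\<^sub>m v) *\<^sub>v y = \<mu> ^ m \<cdot>\<^sub>v y"
proof -
  let ?F = "companion_block m n u v"
  have n: "n > 0"
  proof (rule ccontr)
    assume "\<not> n > 0"
    then have "z = 0\<^sub>v (m * n)" using z(1) by (intro eq_vecI) auto
    then show False using z(2) by simp
  qed
  define y where "y a = vec n (\<lambda>j. z $ (a * n + j))" for a
  have yc: "y a \<in> carrier_vec n" for a by (simp add: y_def)
  have Fc: "?F a b \<in> carrier_mat n n" for a b using companion_block_carrier u v by blast
  have Fd: "dim_row (?F a b) = n" "dim_col (?F a b) = n" for a b using Fc[of a b] by auto
  have lt: "a * n + i < m * n" if "a < m" "i < n" for a i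
    using mult_le_mono1[of "Suc a" m n] that by simp
  have row: "(\<Sum>b<m. (?F a b *\<^sub>v y b) $ i) = \<mu> * y a $ i" if a: "a < m" and i: "i < n" for a i
  proof -
    have "\<mu> * y a $ i = (\<mu> \<cdot>\<^sub>v z) $ (a * n + i)" using z(1) lt[OF a i] i by (simp add: y_def)
    also have "\<dots> = (\<Sum>l<m * n. block_mat m n ?F $$ (a * n + i, l) * z $ l)"
      unfolding eig[symmetric] using lt[OF a i] z(1) block_mat_carrier[of m n ?F]
      by (auto simp: scalar_prod_def lessThan_atLeast0 intro!: sum.cong)
    also have "\<dots> = (\<Sum>l<m * n. ?F a (l div n) $$ (i, l mod n) * z $ l)"
      using lt[OF a i] i by (intro sum.cong) (auto simp: block_mat_index)
    also have "\<dots> = (\<Sum>b<m. \<Sum>l<n. ?F a b $$ (i, l) * z $ (b * n + l))"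
      unfolding sum_over_blocks by (intro sum.cong) auto
    also have "\<dots> = (\<Sum>b<m. (?F a b *\<^sub>v y b) $ i)"
      using i Fd by (intro sum.cong) (auto simp: scalar_prod_def lessThan_atLeast0 y_def intro!: sum.cong)
    finally show ?thesis by simp
  qed
  have zero: "(?F a b *\<^sub>v y b) $ i = 0" if "?F a b = 0\<^sub>m n n" "i < n" for a b i
    unfolding that(1) using zero_mat_mult_vec[OF yc] that(2) by simp
  have step: "y (Suc a) = \<mu> \<cdot>\<^sub>v y a" if a: "Suc a < m" for a
  proof (rule eq_vecI)
    fix i assume "i < dim_vec (\<mu> \<cdot>\<^sub>v y a)"
    then have i: "i < n" using yc[of a] by simp
    have "(\<Sum>b<m. (?F a b *\<^sub>v y b) $ i) = (\<Sum>b\<in>{Suc a}. (?F a b *\<^sub>v y b) $ i)"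
      using a i by (intro sum.mono_neutral_right ballI zero) (auto simp: companion_block_def)
    also have "\<dots> = y (Suc a) $ i" using a yc[of "Suc a"] by (simp add: companion_block_def)
    finally show "y (Suc a) $ i = (\<mu> \<cdot>\<^sub>v y a) $ i" using row[of a i] a i yc[of a] by simp
  qed (simp add: y_def)
  have pow: "y a = \<mu> ^ a \<cdot>\<^sub>v y 0" if "a < m" for a
    using that by (induction a) (auto simp: step smult_smult_assoc)
  have y0: "y 0 \<noteq> 0\<^sub>v n"
  proof
    assume 0: "y 0 = 0\<^sub>v n"
    have "z = 0\<^sub>v (m * n)"
    proof (rule eq_vecI)
      fix l assume "l < dim_vec (0\<^sub>v (m * n))"
      then have l: "l < m * n" by simp
      then have "z $ l = y (l div n) $ (l mod n)" using n by (simp add: y_def)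
      also have "\<dots> = 0" using pow[of "l div n"] l n unfolding 0 by (simp add: less_mult_imp_div_less)
      finally show "z $ l = 0\<^sub>v (m * n) $ l" using l by simp
    qed (use z(1) in simp)
    then show False using z(2) by simp
  qed
  have "(u + (if m = 1 then 0 else \<mu> ^ (m - 1)) \<cdot>\<^sub>m v) *\<^sub>v y 0 = \<mu> ^ m \<cdot>\<^sub>v y 0"
  proof (rule eq_vecI)
    fix i assume "i < dim_vec (\<mu> ^ m \<cdot>\<^sub>v y 0)"
    then have i: "i < n" using yc[of 0] by simp
    have last: "(\<Sum>b<m. (?F (m - 1) b *\<^sub>v y b) $ i) = \<mu> ^ m * y 0 $ i"
    proof -
      have "(\<Sum>b<m. (?F (m - 1) b *\<^sub>v y b) $ i) = \<mu> * y (m - 1) $ i" using row[of "m - 1" i] m i by simp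
      also have "\<dots> = \<mu> * \<mu> ^ (m - 1) * y 0 $ i" using pow[of "m - 1"] m i yc[of 0] by simp
      also have "\<mu> * \<mu> ^ (m - 1) = \<mu> ^ m" using m by (cases m) auto
      finally show ?thesis .
    qed
    have uv: "u *\<^sub>v y 0 \<in> carrier_vec n" "v *\<^sub>v y 0 \<in> carrier_vec n" using u v yc[of 0] by auto
    have l: "((u + s \<cdot>\<^sub>m v) *\<^sub>v y 0) $ i = (u *\<^sub>v y 0) $ i + s * (v *\<^sub>v y 0) $ i" for s
      using u v yc[of 0] i uv
      by (simp add: add_mult_distrib_mat_vec[OF u _ yc] scalar_prod_def sum_distrib_left mult.assoc)
    have "(\<Sum>b<m. (?F (m - 1) b *\<^sub>v y b) $ i) = (\<Sum>b\<in>{0, m - 1}. (?F (m - 1) b *\<^sub>v y b) $ i)"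
      using m i by (intro sum.mono_neutral_right ballI zero) (auto simp: companion_block_def)
    also have "\<dots> = (u *\<^sub>v y 0) $ i + (if m = 1 then 0 else \<mu> ^ (m - 1)) * (v *\<^sub>v y 0) $ i"
    proof (cases "m = 1")
      case True
      then show ?thesis by (simp add: companion_block_def)
    next
      case False
      then have "(v *\<^sub>v y (m - 1)) $ i = \<mu> ^ (m - 1) * (v *\<^sub>v y 0) $ i"
        using pow[of "m - 1"] m mult_mat_vec[OF v yc, of "\<mu> ^ (m - 1)" 0] uv(2) v i by simp
      then show ?thesis using False m by (simp add: companion_block_def)
    qed
    finally have "(u *\<^sub>v y 0) $ i + (if m = 1 then 0 else \<mu> ^ (m - 1)) * (v *\<^sub>v y 0) $ i = \<mu> ^ m * y 0 $ i"
      unfolding last by simp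
    then show "((u + (if m = 1 then 0 else \<mu> ^ (m - 1)) \<cdot>\<^sub>m v) *\<^sub>v y 0) $ i = (\<mu> ^ m \<cdot>\<^sub>v y 0) $ i"
      unfolding l using i yc[of 0] by simp
  qed (use u v yc[of 0] in auto)
  then show ?thesis using y0 yc by blast
qed

lemma eigenvalue_conjugate_diag:
  fixes U V :: "'a :: field mat"
  assumes U: "U \<in> carrier_mat n n" and V: "V \<in> carrier_mat n n" "U * V = 1\<^sub>m n" "V * U = 1\<^sub>m n"
    and y: "y \<in> carrier_vec n" "y \<noteq> 0\<^sub>v n" and eig: "(U * mat_diag n d * V) *\<^sub>v y = \<mu> \<cdot>\<^sub>v y"
  shows "\<exists>i<n. \<mu> = d i"
proof -
  define x where "x = V *\<^sub>v y"
  have xc: "x \<in> carrier_vec n" using V y by (simp add: x_def)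
  have Dx: "mat_diag n d *\<^sub>v x \<in> carrier_vec n" using mult_mat_vec_carrier[OF mat_diag_dim xc] .
  have "U *\<^sub>v x = y" unfolding x_def using U V y by (simp add: assoc_mult_mat_vec[symmetric])
  then have "x \<noteq> 0\<^sub>v n" using y U by (metis mat_mult_zero_vec)
  then obtain i where i: "i < n" "x $ i \<noteq> 0" using xc by (metis carrier_vecD eq_vecI index_zero_vec)
  have "(U * mat_diag n d * V) *\<^sub>v y = (U * mat_diag n d) *\<^sub>v x"
    unfolding x_def by (rule assoc_mult_mat_vec[OF mult_carrier_mat[OF U mat_diag_dim] V(1) y(1)])
  also have "\<dots> = U *\<^sub>v (mat_diag n d *\<^sub>v x)" by (rule assoc_mult_mat_vec[OF U mat_diag_dim xc])
  finally have "V *\<^sub>v (U *\<^sub>v (mat_diag n d *\<^sub>v x)) = V *\<^sub>v (\<mu> \<cdot>\<^sub>v y)" using eig by simp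
  moreover have "V *\<^sub>v (U *\<^sub>v (mat_diag n d *\<^sub>v x)) = mat_diag n d *\<^sub>v x"
    using assoc_mult_mat_vec[OF V(1) U Dx] V(3) Dx by simp
  moreover have "V *\<^sub>v (\<mu> \<cdot>\<^sub>v y) = \<mu> \<cdot>\<^sub>v x" unfolding x_def by (rule mult_mat_vec[OF V(1) y(1)])
  ultimately have "mat_diag n d *\<^sub>v x = \<mu> \<cdot>\<^sub>v x" by simp
  then have "(mat_diag n d *\<^sub>v x) $ i = \<mu> * x $ i" using i xc by simp
  moreover have "(mat_diag n d *\<^sub>v x) $ i = (\<Sum>j<n. (if i = j then d j else 0) * x $ j)"
    using i xc by (auto simp: mat_diag_def scalar_prod_def lessThan_atLeast0 intro!: sum.cong)
  moreover have "\<dots> = (\<Sum>j<n. if i = j then d i * x $ i else 0)" by (intro sum.cong) auto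
  ultimately have "d i * x $ i = \<mu> * x $ i" using i by simp
  then show ?thesis using i by auto
qed

text \<open>\<open>B\<close> is the order of magnitude of W. The factor 1 + \<mu>^(m - 1) (or 1 if m
  = 1) is bounded below for small \<mu> and comparable to |\<mu>|^(m - 1) for large \<mu>. Apart
  from the middle range, where \<mu> has order 1, this yields order B^m.\<close>

lemma companion_root_bounds:
  fixes \<mu> :: complex and W K B :: real
  assumes m: "m \<ge> 1" and K: "K \<ge> 1" and B: "B \<ge> 1" "B \<le> K * \<bar>W\<bar>" "\<bar>W\<bar> \<le> K * B"
    and eq: "\<mu> ^ m = of_real W ^ m * (1 + (if m = 1 then 0 else \<mu> ^ (m - 1)))"
  shows "(1 \<le> 2 * K ^ m * cmod \<mu> \<and> cmod \<mu> \<le> 2 * K ^ m) \<or>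
    (B ^ m \<le> 2 * K ^ m * cmod \<mu> \<and> cmod \<mu> \<le> 2 * K ^ m * B ^ m)"
proof -
  define r where "r = cmod \<mu>"
  define e where "e = cmod (1 + (if m = 1 then 0 else \<mu> ^ (m - 1)))"
  have r0: "r \<ge> 0" by (simp add: r_def)
  have "r ^ m = cmod (\<mu> ^ m)" by (simp add: r_def norm_power)
  also have "\<dots> = \<bar>W\<bar> ^ m * e" unfolding eq norm_mult e_def by (simp add: norm_power)
  finally have norm: "r ^ m = \<bar>W\<bar> ^ m * e" .
  have rm: "r ^ m = r * r ^ (m - 1)" using m by (cases m) auto
  have lo: "B ^ m \<le> K ^ m * \<bar>W\<bar> ^ m"
    using power_mono[OF B(2), of m] B(1) by (simp add: power_mult_distrib)
  have up: "\<bar>W\<bar> ^ m \<le> K ^ m * B ^ m" using power_mono[OF B(3), of m] by (simp add: power_mult_distrib)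
  have K1: "K ^ m \<ge> 1" and B1: "B ^ m \<ge> 1" using K B(1) by simp_all
  have KB: "K ^ m * B ^ m \<ge> 1" using mult_mono[OF K1 B1] K by simp
  \<comment> \<open>For r < 1/2 the factor is at least 1/2 and |W|^m \<le> 2 r follows, so B^m is at
    most a constant times r; the upper bound is free because r < 1. For r > 2, dividing by r^(m - 1)
    compares r with |W|^m.\<close>
  consider "r < 1 / 2" | "1 / 2 \<le> r" "r \<le> 2" | "r > 2" by linarith
  then show ?thesis
  proof cases
    case 1
    have "e \<ge> 1 / 2"
    proof (cases "m = 1")
      case False
      then have "r ^ (m - 1) \<le> r ^ 1" using 1 r0 m by (intro power_decreasing) auto
      moreover have "e \<ge> 1 - r ^ (m - 1)"
        using norm_diff_ineq[of 1 "\<mu> ^ (m - 1)"] False by (simp add: e_def r_def norm_power)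
      ultimately show ?thesis using 1 by simp
    qed (simp add: e_def)
    then have "\<bar>W\<bar> ^ m * (1 / 2) \<le> \<bar>W\<bar> ^ m * e" by (intro mult_left_mono) auto
    moreover have "r ^ m \<le> r ^ 1" using 1 r0 m by (intro power_decreasing) auto
    ultimately have "\<bar>W\<bar> ^ m \<le> 2 * r" unfolding norm by simp
    then have "K ^ m * \<bar>W\<bar> ^ m \<le> K ^ m * (2 * r)" using K1 by (intro mult_left_mono) auto
    then have "B ^ m \<le> 2 * K ^ m * r" using lo by simp
    moreover have "r \<le> 2 * K ^ m * B ^ m" using 1 KB by simp
    ultimately show ?thesis by (simp add: r_def)
  next
    case 2
    have "1 * (1 / 2) \<le> K ^ m * r" using K1 2 by (intro mult_mono) auto
    then show ?thesis using 2 K1 by (simp add: r_def)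
  next
    case 3
    have p: "r ^ (m - 1) > 0" using 3 by simp
    have e: "r ^ (m - 1) / 2 \<le> e \<and> e \<le> 2 * r ^ (m - 1)"
    proof (cases "m = 1")
      case False
      then have "r ^ 1 \<le> r ^ (m - 1)" using 3 m by (intro power_increasing) auto
      moreover have "e \<ge> r ^ (m - 1) - 1"
        using norm_diff_ineq[of "\<mu> ^ (m - 1)" 1] False by (simp add: e_def r_def norm_power add.commute)
      moreover have "e \<le> 1 + r ^ (m - 1)"
        using norm_triangle_ineq[of 1 "\<mu> ^ (m - 1)"] False by (simp add: e_def r_def norm_power)
      ultimately show ?thesis using 3 by simp
    qed (simp add: e_def)
    have "\<bar>W\<bar> ^ m * (r ^ (m - 1) / 2) \<le> r * r ^ (m - 1)"
      using e norm rm by (metis abs_ge_zero mult_left_mono zero_le_power)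
    then have "(\<bar>W\<bar> ^ m / 2) * r ^ (m - 1) \<le> r * r ^ (m - 1)" by simp
    then have "\<bar>W\<bar> ^ m / 2 \<le> r" using p by (simp only: mult_le_cancel_right_pos)
    then have "K ^ m * (\<bar>W\<bar> ^ m / 2) \<le> K ^ m * r" using K1 by (intro mult_left_mono) auto
    then have l: "B ^ m \<le> 2 * K ^ m * r" using lo by simp
    have "r * r ^ (m - 1) \<le> \<bar>W\<bar> ^ m * (2 * r ^ (m - 1))"
      using e norm rm by (metis abs_ge_zero mult_left_mono zero_le_power)
    then have "r * r ^ (m - 1) \<le> (2 * \<bar>W\<bar> ^ m) * r ^ (m - 1)" by simp
    then have "r \<le> 2 * \<bar>W\<bar> ^ m" using p by (simp only: mult_le_cancel_right_pos)
    then have "r \<le> 2 * K ^ m * B ^ m" using up by simp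
    then show ?thesis using l by (simp add: r_def)
  qed
qed

text \<open>p counts the factors assigned to the scale b^M; each factor costs one Q on either side.
  Entries that fit both scales may be assigned to either.\<close>

lemma product_of_two_scales:
  fixes ls :: "complex list" and b Q :: real
  assumes Q: "Q \<ge> 1" and b: "b > 0"
    and scales: "\<forall>z\<in>set ls. (1 \<le> Q * (b * cmod z) \<and> b * cmod z \<le> Q) \<or> (b ^ M \<le> Q * (b * cmod z) \<and> b * cmod z \<le> Q * b ^ M)"
  shows "\<exists>p. b ^ (M * p) \<le> Q ^ length ls * (b ^ length ls * cmod (prod_list ls)) \<and>
    b ^ length ls * cmod (prod_list ls) \<le> Q ^ length ls * b ^ (M * p)"
  using scales
proof (induction ls)
  case Nil
  show ?case by (rule exI[of _ 0]) simp
next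
  case (Cons z ls)
  define L where "L = length ls"
  define P where "P = b ^ L * cmod (prod_list ls)"
  define x where "x = b * cmod z"
  have P0: "P \<ge> 0" and x0: "x \<ge> 0" using b by (simp_all add: P_def x_def)
  have len: "length (z # ls) = Suc L" and new: "b ^ Suc L * cmod (prod_list (z # ls)) = x * P"
    by (simp_all add: P_def x_def L_def norm_mult)
  obtain p where p: "b ^ (M * p) \<le> Q ^ L * P" "P \<le> Q ^ L * b ^ (M * p)"
    using Cons by (auto simp: P_def L_def)
  have step: "t * b ^ (M * p) \<le> Q ^ Suc L * (x * P) \<and> x * P \<le> Q ^ Suc L * (t * b ^ (M * p))"
    if t: "t \<le> Q * x" "x \<le> Q * t" "t \<ge> 0" for t
  proof
    have "t * b ^ (M * p) \<le> (Q * x) * (Q ^ L * P)" using t p(1) b Q x0 by (intro mult_mono) auto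
    then show "t * b ^ (M * p) \<le> Q ^ Suc L * (x * P)" by (simp add: mult_ac)
    have "x * P \<le> (Q * t) * (Q ^ L * b ^ (M * p))" using t p(2) P0 Q by (intro mult_mono) auto
    then show "x * P \<le> Q ^ Suc L * (t * b ^ (M * p))" by (simp add: mult_ac)
  qed
  have "(1 \<le> Q * x \<and> x \<le> Q) \<or> (b ^ M \<le> Q * x \<and> x \<le> Q * b ^ M)" using Cons.prems by (simp add: x_def)
  then show ?case
  proof
    assume "1 \<le> Q * x \<and> x \<le> Q"
    then show ?thesis unfolding len new using step[of 1] by (intro exI[of _ p]) simp
  next
    assume "b ^ M \<le> Q * x \<and> x \<le> Q * b ^ M"
    moreover have "b ^ (M * Suc p) = b ^ M * b ^ (M * p)" by (simp add: power_add)
    ultimately show ?thesis unfolding len new using step[of "b ^ M"] b by (intro exI[of _ "Suc p"]) simp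
  qed
qed

text \<open>For a product of absolute value 1 and length L, b^L and b^(M p) would agree up to a
  factor Q^L. As 0 < L < M the exponents differ by at least 1, while b exceeds Q^M.\<close>

lemma no_unit_product_of_two_scales:
  fixes ls :: "complex list" and b Q :: real
  assumes Q: "Q \<ge> 1" and b: "b > Q ^ M" and L: "1 \<le> length ls" "length ls < M"
    and scales: "\<forall>z\<in>set ls. (1 \<le> Q * (b * cmod z) \<and> b * cmod z \<le> Q) \<or> (b ^ M \<le> Q * (b * cmod z) \<and> b * cmod z \<le> Q * b ^ M)"
  shows "cmod (prod_list ls) \<noteq> 1"
proof
  assume 1: "cmod (prod_list ls) = 1"
  define L where "L = length ls"
  have b1: "b > 1" using b Q one_le_power[of Q M] by linarith
  obtain p where p: "b ^ (M * p) \<le> Q ^ L * b ^ L" "b ^ L \<le> Q ^ L * b ^ (M * p)"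
    using product_of_two_scales[OF Q _ scales] b1 1 by (auto simp: L_def)
  have QL: "Q ^ L \<le> Q ^ M" using Q L by (intro power_increasing) (auto simp: L_def)
  show False
  proof (cases "p = 0")
    case True
    have "b ^ 1 \<le> b ^ L" using b1 L by (intro power_increasing) (auto simp: L_def)
    then show False using p(2) True QL b by simp
  next
    case False
    then have "Suc L \<le> M * p" using L by (cases p) (auto simp: L_def)
    then have "b ^ Suc L \<le> b ^ (M * p)" using b1 by (intro power_increasing) auto
    then have "b * b ^ L \<le> Q ^ L * b ^ L" using p(1) by simp
    then have "b \<le> Q ^ L" using b1 by simp
    then show False using QL b by linarith
  qed
qed

lemma det_pow_mat:
  fixes A :: "'a :: comm_ring_1 mat"
  assumes A: "A \<in> carrier_mat n n"
  shows "det (A ^\<^sub>m k) = det A ^ k"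
proof (induction k)
  case (Suc k)
  then show ?case using det_mult[OF pow_carrier_mat[OF A] A, of k] by (simp add: mult.commute)
qed (use A in simp)

lemma companion_of_unit:
  fixes w :: "int mat" and s :: int
  assumes m: "m \<ge> 1" and w: "w \<in> carrier_mat n n" "det w = 1"
  defines "C \<equiv> map_mat rat_of_int (block_mat m n (companion_block m n (w ^\<^sub>m m) (s \<cdot>\<^sub>m (w ^\<^sub>m m))))"
  shows "C \<in> carrier (GL (m * n))" "integer_like C"
proof -
  let ?u = "w ^\<^sub>m m"
  let ?M = "block_mat m n (companion_block m n ?u (s \<cdot>\<^sub>m ?u))"
  have u: "?u \<in> carrier_mat n n" using w by (rule_tac pow_carrier_mat)
  have "det ?u = 1" using det_pow_mat[OF w(1)] w(2) by simp
  \<comment> \<open>Because the determinant is 1, the adjugate is an integral inverse.\<close>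
  then have "?u * adj_mat ?u = 1\<^sub>m n" using adj_mat(2)[OF u] by (auto intro!: eq_matI)
  then obtain M' where M': "M' \<in> carrier_mat (m * n) (m * n)" "?M * M' = 1\<^sub>m (m * n)"
    using companion_right_inverse[OF m u adj_mat(1)[OF u], of "s \<cdot>\<^sub>m ?u"] u by auto
  have "det ?M * det M' = 1" using det_mult[OF block_mat_carrier[of m n "companion_block m n ?u (s \<cdot>\<^sub>m ?u)"] M'(1)] M'(2) by simp
  then have detM: "det ?M = 1 \<or> det ?M = - 1" using zmult_eq_1_iff by blast
  have detC: "det C = of_int (det ?M)" unfolding C_def by (rule of_int_hom.hom_det)
  show "C \<in> carrier (GL (m * n))" using detM detC by (auto simp: GL_iff C_def)
  have "char_poly C = map_poly of_int (char_poly ?M)"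
    unfolding C_def by (rule of_int_hom.char_poly_hom[OF block_mat_carrier])
  then show "integer_like C" using detM detC by (auto simp: integer_like_def coeff_map_poly)
qed

lemma smult_conjugate_diag:
  fixes U V :: "'a :: field mat"
  assumes U: "U \<in> carrier_mat n n" and V: "V \<in> carrier_mat n n"
  shows "k \<cdot>\<^sub>m (U * mat_diag n d * V) = U * mat_diag n (\<lambda>i. k * d i) * V"
proof -
  have "mat_diag n (\<lambda>i. k * d i) = k \<cdot>\<^sub>m mat_diag n d" by (intro eq_matI) (auto simp: mat_diag_def)
  then show ?thesis
    using mult_smult_distrib[OF U mat_diag_dim] mult_smult_assoc_mat[OF mult_carrier_mat[OF U mat_diag_dim] V]
    by metis
qed

text \<open>In the basis that diagonalises \<open>w\<close> the block equation decouples into one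
  scalar equation for each eigenvalue \<open>d i\<close>. An integral \<open>s\<close> keeps the
  matrix integral; it will be b^(m - 1).\<close>

lemma companion_of_unit_eigenvalue:
  fixes w :: "int mat" and U V :: "real mat" and s :: int
  assumes m: "m \<ge> 1" and w: "w \<in> carrier_mat n n"
    and U: "U \<in> carrier_mat n n" and V: "V \<in> carrier_mat n n" "U * V = 1\<^sub>m n" "V * U = 1\<^sub>m n"
    and diag: "map_mat real_of_int w = U * mat_diag n d * V"
    and eig: "\<mu> \<in> spectrum (map_mat of_rat (map_mat rat_of_int (block_mat m n (companion_block m n (w ^\<^sub>m m) (s \<cdot>\<^sub>m (w ^\<^sub>m m))))))"
  shows "\<exists>i<n. \<mu> ^ m = complex_of_real (d i) ^ m * (1 + (if m = 1 then 0 else of_int s * \<mu> ^ (m - 1)))"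
proof -
  let ?u = "w ^\<^sub>m m"
  let ?Uc = "map_mat complex_of_real U" and ?Vc = "map_mat complex_of_real V"
  let ?uc = "?Uc * mat_diag n (\<lambda>i. complex_of_real (d i) ^ m) * ?Vc"
  have Uc: "?Uc \<in> carrier_mat n n" and Vc: "?Vc \<in> carrier_mat n n" using U V by auto
  have inv: "?Uc * ?Vc = 1\<^sub>m n" "?Vc * ?Uc = 1\<^sub>m n"
    using map_mat_complex_mult[OF U V(1)] map_mat_complex_mult[OF V(1) U] V(2,3)
    by (simp_all add: of_real_hom.mat_hom_one)
  have u: "?u \<in> carrier_mat n n" using w by (rule pow_carrier_mat)
  have "map_mat complex_of_int w = map_mat complex_of_real (map_mat real_of_int w)"
    by (intro eq_matI) auto
  also have "\<dots> = ?Uc * map_mat complex_of_real (mat_diag n d) * ?Vc"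
    unfolding diag map_mat_complex_mult[OF mult_carrier_mat[OF U mat_diag_dim] V(1)] map_mat_complex_mult[OF U mat_diag_dim] ..
  also have "map_mat complex_of_real (mat_diag n d) = mat_diag n (\<lambda>i. complex_of_real (d i))"
    by (intro eq_matI) (auto simp: mat_diag_def)
  finally have "map_mat complex_of_int w = ?Uc * mat_diag n (\<lambda>i. complex_of_real (d i)) * ?Vc" .
  then have uc: "map_mat complex_of_int ?u = ?uc"
    unfolding of_int_hom.mat_hom_pow[OF w] by (simp add: conjugate_diag_pow[OF Uc Vc inv(2,1)])
  have ucc: "?uc \<in> carrier_mat n n" by (rule mult_carrier_mat[OF mult_carrier_mat[OF Uc mat_diag_dim] Vc])
  have su: "map_mat complex_of_int (s \<cdot>\<^sub>m ?u) = of_int s \<cdot>\<^sub>m ?uc"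
    unfolding uc[symmetric] by (intro eq_matI) auto
  have "map_mat of_rat (map_mat rat_of_int (block_mat m n (companion_block m n ?u (s \<cdot>\<^sub>m ?u)))) =
      map_mat complex_of_int (block_mat m n (companion_block m n ?u (s \<cdot>\<^sub>m ?u)))"
    by (intro eq_matI) auto
  also have "\<dots> = block_mat m n (\<lambda>a b. map_mat complex_of_int (companion_block m n ?u (s \<cdot>\<^sub>m ?u) a b))"
    by (rule map_block_mat) (use u in \<open>simp add: companion_block_carrier\<close>)
  also have "(\<lambda>a b. map_mat complex_of_int (companion_block m n ?u (s \<cdot>\<^sub>m ?u) a b)) =
      companion_block m n ?uc (of_int s \<cdot>\<^sub>m ?uc)"
    unfolding su[symmetric] unfolding uc[symmetric]
    by (intro ext) (auto simp: companion_block_def of_int_hom.mat_hom_one intro!: eq_matI)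
  finally have C: "map_mat of_rat (map_mat rat_of_int (block_mat m n (companion_block m n ?u (s \<cdot>\<^sub>m ?u)))) =
      block_mat m n (companion_block m n ?uc (of_int s \<cdot>\<^sub>m ?uc))" .
  obtain z where z: "z \<in> carrier_vec (m * n)" "z \<noteq> 0\<^sub>v (m * n)"
      "block_mat m n (companion_block m n ?uc (of_int s \<cdot>\<^sub>m ?uc)) *\<^sub>v z = \<mu> \<cdot>\<^sub>v z"
    using eig unfolding C by (auto simp: spectrum_def eigenvalue_def eigenvector_def)
  define t where "t = (if m = 1 then 0 else \<mu> ^ (m - 1))"
  have sc: "of_int s \<cdot>\<^sub>m ?uc \<in> carrier_mat n n" using ucc by simp
  obtain y where y: "y \<in> carrier_vec n" "y \<noteq> 0\<^sub>v n" "(?uc + t \<cdot>\<^sub>m (of_int s \<cdot>\<^sub>m ?uc)) *\<^sub>v y = \<mu> ^ m \<cdot>\<^sub>v y"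
    using companion_eigenvector[OF m ucc sc z] unfolding t_def by blast
  have "?uc + t \<cdot>\<^sub>m (of_int s \<cdot>\<^sub>m ?uc) = (1 + t * of_int s) \<cdot>\<^sub>m ?uc"
    using ucc by (intro eq_matI) (auto simp: algebra_simps)
  also have "\<dots> = ?Uc * mat_diag n (\<lambda>i. (1 + t * of_int s) * complex_of_real (d i) ^ m) * ?Vc"
    by (rule smult_conjugate_diag[OF Uc Vc])
  finally have "\<exists>i<n. \<mu> ^ m = (1 + t * of_int s) * complex_of_real (d i) ^ m"
    using eigenvalue_conjugate_diag[OF Uc Vc inv y(1,2)] y(3) by simp
  moreover have "1 + t * of_int s = 1 + (if m = 1 then 0 else of_int s * \<mu> ^ (m - 1))" by (simp add: t_def)
  ultimately show ?thesis by (simp only: mult.commute)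
qed

section \<open>From the real splitting to an integral commuting matrix\<close>

lemma common_denominator:
  assumes "finite (A :: rat set)"
  obtains D :: int where "D > 0" "\<forall>q\<in>A. of_int D * q \<in> \<int>"
proof -
  have "\<exists>D :: int. D > 0 \<and> (\<forall>q\<in>A. of_int D * q \<in> \<int>)"
    using assms
  proof (induction A)
    case empty
    show ?case by (rule exI[of _ 1]) simp
  next
    case (insert q A)
    then obtain D :: int where D: "D > 0" "\<forall>q\<in>A. of_int D * q \<in> \<int>" by blast
    obtain a b where q: "q = Rat.Fract a b" "b > 0" by (cases q) auto
    have "of_int (D * b) * q = of_int (D * a)" using q by (simp add: Fract_of_int_quotient)
    then have "of_int (D * b) * q \<in> \<int>" by (metis Ints_of_int)
    moreover have "of_int (D * b) * q' \<in> \<int>" if "q' \<in> A" for q'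
    proof -
      have "of_int (D * b) * q' = of_int b * (of_int D * q')" by simp
      then show ?thesis using D(2) that by (metis Ints_mult Ints_of_int)
    qed
    ultimately show ?case using D(1) q(2) by (intro exI[of _ "D * b"]) auto
  qed
  then show ?thesis using that by blast
qed

lemma integer_multiple_mat:
  assumes S: "S \<in> carrier_mat n n"
  obtains D :: int and Z where "D > 0" "Z \<in> carrier_mat n n" "map_mat rat_of_int Z = rat_of_int D \<cdot>\<^sub>m S"
proof -
  obtain D :: int where D: "D > 0" "\<forall>q\<in>(\<lambda>(i, j). S $$ (i, j)) ` ({..<n} \<times> {..<n}). of_int D * q \<in> \<int>"
    by (rule common_denominator[of "(\<lambda>(i, j). S $$ (i, j)) ` ({..<n} \<times> {..<n})"]) auto
  \<comment> \<open>The entries are already integral, so \<open>floor\<close> merely moves them to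
    the type of integers.\<close>
  have "map_mat rat_of_int (map_mat floor (rat_of_int D \<cdot>\<^sub>m S)) = rat_of_int D \<cdot>\<^sub>m S"
    using D(2) S by (intro eq_matI) (auto elim!: Ints_cases)
  then show ?thesis using S by (intro that[OF D(1), of "map_mat floor (rat_of_int D \<cdot>\<^sub>m S)"]) auto
qed

lemma splits_in_components_obtain:
  assumes "group H" and "splits_in_components H n \<rho> k"
  obtains ds \<sigma>s P where "list_all2 (irreducible_rep H) ds \<sigma>s" "sum_list ds = n" "length ds = k"
    "P \<in> carrier_mat n n" "det P \<noteq> 0" "\<And>h. h \<in> carrier H \<Longrightarrow> \<rho> h * P = P * direct_sum_rep \<sigma>s h"
proof -
  interpret group H by fact
  obtain \<sigma>s P where \<sigma>s: "length \<sigma>s = k" "\<forall>\<sigma> \<in> set \<sigma>s. \<exists>d. irreducible_rep H d \<sigma>"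
    and rep: "representation H n (direct_sum_rep \<sigma>s)"
    and P: "P \<in> carrier (GL n)" "\<forall>h \<in> carrier H. \<rho> h * P = P * direct_sum_rep \<sigma>s h"
    using assms(2) by (auto simp: splits_in_components_def equivalent_rep_def)
  define ds where "ds = map (\<lambda>\<sigma>. SOME d. irreducible_rep H d \<sigma>) \<sigma>s"
  have irr: "list_all2 (irreducible_rep H) ds \<sigma>s"
  proof (rule list_all2_all_nthI)
    fix i assume "i < length ds"
    then have i: "i < length \<sigma>s" by (simp add: ds_def)
    then have "\<exists>d. irreducible_rep H d (\<sigma>s ! i)" using \<sigma>s(2) by simp
    from someI_ex[OF this] show "irreducible_rep H (ds ! i) (\<sigma>s ! i)" using i by (simp add: ds_def)
  qed (simp add: ds_def)
  \<comment> \<open>The degrees are chosen separately for each summand; comparing matrix sizes at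
    the unit of the group shows that they add up to n.\<close>
  have "direct_sum_rep \<sigma>s \<one>\<^bsub>H\<^esub> \<in> carrier_mat n n" using rep by (auto simp: representation_iff)
  moreover have "direct_sum_rep \<sigma>s \<one>\<^bsub>H\<^esub> \<in> carrier_mat (sum_list ds) (sum_list ds)"
    by (rule irreducible_rep_carrier[OF irr]) simp
  ultimately have "sum_list ds = n" by (metis carrier_matD(1))
  then show ?thesis using irr \<sigma>s(1) P by (intro that[of ds \<sigma>s P]) (auto simp: ds_def GL_iff)
qed

lemma hyperbolic_of_components_exceed:
  fixes \<rho> :: "'h \<Rightarrow> rat mat"
  assumes m: "m \<ge> 1" and H: "group H" "finite (carrier H)" and irr\<rho>: "irreducible_rep H n \<rho>"
    and splits: "splits_in_components H n (real_extension \<rho>) k" and c: "c < m * k"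
  shows "\<exists>C \<in> carrier (GL (m * n)). integer_like C \<and> c_hyperbolic c C \<and>
            (\<forall>h \<in> carrier H. C * multiple_rep m \<rho> h = multiple_rep m \<rho> h * C)"
proof -
  have \<rho>c: "\<rho> h \<in> carrier_mat n n" if "h \<in> carrier H" for h
    using irr\<rho> that by (simp add: irreducible_rep_iff representation_iff)
  have n0: "n > 0" using irr\<rho> by (simp add: irreducible_rep_iff)
  obtain ds \<sigma>s P where ds: "list_all2 (irreducible_rep H) ds \<sigma>s" "sum_list ds = n" "length ds = k"
    "P \<in> carrier_mat n n" "det P \<noteq> 0" "\<And>h. h \<in> carrier H \<Longrightarrow> real_extension \<rho> h * P = P * direct_sum_rep \<sigma>s h"
    using splits_in_components_obtain[OF H(1) splits] by blast
  obtain S U V f N where S: "S \<in> carrier_mat n n" "\<forall>h \<in> carrier H. S * \<rho> h = \<rho> h * S"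
    and U: "U \<in> carrier_mat n n" and V: "V \<in> carrier_mat n n" "U * V = 1\<^sub>m n" "V * U = 1\<^sub>m n"
    and f: "map_mat real_of_rat S = U * mat_diag n f * V"
      "\<forall>i<n. card {j. j < n \<and> f j = f i} = N" "card (f ` {..<n}) = length ds"
    by (rule real_components_equal_degree[OF H irr\<rho> ds(1,2,4,5,6)]) (assumption | rule that)+
  obtain D :: int and Z where D: "D > 0" "Z \<in> carrier_mat n n" "map_mat rat_of_int Z = rat_of_int D \<cdot>\<^sub>m S"
    by (rule integer_multiple_mat[OF S(1)])
  \<comment> \<open>The eigenvalues of the integral multiple \<open>Z\<close> of \<open>S\<close>.
    Scaling by the nonzero \<open>D\<close> preserves both their number and their
    multiplicities.\<close>
  define g where "g i = real_of_int D * f i" for i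
  have inj: "inj (\<lambda>x :: real. real_of_int D * x)" using D(1) by (auto simp: inj_on_def)
  have commZ: "map_mat rat_of_int Z * \<rho> h = \<rho> h * map_mat rat_of_int Z" if "h \<in> carrier H" for h
    unfolding D(3) using S(2) that mult_smult_assoc_mat[OF S(1) \<rho>c[OF that]] mult_smult_distrib[OF \<rho>c[OF that] S(1)]
    by simp
  have "map_mat real_of_int Z = map_mat real_of_rat (map_mat rat_of_int Z)" by (intro eq_matI) auto
  also have "\<dots> = real_of_int D \<cdot>\<^sub>m map_mat real_of_rat S"
    unfolding D(3) by (intro eq_matI) (auto simp: of_rat_mult)
  finally have diagZ: "map_mat real_of_int Z = U * mat_diag n g * V"
    unfolding f(1) smult_conjugate_diag[OF U V(1)] g_def .
  have multg: "card {j. j < n \<and> g j = g i} = N" if "i < n" for i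
    using f(2) that D(1) by (simp add: g_def)
  have "g ` {..<n} = (\<lambda>x. real_of_int D * x) ` f ` {..<n}" by (auto simp: g_def)
  then have cardg: "card (g ` {..<n}) = k"
    using card_image[OF inj_on_subset[OF inj subset_UNIV], of "f ` {..<n}"] f(3) ds(3) by simp
  have x0: "g 0 \<in> g ` {..<n}" using n0 by simp
  have k1: "k \<ge> 1" using c by (cases k) auto
  obtain K :: real where K: "K \<ge> 1"
    and inf: "infinite {b :: nat. b \<ge> 1 \<and> (\<exists>(w :: int mat) (\<omega> :: real \<Rightarrow> real). w \<in> carrier_mat n n \<and> det w = 1 \<and>
       (\<forall>h \<in> carrier H. map_mat rat_of_int w * \<rho> h = \<rho> h * map_mat rat_of_int w) \<and>
       map_mat real_of_int w = U * mat_diag n (\<lambda>i. \<omega> (g i)) * V \<and>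
       real b ^ (k - 1) \<le> K * \<bar>\<omega> (g 0)\<bar> \<and> \<bar>\<omega> (g 0)\<bar> \<le> K * real b ^ (k - 1) \<and>
       (\<forall>x \<in> g ` {..<n} - {g 0}. 1 \<le> K * real b * \<bar>\<omega> x\<bar> \<and> real b * \<bar>\<omega> x\<bar> \<le> K))}"
    by (rule commutant_units[OF irr\<rho> D(2) commZ U V diagZ multg cardg x0]) (assumption | rule that)+
  \<comment> \<open>The constant of \<open>companion_root_bounds\<close>. It depends on K and m
    only, so b can be taken beyond \<open>Q ^ M\<close> afterwards; this is what the infinitely many
    b are for.\<close>
  define Q where "Q = 2 * K ^ m"
  have Q1: "Q \<ge> 1" unfolding Q_def using one_le_power[OF K, of m] by simp
  define M where "M = k * m"
  obtain b w \<omega> where b: "b > nat \<lceil>Q ^ M\<rceil>" "b \<ge> 1"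
    and w: "w \<in> carrier_mat n n" "det w = 1"
      "\<forall>h \<in> carrier H. map_mat rat_of_int w * \<rho> h = \<rho> h * map_mat rat_of_int w"
      "map_mat real_of_int w = U * mat_diag n (\<lambda>i. \<omega> (g i)) * V"
    and \<omega>0: "real b ^ (k - 1) \<le> K * \<bar>\<omega> (g 0)\<bar>" "\<bar>\<omega> (g 0)\<bar> \<le> K * real b ^ (k - 1)"
    and \<omega>: "\<forall>x \<in> g ` {..<n} - {g 0}. 1 \<le> K * real b * \<bar>\<omega> x\<bar> \<and> real b * \<bar>\<omega> x\<bar> \<le> K"
    using inf unfolding infinite_nat_iff_unbounded by blast
  have bQ: "real b > Q ^ M" using b(1) by linarith
  have b1: "real b \<ge> 1" using b(2) by simp
  \<comment> \<open>With this factor s z^(m - 1) = (b z)^(m - 1), so the equation for an eigenvalue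
    z becomes one for b z in which b enters only through W.\<close>
  define s where "s = int (b ^ (m - 1))"
  define B where "B = companion_block m n (w ^\<^sub>m m) (s \<cdot>\<^sub>m (w ^\<^sub>m m))"
  define C where "C = map_mat rat_of_int (block_mat m n B)"
  have u: "w ^\<^sub>m m \<in> carrier_mat n n" by (rule pow_carrier_mat[OF w(1)])
  have Bc: "B a c \<in> carrier_mat n n" for a c unfolding B_def by (rule companion_block_carrier) (use u in auto)
  have C: "C \<in> carrier (GL (m * n))" "integer_like C"
    unfolding C_def B_def by (rule companion_of_unit[OF m w(1,2)])+
  have commute: "C * multiple_rep m \<rho> h = multiple_rep m \<rho> h * C" if h: "h \<in> carrier H" for h
  proof -
    let ?w = "map_mat rat_of_int w"
    have wc: "?w \<in> carrier_mat n n" using w by simp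
    have pow: "map_mat rat_of_int (w ^\<^sub>m m) = ?w ^\<^sub>m m" by (rule of_int_hom.mat_hom_pow[OF w(1)])
    have wp: "?w ^\<^sub>m l * \<rho> h = \<rho> h * ?w ^\<^sub>m l" for l
    proof (induction l)
      case (Suc l)
      have p: "?w ^\<^sub>m l \<in> carrier_mat n n" by (rule pow_carrier_mat[OF wc])
      have "?w ^\<^sub>m Suc l * \<rho> h = ?w ^\<^sub>m l * (?w * \<rho> h)" using assoc_mult_mat[OF p wc \<rho>c[OF h]] by simp
      also have "\<dots> = ?w ^\<^sub>m l * \<rho> h * ?w" using w(3) h assoc_mult_mat[OF p \<rho>c[OF h] wc] by simp
      also have "\<dots> = \<rho> h * ?w ^\<^sub>m Suc l" unfolding Suc using assoc_mult_mat[OF \<rho>c[OF h] p wc] by simp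
      finally show ?case .
    qed (use \<rho>c[OF h] wc in simp)
    have p: "?w ^\<^sub>m m \<in> carrier_mat n n" by (rule pow_carrier_mat[OF wc])
    have sm: "map_mat rat_of_int (s \<cdot>\<^sub>m (w ^\<^sub>m m)) = of_int s \<cdot>\<^sub>m ?w ^\<^sub>m m"
      unfolding pow[symmetric] by (intro eq_matI) auto
    have z: "map_mat rat_of_int (0\<^sub>m n n) = 0\<^sub>m n n" by (intro eq_matI) auto
    have "map_mat rat_of_int (B a c) * \<rho> h = \<rho> h * map_mat rat_of_int (B a c)" for a c
      using \<rho>c[OF h] wp[of m] mult_smult_assoc_mat[OF p \<rho>c[OF h]] mult_smult_distrib[OF \<rho>c[OF h] p]
      by (simp add: B_def companion_block_def pow sm z of_int_hom.mat_hom_one)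
    then show ?thesis
      unfolding C_def map_block_mat[OF Bc] using Bc \<rho>c[OF h]
      by (intro block_mat_commute_multiple_rep) auto
  qed
  have scale: "(1 \<le> Q * (real b * cmod z) \<and> real b * cmod z \<le> Q) \<or>
      (real b ^ M \<le> Q * (real b * cmod z) \<and> real b * cmod z \<le> Q * real b ^ M)"
    if z: "z \<in> spectrum (map_mat of_rat C)" for z
  proof -
    obtain i where i: "i < n" "z ^ m = complex_of_real (\<omega> (g i)) ^ m * (1 + (if m = 1 then 0 else of_int s * z ^ (m - 1)))"
      using companion_of_unit_eigenvalue[OF m w(1) U V w(4) z[unfolded C_def B_def]] by blast
    define \<mu> where "\<mu> = of_nat b * z"
    define W where "W = real b * \<omega> (g i)"
    have cm: "cmod \<mu> = real b * cmod z" by (simp add: \<mu>_def norm_mult)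
    have "\<mu> ^ m = of_nat b ^ m * z ^ m" by (simp add: \<mu>_def power_mult_distrib)
    also have "\<dots> = complex_of_real W ^ m * (1 + (if m = 1 then 0 else \<mu> ^ (m - 1)))"
      unfolding i(2) by (simp add: W_def \<mu>_def s_def power_mult_distrib)
    finally have eq: "\<mu> ^ m = complex_of_real W ^ m * (1 + (if m = 1 then 0 else \<mu> ^ (m - 1)))" .
    show ?thesis
    proof (cases "g i = g 0")
      case True
      \<comment> \<open>The large eigenvalue of \<open>w\<close> has order b^(k - 1), so W has order
        b^k and the upper scale is (b^k)^m = b^M.\<close>
      have bk: "real b ^ k = real b * real b ^ (k - 1)" using k1 by (cases k) auto
      have "real b ^ k \<le> K * \<bar>W\<bar>"
        using mult_left_mono[OF \<omega>0(1), of "real b"] b1 by (simp add: W_def True bk abs_mult mult_ac)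
      moreover have "\<bar>W\<bar> \<le> K * real b ^ k"
        using mult_left_mono[OF \<omega>0(2), of "real b"] b1 by (simp add: W_def True bk abs_mult mult_ac)
      ultimately show ?thesis
        using companion_root_bounds[OF m K one_le_power[OF b1] _ _ eq, of k] unfolding Q_def cm M_def power_mult by simp
    next
      case False
      \<comment> \<open>The other eigenvalues of \<open>w\<close> have order 1/b, so W has order 1.
        With B = 1 both alternatives of the bound say that b z has order 1.\<close>
      then have "1 \<le> K * \<bar>W\<bar>" "\<bar>W\<bar> \<le> K * 1"
        using \<omega> i(1) b1 by (simp_all add: W_def abs_mult mult_ac)
      then show ?thesis
        using companion_root_bounds[OF m K order_refl _ _ eq] unfolding Q_def cm by simp
    qed
  qed
  have "c_hyperbolic c C"
    unfolding c_hyperbolic_def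
  proof
    assume "\<exists>ls :: complex list. 1 \<le> length ls \<and> length ls \<le> c \<and>
          set ls \<subseteq> spectrum (map_mat of_rat C) \<and> cmod (prod_list ls) = 1"
    then obtain ls :: "complex list" where ls: "1 \<le> length ls" "length ls \<le> c"
      "set ls \<subseteq> spectrum (map_mat of_rat C)" "cmod (prod_list ls) = 1" by blast
    have "length ls < M" using ls(2) c by (simp add: M_def mult.commute)
    then show False
      using no_unit_product_of_two_scales[OF Q1 bQ ls(1)] scale ls(3,4) by blast
  qed
  then show ?thesis using C commute by blast
qed

theorem theorem1p2:
  fixes c m n :: nat
    and H :: "('h, 'b) monoid_scheme"
    and \<rho> :: "'h \<Rightarrow> rat mat"
  assumes "c \<ge> 1" and "m \<ge> 1"
    and "group H" and "finite (carrier H)"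
    and "irreducible_rep H n \<rho>"
  shows "(\<exists>C \<in> carrier (GL (m * n)). integer_like C \<and> c_hyperbolic c C \<and>
            (\<forall>h \<in> carrier H. C * multiple_rep m \<rho> h = multiple_rep m \<rho> h * C))
     \<longleftrightarrow> (\<exists>k. splits_in_components H n (real_extension \<rho>) k \<and> real k > real c / real m)"
proof -
  have "real c / real m < real k \<longleftrightarrow> c < m * k" for k
    using assms(2) by (simp add: pos_divide_less_eq mult.commute flip: of_nat_mult)
  then show ?thesis
    using components_exceed_of_hyperbolic[OF assms(2-5)] hyperbolic_of_components_exceed[OF assms(2-5)] by blast
qed

end
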